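(* Let $(\Sigma,\sigma)$ be a topologically transitive subshift of finite type. Let $F\colon\Sigma\to(0,\infty)$ be a potential with $\alpha$-bounded Hölder variations for some $\alpha>0$, let $\mathcal L$ be the Ruelle transfer operator associated with $F$, and let $\rho$ be its spectral radius. Let $G$ be a finitely generated group and $\theta\colon\Sigma\to G$ a locally constant map. Assume that the extension $(\Sigma_\theta,\sigma_\theta)$ of $(\Sigma,\sigma)$ by $\theta$ has the visibility property. Then the following hold. (i) For every finite subset $S$ of $G$ and every $\epsilon>0$ there exists $\eta>0$ with the following property: for every set $Y$ with an action of $G$, with induced unitary representation $\lambda\colon G\to\mathcal U(\ell^2(Y))$, twisted transfer operator $\mathcal L_\lambda$ and spectral radius $\rho_\lambda$ of $\mathcal L_\lambda$, if $\rho_\lambda>(1-\eta)\rho$ then $\lambda$ admits an $(S,\epsilon)$-invariant vector. (ii) In particular, if $\rho_\lambda=\rho$ then the action of $G$ on $Y$ is amenable.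
   Context: Subshifts: let $\mathcal A$ be a finite alphabet, $\sigma$ the shift on $\mathcal A^{\mathbb N}$, and $d(x,y)=e^{-n}$ where $n$ is the length of the longest common prefix of $x,y$. A subshift $\Sigma\subset\mathcal A^{\mathbb N}$ is a closed $\sigma$-invariant subset; a finite word is admissible if it is a prefix of an element of $\Sigma$. $\Sigma$ is of finite type if there is $N$ such that $x\in\mathcal A^{\mathbb N}$ belongs to $\Sigma$ iff every subword of length $N$ of $x$ is admissible. It is topologically transitive (irreducible) if for all admissible words $w,w'$ there is an admissible word $w_0$ such that the concatenation $ww_0w'$ is admissible. Function spaces: for a Banach space $E$ and $\Phi\colon\Sigma\to E$, let $\|\Phi\|_\infty=\sup_x\|\Phi(x)\|$, $\Delta_\alpha(\Phi)=\sup_{x\ne y}\|\Phi(x)-\Phi(y)\|/d(x,y)^\alpha$, $\|\Phi\|_{\infty,\alpha}=\|\Phi\|_\infty+\Delta_\alpha(\Phi)$, and $H^\infty_\alpha(\Sigma,E)=\{\Phi:\|\Phi\|_{\infty,\alpha}<\infty\}$, a Banach space. "$F$ has $\alpha$-bounded Hölder variations" means $\ln F\in H^\infty_\alpha(\Sigma,\mathbb R)$ (equivalently $F\in H^\infty_\alpha(\Sigma,\mathbb R)$, $F$ being positive and continuous on a compact space). Operators: $\mathcal L\Phi(x)=\sum_{\sigma y=x}F(y)\Phi(y)$ is viewed as a bounded operator of $H^\infty_\alpha(\Sigma,\mathbb C)$. If $G$ acts on $Y$, put $\mathcal H=\ell^2(Y)$ and $[\lambda(g)\phi](y)=\phi(g^{-1}y)$.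 The twisted transfer operator is the bounded operator of $H^\infty_\alpha(\Sigma,\mathcal H)$ given by $\mathcal L_\lambda\Phi(x)=\sum_{\sigma y=x}F(y)\lambda(\theta(y))^{-1}\Phi(y)$. Extension: $\Sigma_\theta=\Sigma\times G$, $\sigma_\theta(x,g)=(\sigma x,g\theta(x))$; $\theta_n(x)=\theta(x)\theta(\sigma x)\cdots\theta(\sigma^{n-1}x)$, $\theta_0=1$. It has the visibility property if there is a finite subset $U\subset G$ such that for every $g\in G$ there are $x\in\Sigma$, $n\in\mathbb N$, $u_1,u_2\in U$ with $g=u_1\theta_n(x)u_2$. A vector $\phi$ is $(S,\epsilon)$-invariant for $\lambda$ if $\sup_{s\in S}\|\lambda(s)\phi-\phi\|<\epsilon\|\phi\|$. The action of $G$ on $Y$ is amenable if for all finite $S\subset G$ and $\epsilon>0$ the representation $\lambda$ has an $(S,\epsilon)$-invariant vector (equivalently, $Y$ has a $G$-invariant mean). *)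

theory Defs
  imports "HOL-Analysis.Analysis" "HOL-Algebra.Group_Action" "HOL-Algebra.Generated_Groups"
begin

section \<open>Subshifts\<close>

definition shift :: "(nat \<Rightarrow> 'a) \<Rightarrow> nat \<Rightarrow> 'a" where
  "shift x = (\<lambda>n. x (Suc n))"

text \<open>For \<open>x \<noteq> y\<close> the longest common prefix has length \<open>LEAST n. x n \<noteq> y n\<close>.\<close>

definition shift_dist :: "(nat \<Rightarrow> 'a) \<Rightarrow> (nat \<Rightarrow> 'a) \<Rightarrow> real" where
  "shift_dist x y = (if x = y then 0 else exp (- real (LEAST n. x n \<noteq> y n)))"

lemma Metric_space_shift_dist: "Metric_space UNIV shift_dist"
proof
  fix x y z :: "nat \<Rightarrow> 'a"
  show "0 \<le> shift_dist x y" by (simp add: shift_dist_def)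
  show "shift_dist x y = shift_dist y x" by (simp add: shift_dist_def eq_commute)
  show "(shift_dist x y = 0) = (x = y)" by (simp add: shift_dist_def)
  show "shift_dist x z \<le> shift_dist x y + shift_dist y z"
  proof (cases "x = y \<or> y = z \<or> x = z")
    case True
    then show ?thesis by (auto simp: shift_dist_def)
  next
    case False
    define a b c where "a = (LEAST n. x n \<noteq> y n)" and "b = (LEAST n. y n \<noteq> z n)"
      and "c = (LEAST n. x n \<noteq> z n)"
    have "\<exists>n. x n \<noteq> z n" using False by (simp add: fun_eq_iff)
    then have "x c \<noteq> z c" unfolding c_def by (rule LeastI_ex)
    then have "x c \<noteq> y c \<or> y c \<noteq> z c" by auto
    then have "a \<le> c \<or> b \<le> c"
      using Least_le[of "\<lambda>n. x n \<noteq> y n" c] Least_le[of "\<lambda>n. y n \<noteq> z n" c]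
      unfolding a_def[symmetric] b_def[symmetric] by blast
    then have "exp (- real c) \<le> exp (- real a) \<or> exp (- real c) \<le> exp (- real b)" by auto
    then have "exp (- real c) \<le> exp (- real a) + exp (- real b)"
      using exp_ge_zero[of "- real a"] exp_ge_zero[of "- real b"] by linarith
    then show ?thesis
      using False unfolding shift_dist_def a_def b_def c_def by simp
  qed
qed

definition subshift :: "(nat \<Rightarrow> 'a) set \<Rightarrow> bool" where
  "subshift X \<longleftrightarrow>
     closedin (Metric_space.mtopology UNIV shift_dist) X \<and> shift ` X \<subseteq> X"

definition subword :: "(nat \<Rightarrow> 'a) \<Rightarrow> nat \<Rightarrow> nat \<Rightarrow> 'a list" where
  "subword x i n = map x [i..<i + n]"

definition admissible :: "(nat \<Rightarrow> 'a) set \<Rightarrow> 'a list \<Rightarrow> bool" where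
  "admissible X w \<longleftrightarrow> (\<exists>x\<in>X. w = subword x 0 (length w))"

definition finite_type :: "(nat \<Rightarrow> 'a) set \<Rightarrow> bool" where
  "finite_type X \<longleftrightarrow> (\<exists>N. \<forall>x. x \<in> X \<longleftrightarrow> (\<forall>i. admissible X (subword x i N)))"

definition topologically_transitive :: "(nat \<Rightarrow> 'a) set \<Rightarrow> bool" where
  "topologically_transitive X \<longleftrightarrow>
     (\<forall>w w'. admissible X w \<longrightarrow> admissible X w' \<longrightarrow>
        (\<exists>w0. admissible X w0 \<and> admissible X (w @ w0 @ w')))"


section \<open>Complex normed vector spaces\<close>

class complex_normed_vector = real_normed_vector +
  fixes scaleC :: "complex \<Rightarrow> 'a \<Rightarrow> 'a" (infixr \<open>*\<^sub>C\<close> 75)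
  assumes scaleC_add_right: "c *\<^sub>C (x + y) = c *\<^sub>C x + c *\<^sub>C y"
    and scaleC_add_left: "(b + c) *\<^sub>C x = b *\<^sub>C x + c *\<^sub>C x"
    and scaleC_scaleC: "b *\<^sub>C c *\<^sub>C x = (b * c) *\<^sub>C x"
    and scaleC_of_real: "complex_of_real r *\<^sub>C x = r *\<^sub>R x"
    and norm_scaleC: "norm (c *\<^sub>C x) = cmod c * norm x"

instantiation complex :: complex_normed_vector
begin

definition scaleC_complex :: "complex \<Rightarrow> complex \<Rightarrow> complex" where
  "scaleC_complex = (*)"

instance
  by standard
    (simp_all only: scaleC_complex_def distrib_left distrib_right mult.assoc norm_mult scaleR_conv_of_real)

end


section \<open>Square summable functions\<close>

typedef 'y ell2 = "{f :: 'y \<Rightarrow> complex. (\<lambda>y. (cmod (f y))\<^sup>2) summable_on UNIV}"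
  by (rule exI[of _ "\<lambda>_. 0"]) simp

setup_lifting type_definition_ell2

lemma ell2_minkowski:
  fixes f g :: "'y \<Rightarrow> complex"
  assumes f: "(\<lambda>y. (cmod (f y))\<^sup>2) summable_on UNIV"
    and g: "(\<lambda>y. (cmod (g y))\<^sup>2) summable_on UNIV"
  shows "(\<lambda>y. (cmod (f y + g y))\<^sup>2) summable_on UNIV"
    and "sqrt (\<Sum>\<^sub>\<infinity>y. (cmod (f y + g y))\<^sup>2)
           \<le> sqrt (\<Sum>\<^sub>\<infinity>y. (cmod (f y))\<^sup>2) + sqrt (\<Sum>\<^sub>\<infinity>y. (cmod (g y))\<^sup>2)"
proof -
  define A B where "A = sqrt (\<Sum>\<^sub>\<infinity>y. (cmod (f y))\<^sup>2)" and "B = sqrt (\<Sum>\<^sub>\<infinity>y. (cmod (g y))\<^sup>2)"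
  have AB: "0 \<le> A + B" by (simp add: A_def B_def infsum_nonneg)
  have fin: "(\<Sum>y\<in>F. (cmod (f y + g y))\<^sup>2) \<le> (A + B)\<^sup>2" if "finite F" for F
  proof -
    have "L2_set (\<lambda>y. cmod (f y + g y)) F \<le> L2_set (\<lambda>y. cmod (f y) + cmod (g y)) F"
      by (intro L2_set_mono norm_triangle_ineq) auto
    also have "\<dots> \<le> L2_set (\<lambda>y. cmod (f y)) F + L2_set (\<lambda>y. cmod (g y)) F"
      by (rule L2_set_triangle_ineq)
    also have "\<dots> \<le> A + B"
      unfolding L2_set_def A_def B_def
      by (intro add_mono real_sqrt_le_mono finite_sum_le_infsum f g that) auto
    finally show ?thesis
      unfolding L2_set_def by (rule sqrt_le_D)
  qed
  show sm: "(\<lambda>y. (cmod (f y + g y))\<^sup>2) summable_on UNIV"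
    by (rule nonneg_bdd_above_summable_on) (auto intro!: bdd_aboveI[of _ "(A + B)\<^sup>2"] fin)
  have "(\<Sum>\<^sub>\<infinity>y. (cmod (f y + g y))\<^sup>2) \<le> (A + B)\<^sup>2"
    by (rule infsum_le_finite_sums[OF sm]) (auto intro: fin)
  then show "sqrt (\<Sum>\<^sub>\<infinity>y. (cmod (f y + g y))\<^sup>2)
           \<le> sqrt (\<Sum>\<^sub>\<infinity>y. (cmod (f y))\<^sup>2) + sqrt (\<Sum>\<^sub>\<infinity>y. (cmod (g y))\<^sup>2)"
    unfolding A_def[symmetric] B_def[symmetric] using AB by (rule real_le_lsqrt[rotated -1])
qed

lemma ell2_summable_scale:
  "(\<lambda>y. (cmod (f y))\<^sup>2) summable_on UNIV \<Longrightarrow> (\<lambda>y. (cmod (c * f y))\<^sup>2) summable_on UNIV"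
  unfolding norm_mult power_mult_distrib by (rule summable_on_cmult_right)

lemma ell2_norm_scale:
  "sqrt (\<Sum>\<^sub>\<infinity>y. (cmod (c * f y))\<^sup>2) = cmod c * sqrt (\<Sum>\<^sub>\<infinity>y. (cmod (f y))\<^sup>2)"
  unfolding norm_mult power_mult_distrib infsum_cmult_right' real_sqrt_mult by simp

instantiation ell2 :: (type) complex_normed_vector
begin

lift_definition zero_ell2 :: "'a ell2" is "\<lambda>_. 0" by simp

lift_definition plus_ell2 :: "'a ell2 \<Rightarrow> 'a ell2 \<Rightarrow> 'a ell2" is "\<lambda>f g y. f y + g y"
  by (rule ell2_minkowski)

lift_definition uminus_ell2 :: "'a ell2 \<Rightarrow> 'a ell2" is "\<lambda>f y. - f y" by simp

lift_definition minus_ell2 :: "'a ell2 \<Rightarrow> 'a ell2 \<Rightarrow> 'a ell2" is "\<lambda>f g y. f y - g y"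
  subgoal for f g using ell2_minkowski(1)[of f "\<lambda>y. - g y"] by simp
  done

lift_definition scaleC_ell2 :: "complex \<Rightarrow> 'a ell2 \<Rightarrow> 'a ell2" is "\<lambda>c f y. c * f y"
  by (rule ell2_summable_scale)

lift_definition scaleR_ell2 :: "real \<Rightarrow> 'a ell2 \<Rightarrow> 'a ell2" is "\<lambda>r f y. complex_of_real r * f y"
  by (rule ell2_summable_scale)

lift_definition norm_ell2 :: "'a ell2 \<Rightarrow> real" is "\<lambda>f. sqrt (\<Sum>\<^sub>\<infinity>y. (cmod (f y))\<^sup>2)" .

definition dist_ell2 :: "'a ell2 \<Rightarrow> 'a ell2 \<Rightarrow> real" where
  "dist_ell2 f g = norm (f - g)"

definition sgn_ell2 :: "'a ell2 \<Rightarrow> 'a ell2" where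
  "sgn_ell2 f = scaleR (inverse (norm f)) f"

definition uniformity_ell2 :: "('a ell2 \<times> 'a ell2) filter" where
  "uniformity_ell2 = (INF e\<in>{0<..}. principal {(f, g). dist f g < e})"

definition open_ell2 :: "'a ell2 set \<Rightarrow> bool" where
  "open_ell2 U = (\<forall>f\<in>U. eventually (\<lambda>(f', g). f' = f \<longrightarrow> g \<in> U) uniformity)"

instance
proof
  fix f g h :: "'a ell2" and a b :: real and c d :: complex
  show "f + g + h = f + (g + h)" by transfer (simp add: algebra_simps)
  show "f + g = g + f" by transfer (simp add: algebra_simps)
  show "0 + f = f" by transfer simp
  show "- f + f = 0" by transfer simp
  show "f - g = f + - g" by transfer simp
  show "a *\<^sub>R (f + g) = a *\<^sub>R f + a *\<^sub>R g" by transfer (simp add: algebra_simps)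
  show "(a + b) *\<^sub>R f = a *\<^sub>R f + b *\<^sub>R f" by transfer (simp add: algebra_simps)
  show "a *\<^sub>R b *\<^sub>R f = (a * b) *\<^sub>R f" by transfer (simp add: algebra_simps)
  show "1 *\<^sub>R f = f" by transfer simp
  show "dist f g = norm (f - g)" by (rule dist_ell2_def)
  show "sgn f = inverse (norm f) *\<^sub>R f" by (rule sgn_ell2_def)
  show "(uniformity :: ('a ell2 \<times> 'a ell2) filter)
          = (INF e\<in>{0<..}. principal {(f, g). dist f g < e})"
    by (rule uniformity_ell2_def)
  show "open U = (\<forall>f\<in>U. \<forall>\<^sub>F (f', g) in uniformity. f' = f \<longrightarrow> g \<in> U)" for U :: "'a ell2 set"
    by (rule open_ell2_def)
  show "norm f = 0 \<longleftrightarrow> f = 0"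
  proof transfer
    fix f :: "'a \<Rightarrow> complex"
    assume f: "(\<lambda>y. (cmod (f y))\<^sup>2) summable_on UNIV"
    have "f y = 0" if zero: "(\<Sum>\<^sub>\<infinity>y. (cmod (f y))\<^sup>2) = 0" for y
    proof -
      have "(\<Sum>y\<in>{y}. (cmod (f y))\<^sup>2) \<le> (\<Sum>\<^sub>\<infinity>y. (cmod (f y))\<^sup>2)"
        by (rule finite_sum_le_infsum[OF f]) simp_all
      then have "(cmod (f y))\<^sup>2 \<le> 0" unfolding zero by simp
      then show ?thesis by simp
    qed
    then show "(sqrt (\<Sum>\<^sub>\<infinity>y. (cmod (f y))\<^sup>2) = 0) = (f = (\<lambda>_. 0))"
      unfolding real_sqrt_eq_0_iff by (intro iffI ext) simp_all
  qed
  show "norm (f + g) \<le> norm f + norm g" by transfer (rule ell2_minkowski(2))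
  show "norm (a *\<^sub>R f) = \<bar>a\<bar> * norm f" by transfer (subst ell2_norm_scale, simp)
  show "c *\<^sub>C (f + g) = c *\<^sub>C f + c *\<^sub>C g" by transfer (simp add: algebra_simps)
  show "(c + d) *\<^sub>C f = c *\<^sub>C f + d *\<^sub>C f" by transfer (simp add: algebra_simps)
  show "c *\<^sub>C d *\<^sub>C f = (c * d) *\<^sub>C f" by transfer (simp add: algebra_simps)
  show "complex_of_real a *\<^sub>C f = a *\<^sub>R f" by transfer simp
  show "norm (c *\<^sub>C f) = cmod c * norm f" by transfer (rule ell2_norm_scale)
qed

end

text \<open>The Hilbert space \<open>\<ell>\<^sup>2(Y)\<close> of a set \<open>Y\<close> in the type \<open>'y\<close>, realised inside \<open>'y ell2\<close> as the
  functions vanishing off \<open>Y\<close>.\<close>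

definition ell2_on :: "'y set \<Rightarrow> 'y ell2 set" where
  "ell2_on Y = {\<phi>. \<forall>y. y \<notin> Y \<longrightarrow> Rep_ell2 \<phi> y = 0}"


section \<open>Hoelder spaces and bounded operators on them\<close>

text \<open>Suprema are taken in \<open>ennreal\<close>, where the supremum of the empty set is \<open>0\<close>.\<close>

definition holder_norm ::
    "real \<Rightarrow> (nat \<Rightarrow> 'a) set \<Rightarrow> ((nat \<Rightarrow> 'a) \<Rightarrow> 'e::real_normed_vector) \<Rightarrow> ennreal" where
  "holder_norm \<alpha> X \<Phi> =
     (SUP x\<in>X. ennreal (norm (\<Phi> x))) +
     (SUP (x, y)\<in>{(x, y). x \<in> X \<and> y \<in> X \<and> x \<noteq> y}.
        ennreal (norm (\<Phi> x - \<Phi> y) / shift_dist x y powr \<alpha>))"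

text \<open>\<open>E\<close> is a linear subspace of the ambient type. Functions on \<open>X\<close> are represented by functions
  on all sequences that vanish off \<open>X\<close>.\<close>

definition holder_space ::
    "real \<Rightarrow> (nat \<Rightarrow> 'a) set \<Rightarrow> 'e::real_normed_vector set \<Rightarrow> ((nat \<Rightarrow> 'a) \<Rightarrow> 'e) set" where
  "holder_space \<alpha> X E =
     {\<Phi>. (\<forall>x\<in>X. \<Phi> x \<in> E) \<and> (\<forall>x. x \<notin> X \<longrightarrow> \<Phi> x = 0) \<and> holder_norm \<alpha> X \<Phi> < \<infinity>}"

definition bounded_op ::
    "real \<Rightarrow> (nat \<Rightarrow> 'a) set \<Rightarrow> 'e::complex_normed_vector set \<Rightarrow>
     (((nat \<Rightarrow> 'a) \<Rightarrow> 'e) \<Rightarrow> ((nat \<Rightarrow> 'a) \<Rightarrow> 'e)) \<Rightarrow> bool" where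
  "bounded_op \<alpha> X E T \<longleftrightarrow>
     (\<forall>\<Phi>\<in>holder_space \<alpha> X E. T \<Phi> \<in> holder_space \<alpha> X E) \<and>
     (\<forall>\<Phi>\<in>holder_space \<alpha> X E. \<forall>\<Psi>\<in>holder_space \<alpha> X E.
        T (\<lambda>x. \<Phi> x + \<Psi> x) = (\<lambda>x. T \<Phi> x + T \<Psi> x)) \<and>
     (\<forall>c. \<forall>\<Phi>\<in>holder_space \<alpha> X E. T (\<lambda>x. c *\<^sub>C \<Phi> x) = (\<lambda>x. c *\<^sub>C T \<Phi> x)) \<and>
     (\<exists>C::real. \<forall>\<Phi>\<in>holder_space \<alpha> X E. holder_norm \<alpha> X (T \<Phi>) \<le> ennreal C * holder_norm \<alpha> X \<Phi>)"

definition holder_spectrum ::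
    "real \<Rightarrow> (nat \<Rightarrow> 'a) set \<Rightarrow> 'e::complex_normed_vector set \<Rightarrow>
     (((nat \<Rightarrow> 'a) \<Rightarrow> 'e) \<Rightarrow> ((nat \<Rightarrow> 'a) \<Rightarrow> 'e)) \<Rightarrow> complex set" where
  "holder_spectrum \<alpha> X E T =
     {z. \<not> (\<exists>R. bounded_op \<alpha> X E R \<and>
              (\<forall>\<Phi>\<in>holder_space \<alpha> X E.
                 R (\<lambda>x. z *\<^sub>C \<Phi> x - T \<Phi> x) = \<Phi> \<and>
                 (\<lambda>x. z *\<^sub>C R \<Phi> x - T (R \<Phi>) x) = \<Phi>))}"

text \<open>The spectrum is empty exactly when the space is zero, for instance for \<open>\<ell>\<^sup>2\<close> of the empty set;
  inserting \<open>0\<close> gives the spectral radius the value \<open>0\<close> there and changes nothing otherwise.\<close>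

definition spectral_radius ::
    "real \<Rightarrow> (nat \<Rightarrow> 'a) set \<Rightarrow> 'e::complex_normed_vector set \<Rightarrow>
     (((nat \<Rightarrow> 'a) \<Rightarrow> 'e) \<Rightarrow> ((nat \<Rightarrow> 'a) \<Rightarrow> 'e)) \<Rightarrow> real" where
  "spectral_radius \<alpha> X E T = Sup (insert 0 (cmod ` holder_spectrum \<alpha> X E T))"

definition bounded_holder_variations ::
    "real \<Rightarrow> (nat \<Rightarrow> 'a) set \<Rightarrow> ((nat \<Rightarrow> 'a) \<Rightarrow> real) \<Rightarrow> bool" where
  "bounded_holder_variations \<alpha> X F \<longleftrightarrow> holder_norm \<alpha> X (\<lambda>x. ln (F x)) < \<infinity>"


section \<open>Actions and the induced representations\<close>

definition finitely_generated :: "('g, 'm) monoid_scheme \<Rightarrow> bool" where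
  "finitely_generated G \<longleftrightarrow> (\<exists>A. finite A \<and> A \<subseteq> carrier G \<and> generate G A = carrier G)"

definition induced_rep ::
    "('g, 'm) monoid_scheme \<Rightarrow> 'y set \<Rightarrow> ('g \<Rightarrow> 'y \<Rightarrow> 'y) \<Rightarrow> 'g \<Rightarrow> 'y ell2 \<Rightarrow> 'y ell2" where
  "induced_rep G Y act g \<phi> =
     Abs_ell2 (\<lambda>y. if y \<in> Y then Rep_ell2 \<phi> (act (inv\<^bsub>G\<^esub> g) y) else 0)"

lemma Rep_induced_rep:
  assumes "group_action G Y act" and "g \<in> carrier G"
  shows "Rep_ell2 (induced_rep G Y act g \<phi>) =
           (\<lambda>y. if y \<in> Y then Rep_ell2 \<phi> (act (inv\<^bsub>G\<^esub> g) y) else 0)"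
proof -
  interpret group_action G Y act by fact
  have "group G" using group_hom by (simp add: group_hom_def)
  then have "inv\<^bsub>G\<^esub> g \<in> carrier G" using assms(2) by (simp add: group.inv_closed)
  then have bij: "bij_betw (act (inv\<^bsub>G\<^esub> g)) Y Y"
    using bij_prop0 by (simp add: Bij_def)
  have "(\<lambda>y. (cmod (Rep_ell2 \<phi> y))\<^sup>2) summable_on Y"
    using Rep_ell2[of \<phi>] summable_on_subset_banach by blast
  then have "(\<lambda>y. (cmod (Rep_ell2 \<phi> (act (inv\<^bsub>G\<^esub> g) y)))\<^sup>2) summable_on Y"
    using summable_on_reindex_bij_betw[OF bij, of "\<lambda>y. (cmod (Rep_ell2 \<phi> y))\<^sup>2"] by simp
  then have "(\<lambda>y. (cmod (if y \<in> Y then Rep_ell2 \<phi> (act (inv\<^bsub>G\<^esub> g) y) else 0))\<^sup>2) summable_on UNIV"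
    by (rule summable_on_cong_neutral[THEN iffD1, rotated -1]) auto
  then show ?thesis unfolding induced_rep_def by (subst Abs_ell2_inverse) auto
qed

definition invariant_vector ::
    "('g, 'm) monoid_scheme \<Rightarrow> 'y set \<Rightarrow> ('g \<Rightarrow> 'y \<Rightarrow> 'y) \<Rightarrow> 'g set \<Rightarrow> real \<Rightarrow> 'y ell2 \<Rightarrow> bool" where
  "invariant_vector G Y act S \<epsilon> \<phi> \<longleftrightarrow>
     \<phi> \<in> ell2_on Y \<and>
     (SUP s\<in>S. ennreal (norm (induced_rep G Y act s \<phi> - \<phi>))) < ennreal (\<epsilon> * norm \<phi>)"

definition amenable_action ::
    "('g, 'm) monoid_scheme \<Rightarrow> 'y set \<Rightarrow> ('g \<Rightarrow> 'y \<Rightarrow> 'y) \<Rightarrow> bool" where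
  "amenable_action G Y act \<longleftrightarrow>
     (\<forall>S \<epsilon>. finite S \<longrightarrow> S \<subseteq> carrier G \<longrightarrow> 0 < \<epsilon> \<longrightarrow> (\<exists>\<phi>. invariant_vector G Y act S \<epsilon> \<phi>))"


section \<open>Group extensions\<close>

definition locally_constant_on :: "(nat \<Rightarrow> 'a) set \<Rightarrow> ((nat \<Rightarrow> 'a) \<Rightarrow> 'g) \<Rightarrow> bool" where
  "locally_constant_on X \<theta> \<longleftrightarrow>
     (\<forall>x\<in>X. \<exists>r>0. \<forall>y\<in>X. shift_dist x y < r \<longrightarrow> \<theta> y = \<theta> x)"

primrec cocycle ::
    "('g, 'm) monoid_scheme \<Rightarrow> ((nat \<Rightarrow> 'a) \<Rightarrow> 'g) \<Rightarrow> nat \<Rightarrow> (nat \<Rightarrow> 'a) \<Rightarrow> 'g" where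
  "cocycle G \<theta> 0 x = \<one>\<^bsub>G\<^esub>"
| "cocycle G \<theta> (Suc n) x = \<theta> x \<otimes>\<^bsub>G\<^esub> cocycle G \<theta> n (shift x)"

definition visibility ::
    "(nat \<Rightarrow> 'a) set \<Rightarrow> ('g, 'm) monoid_scheme \<Rightarrow> ((nat \<Rightarrow> 'a) \<Rightarrow> 'g) \<Rightarrow> bool" where
  "visibility X G \<theta> \<longleftrightarrow>
     (\<exists>U. finite U \<and> U \<subseteq> carrier G \<and>
        (\<forall>g\<in>carrier G. \<exists>x\<in>X. \<exists>n. \<exists>u1\<in>U. \<exists>u2\<in>U.
           g = u1 \<otimes>\<^bsub>G\<^esub> cocycle G \<theta> n x \<otimes>\<^bsub>G\<^esub> u2))"


section \<open>Transfer operators\<close>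

definition transfer_op ::
    "(nat \<Rightarrow> 'a) set \<Rightarrow> ((nat \<Rightarrow> 'a) \<Rightarrow> real) \<Rightarrow>
     ((nat \<Rightarrow> 'a) \<Rightarrow> complex) \<Rightarrow> (nat \<Rightarrow> 'a) \<Rightarrow> complex" where
  "transfer_op X F \<Phi> x =
     (if x \<in> X then \<Sum>y\<in>{y\<in>X. shift y = x}. complex_of_real (F y) * \<Phi> y else 0)"

text \<open>The inverse of \<open>\<lambda>(\<theta>(y))\<close> is written \<open>\<lambda>(\<theta>(y)\<^sup>-\<^sup>1)\<close>.\<close>

definition twisted_transfer_op ::
    "(nat \<Rightarrow> 'a) set \<Rightarrow> ((nat \<Rightarrow> 'a) \<Rightarrow> real) \<Rightarrow> ('g, 'm) monoid_scheme \<Rightarrow> ((nat \<Rightarrow> 'a) \<Rightarrow> 'g) \<Rightarrow>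
     'y set \<Rightarrow> ('g \<Rightarrow> 'y \<Rightarrow> 'y) \<Rightarrow> ((nat \<Rightarrow> 'a) \<Rightarrow> 'y ell2) \<Rightarrow> (nat \<Rightarrow> 'a) \<Rightarrow> 'y ell2" where
  "twisted_transfer_op X F G \<theta> Y act \<Phi> x =
     (if x \<in> X
      then \<Sum>y\<in>{y\<in>X. shift y = x}. F y *\<^sub>R induced_rep G Y act (inv\<^bsub>G\<^esub> (\<theta> y)) (\<Phi> y)
      else 0)"

abbreviation transfer_radius ::
    "real \<Rightarrow> (nat \<Rightarrow> 'a) set \<Rightarrow> ((nat \<Rightarrow> 'a) \<Rightarrow> real) \<Rightarrow> real" where
  "transfer_radius \<alpha> X F \<equiv> spectral_radius \<alpha> X UNIV (transfer_op X F)"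

abbreviation twisted_transfer_radius ::
    "real \<Rightarrow> (nat \<Rightarrow> 'a) set \<Rightarrow> ((nat \<Rightarrow> 'a) \<Rightarrow> real) \<Rightarrow> ('g, 'm) monoid_scheme \<Rightarrow>
     ((nat \<Rightarrow> 'a) \<Rightarrow> 'g) \<Rightarrow> 'y set \<Rightarrow> ('g \<Rightarrow> 'y \<Rightarrow> 'y) \<Rightarrow> real" where
  "twisted_transfer_radius \<alpha> X F G \<theta> Y act \<equiv>
     spectral_radius \<alpha> X (ell2_on Y) (twisted_transfer_op X F G \<theta> Y act)"

text \<open>The property required of \<open>\<eta>\<close>, for all \<open>G\<close>-sets \<open>Y\<close> contained in a given type. A formula cannot
  quantify over types, so to express that one \<open>\<eta>\<close> serves \<open>G\<close>-sets in every type we record the type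
  as an argument, and state both that some positive \<open>\<eta>\<close> works for \<open>nat\<close> and that every such \<open>\<eta>\<close>
  works for an arbitrary type.\<close>

definition invariance_gap ::
    "'y itself \<Rightarrow> real \<Rightarrow> (nat \<Rightarrow> 'a) set \<Rightarrow> ((nat \<Rightarrow> 'a) \<Rightarrow> real) \<Rightarrow> ('g, 'm) monoid_scheme \<Rightarrow>
     ((nat \<Rightarrow> 'a) \<Rightarrow> 'g) \<Rightarrow> 'g set \<Rightarrow> real \<Rightarrow> real \<Rightarrow> bool" where
  "invariance_gap (_ :: 'y itself) \<alpha> X F G \<theta> S \<epsilon> \<eta> \<longleftrightarrow>
     (\<forall>(Y :: 'y set) act. group_action G Y act \<longrightarrow>
        twisted_transfer_radius \<alpha> X F G \<theta> Y act > (1 - \<eta>) * transfer_radius \<alpha> X F \<longrightarrow>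
        (\<exists>\<phi>. invariant_vector G Y act S \<epsilon> \<phi>))"

end

theory Submission
  imports Defs
begin

text \<open>
  The spectral radius of \<open>\<L>\<^sub>\<lambda>\<close> being almost as large as that of \<open>\<L>\<close> means that almost nothing
  cancels in the sums that define \<open>\<L>\<^sub>\<lambda>\<close>. In a Hilbert space a convex combination of vectors of norm
  at most \<open>1\<close> can have norm almost \<open>1\<close> only if the vectors almost coincide, and this coincidence
  is what produces almost invariant vectors.

  Here is the argument in more detail. A point of the spectrum that is the last one on its ray is
  an approximate eigenvalue (\<open>spec_imp_approximate_eigenvectors\<close>), so there are \<open>z\<close> with \<open>|z|\<close> almost
  \<open>\<rho>\<close> and \<open>\<Phi>\<close> with \<open>\<L>\<^sub>\<lambda> \<Phi>\<close> almost equal to \<open>z \<Phi>\<close>. The norm of \<open>\<Phi>\<close> is compared with a positive function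
  \<open>h\<close> satisfying \<open>\<L> h \<le> r h\<close>, where \<open>r\<close> is slightly larger than the growth rate of \<open>\<L>\<^sup>n 1\<close>. Such
  an \<open>h\<close> is given by a Green series, whose blow-up at the growth rate also shows that the growth rate
  is a spectral value of \<open>\<L>\<close> (\<open>growth_le_transfer_radius\<close>). At a point \<open>x\<close> where \<open>\<parallel>\<Phi>\<parallel> / h\<close> is almost
  maximal, \<open>\<Phi>(x) / h(x)\<close> is up to a phase almost a convex combination of the vectors
  \<open>\<lambda>(\<theta>(y))\<^sup>-\<^sup>1 \<Phi>(y) / h(y)\<close> over the preimages \<open>y\<close> of \<open>x\<close>, so all of these are almost equal to it
  (\<open>profile_step\<close>). In particular \<open>\<parallel>\<Phi>\<parallel> / h\<close> is almost maximal at the preimages as well, and the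
  argument can be repeated a fixed number of times. Taking absolute values in \<open>\<ell>\<^sup>2(Y)\<close> removes the phases.

  A Lasota--Yorke inequality bounds the Hoelder constant of \<open>\<Phi>\<close> by its sup norm, uniformly in \<open>Y\<close>. Hence
  two backward orbits of \<open>x\<close> that end in the same long word carry almost the same vector,
  and comparing them shows that one vector \<open>v \<ge> 0\<close> is almost fixed by any prescribed finite set of elements
  \<open>\<theta>\<^sub>n(y)\<close> for which \<open>y\<close> and \<open>\<sigma>\<^sup>n y\<close> begin with the same fixed word \<open>w\<close> (\<open>almost_invariant_vector\<close>).
  Let \<open>H\<close> be the subgroup generated by all such elements. Visibility says that \<open>G\<close> is a finite union
  of sets \<open>u H u'\<close>, so by a lemma of B. H. Neumann \<open>H\<close> has finite index (\<open>finite_left_transversal\<close>).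
  The sum of the translates of \<open>v\<close> over a transversal of \<open>H\<close> is then almost invariant under \<open>S\<close>, and it
  is not small because \<open>v \<ge> 0\<close> excludes cancellation.

  An \<open>\<eta>\<close> that works for \<open>G\<close>-sets of natural numbers works for all \<open>G\<close>-sets, because countably many
  approximate eigenvectors have values supported in one countable invariant subset
  (\<open>invariance_gap_transfer\<close>).
\<close>

section \<open>Resolvents of operators on spaces of functions\<close>

lemma bounded_linear_scaleC: "bounded_linear (\<lambda>v. c *\<^sub>C v :: 'e::complex_normed_vector)"
proof
  fix u v :: 'e and r :: real
  show "c *\<^sub>C (u + v) = c *\<^sub>C u + c *\<^sub>C v" by (rule scaleC_add_right)
  show "c *\<^sub>C (r *\<^sub>R v) = r *\<^sub>R (c *\<^sub>C v)"
    by (simp add: scaleC_of_real[symmetric] scaleC_scaleC mult.commute)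
  show "\<exists>K. \<forall>v. norm (c *\<^sub>C v :: 'e) \<le> norm v * K"
    by (rule exI[of _ "cmod c"]) (simp add: norm_scaleC mult.commute)
qed

lemma scaleC_simps [simp]:
  fixes v :: "'e::complex_normed_vector"
  shows "1 *\<^sub>C v = v" "0 *\<^sub>C v = 0" "c *\<^sub>C (0::'e) = 0"
    "c *\<^sub>C (- v) = - (c *\<^sub>C v)" "(- c) *\<^sub>C v = - (c *\<^sub>C v)"
proof -
  show "1 *\<^sub>C v = v" using scaleC_of_real[of 1 v] by simp
  show "0 *\<^sub>C v = 0" using scaleC_of_real[of 0 v] by simp
  interpret bounded_linear "\<lambda>v. c *\<^sub>C v :: 'e" by (rule bounded_linear_scaleC)
  show "c *\<^sub>C (0::'e) = 0" by (rule zero)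
  show "c *\<^sub>C (- v) = - (c *\<^sub>C v)" by (rule neg)
  have "(- c) *\<^sub>C v + c *\<^sub>C v = 0"
    using scaleC_add_left[of "-c" c v] \<open>0 *\<^sub>C v = 0\<close> by simp
  then show "(- c) *\<^sub>C v = - (c *\<^sub>C v)" by (simp add: eq_neg_iff_add_eq_0)
qed

lemma scaleC_diff_right: "c *\<^sub>C (u - v) = c *\<^sub>C u - c *\<^sub>C (v::'e::complex_normed_vector)"
  using scaleC_add_right[of c u "- v"] by simp

lemma scaleC_diff_left: "(b - c) *\<^sub>C v = b *\<^sub>C v - c *\<^sub>C (v::'e::complex_normed_vector)"
  using scaleC_add_left[of b "- c" v] by simp

text \<open>The last assumption, lower semicontinuity of the norm under pointwise limits, is the form of
  completeness that a Neumann series needs: its partial sums converge pointwise, and the bound on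
  their norms passes to the sum.\<close>

locale function_space =
  fixes V :: "('b \<Rightarrow> 'e::{complex_normed_vector,banach}) set"
    and N :: "('b \<Rightarrow> 'e) \<Rightarrow> real"
  assumes zero_mem: "(\<lambda>_. 0) \<in> V"
    and add_mem: "\<lbrakk>f \<in> V; g \<in> V\<rbrakk> \<Longrightarrow> (\<lambda>x. f x + g x) \<in> V"
    and scale_mem: "f \<in> V \<Longrightarrow> (\<lambda>x. c *\<^sub>C f x) \<in> V"
    and N_triangle: "\<lbrakk>f \<in> V; g \<in> V\<rbrakk> \<Longrightarrow> N (\<lambda>x. f x + g x) \<le> N f + N g"
    and N_scale: "f \<in> V \<Longrightarrow> N (\<lambda>x. c *\<^sub>C f x) = cmod c * N f"
    and norm_le_N: "f \<in> V \<Longrightarrow> norm (f x) \<le> N f"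
    and fatou: "\<lbrakk>\<And>n::nat. p n \<in> V; \<And>n. N (p n) \<le> C; \<And>x. (\<lambda>n. p n x) \<longlonglongrightarrow> f x\<rbrakk>
                  \<Longrightarrow> f \<in> V \<and> N f \<le> C"
begin

lemma N_nonneg: "f \<in> V \<Longrightarrow> 0 \<le> N f"
  using norm_le_N norm_ge_zero order_trans by blast

lemma N_zero: "N (\<lambda>_. 0) = 0"
  using N_scale[OF zero_mem, of 0] by simp

lemma uminus_mem: "f \<in> V \<Longrightarrow> (\<lambda>x. - f x) \<in> V"
  using scale_mem[of f "-1"] by simp

lemma diff_mem: "\<lbrakk>f \<in> V; g \<in> V\<rbrakk> \<Longrightarrow> (\<lambda>x. f x - g x) \<in> V"
  using add_mem[OF _ uminus_mem, of f g] by simp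

lemma N_uminus: "f \<in> V \<Longrightarrow> N (\<lambda>x. - f x) = N f"
  using N_scale[of f "-1"] by simp

lemma N_diff_le: "\<lbrakk>f \<in> V; g \<in> V\<rbrakk> \<Longrightarrow> N (\<lambda>x. f x - g x) \<le> N f + N g"
  using N_triangle[OF _ uminus_mem, of f g] by (simp add: N_uminus)

definition linear_op :: "(('b \<Rightarrow> 'e) \<Rightarrow> 'b \<Rightarrow> 'e) \<Rightarrow> bool" where
  "linear_op T \<longleftrightarrow> (\<forall>f\<in>V. T f \<in> V) \<and>
     (\<forall>f\<in>V. \<forall>g\<in>V. T (\<lambda>x. f x + g x) = (\<lambda>x. T f x + T g x)) \<and>
     (\<forall>c. \<forall>f\<in>V. T (\<lambda>x. c *\<^sub>C f x) = (\<lambda>x. c *\<^sub>C T f x))"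

definition bounded_by :: "real \<Rightarrow> (('b \<Rightarrow> 'e) \<Rightarrow> 'b \<Rightarrow> 'e) \<Rightarrow> bool" where
  "bounded_by C T \<longleftrightarrow> linear_op T \<and> (\<forall>f\<in>V. N (T f) \<le> C * N f)"

definition inverse_at :: "(('b \<Rightarrow> 'e) \<Rightarrow> 'b \<Rightarrow> 'e) \<Rightarrow> complex \<Rightarrow> (('b \<Rightarrow> 'e) \<Rightarrow> 'b \<Rightarrow> 'e) \<Rightarrow> bool" where
  "inverse_at T z R \<longleftrightarrow>
     (\<forall>f\<in>V. R (\<lambda>x. z *\<^sub>C f x - T f x) = f \<and> (\<lambda>x. z *\<^sub>C R f x - T (R f) x) = f)"

definition spec :: "(('b \<Rightarrow> 'e) \<Rightarrow> 'b \<Rightarrow> 'e) \<Rightarrow> complex set" where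
  "spec T = {z. \<not> (\<exists>R C. bounded_by C R \<and> inverse_at T z R)}"

lemma linear_opD:
  assumes "linear_op T" "f \<in> V"
  shows "T f \<in> V" "g \<in> V \<Longrightarrow> T (\<lambda>x. f x + g x) = (\<lambda>x. T f x + T g x)"
    "T (\<lambda>x. c *\<^sub>C f x) = (\<lambda>x. c *\<^sub>C T f x)"
  using assms unfolding linear_op_def by blast+

lemma linear_op_diff:
  assumes "linear_op T" "f \<in> V" "g \<in> V"
  shows "T (\<lambda>x. f x - g x) = (\<lambda>x. T f x - T g x)"
  using linear_opD(2)[OF assms(1,2) uminus_mem[OF assms(3)]] linear_opD(3)[OF assms(1,3), of "-1"]
  by simp

lemma linear_op_zero: "linear_op T \<Longrightarrow> T (\<lambda>_. 0) = (\<lambda>_. 0)"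
  using linear_opD(3)[OF _ zero_mem, of T 0] by simp

lemma linear_op_sum:
  assumes "linear_op T" "finite I" "\<And>i. i \<in> I \<Longrightarrow> p i \<in> V"
  shows "(\<lambda>x. \<Sum>i\<in>I. p i x) \<in> V \<and> T (\<lambda>x. \<Sum>i\<in>I. p i x) = (\<lambda>x. \<Sum>i\<in>I. T (p i) x)"
  using assms(2,3)
proof (induction rule: finite_induct)
  case empty
  then show ?case using zero_mem linear_op_zero[OF assms(1)] by simp
next
  case (insert i I)
  then show ?case
    using linear_opD(2)[OF assms(1), of "p i" "\<lambda>x. \<Sum>i\<in>I. p i x"] add_mem[of "p i" "\<lambda>x. \<Sum>i\<in>I. p i x"]
    by simp
qed

lemma N_sum_le:
  assumes "finite I" "\<And>i. i \<in> I \<Longrightarrow> p i \<in> V"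
  shows "N (\<lambda>x. \<Sum>i\<in>I. p i x) \<le> (\<Sum>i\<in>I. N (p i))"
  using assms
proof (induction rule: finite_induct)
  case empty
  then show ?case using N_zero by simp
next
  case (insert i I)
  have lin: "linear_op (\<lambda>f. f)" by (simp add: linear_op_def)
  show ?case
    using insert N_triangle[of "p i" "\<lambda>x. \<Sum>i\<in>I. p i x"] linear_op_sum[OF lin, of I p] by simp
qed

lemma bounded_by_linear: "bounded_by C T \<Longrightarrow> linear_op T"
  by (simp add: bounded_by_def)

lemma bounded_byD: "bounded_by C T \<Longrightarrow> f \<in> V \<Longrightarrow> N (T f) \<le> C * N f"
  by (simp add: bounded_by_def)

lemma linear_op_compose: "linear_op S \<Longrightarrow> linear_op T \<Longrightarrow> linear_op (\<lambda>f. S (T f))"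
  by (simp add: linear_op_def)

lemma funpow_bound:
  assumes K: "bounded_by q K" and q: "0 \<le> q" and f: "f \<in> V"
  shows "(K ^^ k) f \<in> V \<and> N ((K ^^ k) f) \<le> q ^ k * N f"
proof (induction k)
  case (Suc k)
  have "N (K ((K ^^ k) f)) \<le> q * N ((K ^^ k) f)" using bounded_byD[OF K] Suc by blast
  also have "\<dots> \<le> q * (q ^ k * N f)" using Suc q mult_left_mono by blast
  finally show ?case
    using Suc linear_opD(1)[OF bounded_by_linear[OF K]] by (simp add: mult.assoc)
qed (use f in simp)

text \<open>The series \<open>S = 1 + K + K\<^sup>2 + \<dots>\<close> is summed pointwise. The remainder of \<open>S f\<close> after \<open>n\<close> terms is
  \<open>S (K\<^sup>n f)\<close>, whose norm is at most a constant times \<open>q\<^sup>n\<close>. This norm estimate is what allows \<open>K\<close>, which need not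
  be continuous for pointwise convergence, to be exchanged with the sum.\<close>

lemma neumann_series:
  assumes K: "bounded_by q K" and q: "0 \<le> q" "q < 1"
  obtains S where "bounded_by (1 / (1 - q)) S"
    "\<And>f. f \<in> V \<Longrightarrow> S (\<lambda>x. f x - K f x) = f"
    "\<And>f. f \<in> V \<Longrightarrow> (\<lambda>x. S f x - K (S f) x) = f"
proof -
  note lin = bounded_by_linear[OF K]
  define S where "S f x = (\<Sum>k. (K ^^ k) f x)" for f x
  have summ: "summable (\<lambda>k. (K ^^ k) f x)" if f: "f \<in> V" for f x
  proof (rule summable_comparison_test[of _ "\<lambda>k. q ^ k * N f"])
    show "summable (\<lambda>k. q ^ k * N f)" using q by (intro summable_mult2 summable_geometric) simp
    show "\<exists>M. \<forall>k\<ge>M. norm ((K ^^ k) f x) \<le> q ^ k * N f"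
      using funpow_bound[OF K q(1) f] norm_le_N order_trans by blast
  qed
  have partial_mem: "(\<lambda>x. \<Sum>k<n. (K ^^ k) f x) \<in> V" if "f \<in> V" for f n
    using linear_op_sum[OF lin, of "{..<n}" "\<lambda>k. (K ^^ k) f"] funpow_bound[OF K q(1) that] by simp
  have S_bound: "S f \<in> V \<and> N (S f) \<le> 1 / (1 - q) * N f" if f: "f \<in> V" for f
  proof (rule fatou[where p = "\<lambda>n x. \<Sum>k<n. (K ^^ k) f x"])
    show "(\<lambda>x. \<Sum>k<n. (K ^^ k) f x) \<in> V" for n by (rule partial_mem[OF f])
    have "N (\<lambda>x. \<Sum>k<n. (K ^^ k) f x) \<le> (\<Sum>k<n. N ((K ^^ k) f))" for n
      using N_sum_le[of "{..<n}" "\<lambda>k. (K ^^ k) f"] funpow_bound[OF K q(1) f] by simp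
    also have "\<dots> n \<le> (\<Sum>k<n. q ^ k * N f)" for n
      using funpow_bound[OF K q(1) f] by (intro sum_mono) blast
    also have "\<dots> n = (\<Sum>k<n. q ^ k) * N f" for n by (simp add: sum_distrib_right)
    also have "\<dots> n \<le> 1 / (1 - q) * N f" for n
    proof (rule mult_right_mono[OF _ N_nonneg[OF f]])
      have "(\<Sum>k<n. q ^ k) = (1 - q ^ n) / (1 - q)"
        using q by (simp add: sum_gp_strict)
      also have "\<dots> \<le> 1 / (1 - q)" using q by (intro divide_right_mono) simp_all
      finally show "(\<Sum>k<n. q ^ k) \<le> 1 / (1 - q)" .
    qed
    finally show "N (\<lambda>x. \<Sum>k<n. (K ^^ k) f x) \<le> 1 / (1 - q) * N f" for n .
    show "(\<lambda>n. \<Sum>k<n. (K ^^ k) f x) \<longlonglongrightarrow> S f x" for x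
      unfolding S_def using summable_LIMSEQ[OF summ[OF f]] .
  qed
  have pow_lin: "linear_op (K ^^ k)" for k
  proof (induction k)
    case 0 show ?case by (simp add: linear_op_def)
  next
    case (Suc k) show ?case using linear_op_compose[OF lin Suc] by (simp add: o_def)
  qed
  have S_lin: "linear_op S"
    unfolding linear_op_def
  proof (intro conjI ballI allI ext)
    fix f assume f: "f \<in> V"
    show "S f \<in> V" using S_bound f by blast
    fix x
    show "S (\<lambda>x. f x + g x) x = S f x + S g x" if g: "g \<in> V" for g
      unfolding S_def linear_opD(2)[OF pow_lin f g] using suminf_add[OF summ summ, OF f g] by simp
    show "S (\<lambda>x. c *\<^sub>C f x) x = c *\<^sub>C S f x" for c
      unfolding S_def linear_opD(3)[OF pow_lin f]
      using bounded_linear.suminf[OF bounded_linear_scaleC summ[OF f]] by simp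
  qed
  have S_split: "S f x = (\<Sum>k<n. (K ^^ k) f x) + S ((K ^^ n) f) x" if f: "f \<in> V" for f n x
    unfolding S_def using suminf_split_initial_segment[OF summ[OF f], of x n]
    by (simp add: funpow_add add.commute)
  have left: "S (\<lambda>x. f x - K f x) = f" if f: "f \<in> V" for f
    using linear_op_diff[OF S_lin f linear_opD(1)[OF lin f]] S_split[OF f, of _ 1] by simp
  have comm: "K (S f) = S (K f)" if f: "f \<in> V" for f
  proof
    fix x
    have Kf: "K f \<in> V" using linear_opD(1)[OF lin f] .
    have "(\<lambda>n. K (\<lambda>x. \<Sum>k<n. (K ^^ k) f x) x) \<longlonglongrightarrow> S (K f) x"
    proof -
      have "K (\<lambda>x. \<Sum>k<n. (K ^^ k) f x) x = (\<Sum>k<n. (K ^^ k) (K f) x)" for n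
        using linear_op_sum[OF lin, of "{..<n}" "\<lambda>k. (K ^^ k) f"] funpow_bound[OF K q(1) f]
        by (simp add: funpow_swap1)
      then show ?thesis unfolding S_def using summable_LIMSEQ[OF summ[OF Kf]] by simp
    qed
    moreover have "(\<lambda>n. K (\<lambda>x. \<Sum>k<n. (K ^^ k) f x) x) \<longlonglongrightarrow> K (S f) x"
    proof -
      define C where "C = q * (1 / (1 - q)) * N f"
      have dist: "norm (K (S f) x - K (\<lambda>x. \<Sum>k<n. (K ^^ k) f x) x) \<le> q ^ n * C" for n
      proof -
        have mem: "(K ^^ n) f \<in> V" and le: "N ((K ^^ n) f) \<le> q ^ n * N f"
          using funpow_bound[OF K q(1) f] by auto
        have "(\<lambda>x. S f x - (\<Sum>k<n. (K ^^ k) f x)) = S ((K ^^ n) f)"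
          using S_split[OF f, of _ n] by auto
        then have "(\<lambda>x. K (S f) x - K (\<lambda>x. \<Sum>k<n. (K ^^ k) f x) x) = K (S ((K ^^ n) f))"
          using linear_op_diff[OF lin linear_opD(1)[OF S_lin f] partial_mem[OF f], of n] by simp
        then have "norm (K (S f) x - K (\<lambda>x. \<Sum>k<n. (K ^^ k) f x) x) = norm (K (S ((K ^^ n) f)) x)"
          by (auto dest: fun_cong[where x = x])
        also have "\<dots> \<le> N (K (S ((K ^^ n) f)))"
          using mem linear_opD(1)[OF lin] linear_opD(1)[OF S_lin] norm_le_N by blast
        also have "\<dots> \<le> q * N (S ((K ^^ n) f))"
          using bounded_byD[OF K] linear_opD(1)[OF S_lin mem] by blast
        also have "\<dots> \<le> q * (1 / (1 - q) * (q ^ n * N f))"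
        proof (intro mult_left_mono[OF _ q(1)])
          have "N (S ((K ^^ n) f)) \<le> 1 / (1 - q) * N ((K ^^ n) f)" using S_bound[OF mem] by blast
          also have "\<dots> \<le> 1 / (1 - q) * (q ^ n * N f)" using q le by (intro mult_left_mono) simp_all
          finally show "N (S ((K ^^ n) f)) \<le> 1 / (1 - q) * (q ^ n * N f)" .
        qed
        finally show ?thesis by (simp add: C_def mult_ac)
      qed
      have "(\<lambda>n. q ^ n * C) \<longlonglongrightarrow> 0"
        using q by (intro tendsto_mult_left_zero LIMSEQ_realpow_zero)
      then have "(\<lambda>n. K (S f) x - K (\<lambda>x. \<Sum>k<n. (K ^^ k) f x) x) \<longlonglongrightarrow> 0"
        by (rule Lim_null_comparison[OF always_eventually[OF allI[OF dist]]])
      from tendsto_diff[OF tendsto_const[of "K (S f) x"] this] show ?thesis by simp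
    qed
    ultimately show "K (S f) x = S (K f) x" using LIMSEQ_unique by blast
  qed
  show ?thesis
  proof (rule that)
    show "bounded_by (1 / (1 - q)) S" using S_lin S_bound by (simp add: bounded_by_def)
    show "S (\<lambda>x. f x - K f x) = f" if "f \<in> V" for f by (rule left[OF that])
    show "(\<lambda>x. S f x - K (S f) x) = f" if "f \<in> V" for f
      using S_split[OF that, of _ 1] comm[OF that] by auto
  qed
qed

text \<open>If \<open>R\<close> is the inverse of \<open>z0 - T\<close>, then \<open>z - T = (1 - (z0 - z) R) (z0 - T)\<close>, and the first factor is
  inverted by a Neumann series.\<close>

lemma spec_perturb:
  assumes T: "linear_op T" and R: "bounded_by C R" "inverse_at T z0 R" and C: "0 \<le> C"
    and z: "cmod (z - z0) * C < 1"
  shows "z \<notin> spec T"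
proof -
  define K where "K f x = (z0 - z) *\<^sub>C R f x" for f x
  note Rl = bounded_by_linear[OF R(1)]
  have K: "bounded_by (cmod (z - z0) * C) K"
    unfolding bounded_by_def linear_op_def
  proof (intro conjI ballI allI)
    fix f assume f: "f \<in> V"
    note Rf = linear_opD[OF Rl f]
    show "K f \<in> V" unfolding K_def by (intro scale_mem Rf)
    show "K (\<lambda>x. f x + g x) = (\<lambda>x. K f x + K g x)" if "g \<in> V" for g
      unfolding K_def Rf(2)[OF that] by (simp add: scaleC_add_right)
    show "K (\<lambda>x. c *\<^sub>C f x) = (\<lambda>x. c *\<^sub>C K f x)" for c
      unfolding K_def Rf(3) by (simp add: scaleC_scaleC mult.commute)
    have "N (K f) = cmod (z - z0) * N (R f)"
      unfolding K_def using N_scale[OF Rf(1)] by (simp add: norm_minus_commute)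
    also have "\<dots> \<le> cmod (z - z0) * (C * N f)"
      using bounded_byD[OF R(1) f] by (intro mult_left_mono) simp_all
    finally show "N (K f) \<le> cmod (z - z0) * C * N f" by (simp add: mult.assoc)
  qed
  obtain S where S: "bounded_by (1 / (1 - cmod (z - z0) * C)) S"
    and S1: "\<And>f. f \<in> V \<Longrightarrow> S (\<lambda>x. f x - K f x) = f"
    and S2: "\<And>f. f \<in> V \<Longrightarrow> (\<lambda>x. S f x - K (S f) x) = f"
    using neumann_series[OF K] z C by auto
  note Sl = bounded_by_linear[OF S]
  have "bounded_by (C * (1 / (1 - cmod (z - z0) * C))) (\<lambda>f. R (S f))"
    unfolding bounded_by_def
  proof (intro conjI ballI)
    show "linear_op (\<lambda>f. R (S f))" by (rule linear_op_compose[OF Rl Sl])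
    fix f assume f: "f \<in> V"
    have "N (R (S f)) \<le> C * N (S f)" by (rule bounded_byD[OF R(1) linear_opD(1)[OF Sl f]])
    also have "\<dots> \<le> C * (1 / (1 - cmod (z - z0) * C) * N f)"
      by (rule mult_left_mono[OF bounded_byD[OF S f] C])
    finally show "N (R (S f)) \<le> C * (1 / (1 - cmod (z - z0) * C)) * N f"
      by (simp add: mult.assoc)
  qed
  moreover have "inverse_at T z (\<lambda>f. R (S f))"
    unfolding inverse_at_def
  proof (intro ballI conjI)
    fix f assume f: "f \<in> V"
    define g where "g = (\<lambda>x. z0 *\<^sub>C f x - T f x)"
    have g: "g \<in> V" unfolding g_def by (intro diff_mem scale_mem f linear_opD(1)[OF T f])
    have Rg: "R g = f" using R(2) f unfolding inverse_at_def g_def by blast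
    have "(\<lambda>x. z *\<^sub>C f x - T f x) = (\<lambda>x. g x - K g x)"
      unfolding K_def Rg by (simp add: g_def scaleC_diff_left)
    then show "R (S (\<lambda>x. z *\<^sub>C f x - T f x)) = f" using S1[OF g] Rg by simp
    have Sf: "S f \<in> V" by (rule linear_opD(1)[OF Sl f])
    have "(\<lambda>x. z0 *\<^sub>C R (S f) x - T (R (S f)) x) = S f"
      using R(2) Sf unfolding inverse_at_def by blast
    then have "z0 *\<^sub>C R (S f) x - T (R (S f)) x = S f x" for x by (rule fun_cong)
    then have "z *\<^sub>C R (S f) x - T (R (S f)) x = S f x - K (S f) x" for x
      unfolding K_def scaleC_diff_left by (simp add: algebra_simps)
    then show "(\<lambda>x. z *\<^sub>C R (S f) x - T (R (S f)) x) = f" using S2[OF f] by simp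
  qed
  ultimately show ?thesis unfolding spec_def by blast
qed

text \<open>Write \<open>z - T = z (1 - z\<^sup>-\<^sup>1 T)\<close>.\<close>

lemma spec_bounded:
  assumes T: "bounded_by C T" and z: "z \<in> spec T"
  shows "cmod z \<le> max C 0"
proof (rule ccontr)
  assume "\<not> cmod z \<le> max C 0"
  then have big: "max C 0 < cmod z" and z0: "z \<noteq> 0" by auto
  note Tl = bounded_by_linear[OF T]
  define q where "q = max C 0 / cmod z"
  define K where "K f x = inverse z *\<^sub>C T f x" for f x
  have q: "0 \<le> q" "q < 1" using big by (simp_all add: q_def divide_less_eq)
  have scale_Tl: "linear_op (\<lambda>f x. c *\<^sub>C S f x)" if S: "linear_op S" for S c
    unfolding linear_op_def
    using linear_opD[OF S] scale_mem by (simp add: scaleC_add_right scaleC_scaleC mult.commute)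
  have K: "bounded_by q K"
    unfolding bounded_by_def
  proof (intro conjI ballI)
    show "linear_op K" unfolding K_def using scale_Tl[OF Tl] .
    fix f assume f: "f \<in> V"
    have "N (K f) = inverse (cmod z) * N (T f)"
      unfolding K_def using N_scale[OF linear_opD(1)[OF Tl f]] by (simp add: norm_inverse)
    also have "\<dots> \<le> inverse (cmod z) * (max C 0 * N f)"
    proof (intro mult_left_mono)
      have "N (T f) \<le> C * N f" by (rule bounded_byD[OF T f])
      also have "\<dots> \<le> max C 0 * N f" by (intro mult_right_mono N_nonneg f) simp
      finally show "N (T f) \<le> max C 0 * N f" .
    qed simp
    finally show "N (K f) \<le> q * N f" by (simp add: q_def divide_inverse mult_ac)
  qed
  obtain S where S: "bounded_by (1 / (1 - q)) S"
    and S1: "\<And>f. f \<in> V \<Longrightarrow> S (\<lambda>x. f x - K f x) = f"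
    and S2: "\<And>f. f \<in> V \<Longrightarrow> (\<lambda>x. S f x - K (S f) x) = f"
    using neumann_series[OF K q] by blast
  note Sl = bounded_by_linear[OF S]
  define R where "R f x = inverse z *\<^sub>C S f x" for f x
  have "bounded_by (inverse (cmod z) * (1 / (1 - q))) R"
    unfolding bounded_by_def
  proof (intro conjI ballI)
    show "linear_op R" unfolding R_def using scale_Tl[OF Sl] .
    fix f assume f: "f \<in> V"
    have "N (R f) = inverse (cmod z) * N (S f)"
      unfolding R_def using N_scale[OF linear_opD(1)[OF Sl f]] by (simp add: norm_inverse)
    also have "\<dots> \<le> inverse (cmod z) * (1 / (1 - q) * N f)"
      by (intro mult_left_mono bounded_byD[OF S f]) simp
    finally show "N (R f) \<le> inverse (cmod z) * (1 / (1 - q)) * N f" by (simp add: mult.assoc)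
  qed
  moreover have "inverse_at T z R"
    unfolding inverse_at_def
  proof (intro ballI conjI)
    fix f assume f: "f \<in> V"
    have Tf: "T f \<in> V" and Sf: "S f \<in> V" using linear_opD(1) Tl Sl f by auto
    have "(\<lambda>x. z *\<^sub>C f x - T f x) = (\<lambda>x. z *\<^sub>C (f x - K f x))"
      using z0 by (simp add: K_def scaleC_diff_right scaleC_scaleC)
    moreover have "(\<lambda>x. f x - K f x) \<in> V"
      using diff_mem[OF f linear_opD(1)[OF bounded_by_linear[OF K] f]] .
    ultimately have "S (\<lambda>x. z *\<^sub>C f x - T f x) = (\<lambda>x. z *\<^sub>C f x)"
      using linear_opD(3)[OF Sl, of "\<lambda>x. f x - K f x" z] S1[OF f] by simp
    then show "R (\<lambda>x. z *\<^sub>C f x - T f x) = f" using z0 by (simp add: R_def[abs_def] scaleC_scaleC)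
    have "T (R f) = K (S f)" unfolding R_def K_def using linear_opD(3)[OF Tl Sf] .
    then show "(\<lambda>x. z *\<^sub>C R f x - T (R f) x) = f"
      using S2[OF f] z0 by (simp add: R_def scaleC_scaleC)
  qed
  ultimately show False using z unfolding spec_def by blast
qed

text \<open>An inverse of \<open>z - T\<close> bounded by \<open>C\<close> gives \<open>N f \<le> C N (z f - T f)\<close>.\<close>

lemma approximate_eigenvectors_imp_spec:
  assumes T: "linear_op T"
    and approx: "\<And>\<delta>. 0 < \<delta> \<Longrightarrow> \<exists>f\<in>V. N (\<lambda>x. z *\<^sub>C f x - T f x) < \<delta> * N f"
  shows "z \<in> spec T"
proof (rule ccontr)
  assume "z \<notin> spec T"
  then obtain R C where R: "bounded_by C R" "inverse_at T z R" unfolding spec_def by blast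
  obtain f where f: "f \<in> V" and less: "N (\<lambda>x. z *\<^sub>C f x - T f x) < 1 / (\<bar>C\<bar> + 1) * N f"
    using approx[of "1 / (\<bar>C\<bar> + 1)"] by fastforce
  let ?g = "\<lambda>x. z *\<^sub>C f x - T f x"
  have g: "?g \<in> V" by (intro diff_mem scale_mem f linear_opD(1)[OF T f])
  have "N f = N (R ?g)" using R(2) f unfolding inverse_at_def by simp
  also have "\<dots> \<le> C * N ?g" by (rule bounded_byD[OF R(1) g])
  also have "\<dots> \<le> (\<bar>C\<bar> + 1) * N ?g" by (intro mult_right_mono N_nonneg g) simp
  also have "\<dots> < (\<bar>C\<bar> + 1) * (1 / (\<bar>C\<bar> + 1) * N f)" by (intro mult_strict_left_mono less) simp
  also have "\<dots> = N f" by simp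
  finally show False by simp
qed

text \<open>Let \<open>z\<close> be the last point of the spectrum on the ray from \<open>z0\<close> outwards. If \<open>z f - T f\<close> were bounded
  below by \<open>\<delta> N f\<close>, the inverses at the points just beyond \<open>z\<close> would be bounded by \<open>2 / \<delta>\<close>, so that discs of radius
  \<open>\<delta> / 2\<close> around these points would avoid the spectrum; but they contain spectral points of the ray close to \<open>z\<close>.
  This makes approximate eigenvectors available without the spectral radius formula.\<close>

lemma spec_imp_approximate_eigenvectors:
  assumes T: "bounded_by C T" and z0: "z0 \<in> spec T" "z0 \<noteq> 0"
  obtains z where "cmod z0 \<le> cmod z"
    "\<And>\<delta>. 0 < \<delta> \<Longrightarrow> \<exists>f\<in>V. N (\<lambda>x. z *\<^sub>C f x - T f x) < \<delta> * N f"
proof -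
  note Tl = bounded_by_linear[OF T]
  define A where "A = {t::real. 1 \<le> t \<and> of_real t * z0 \<in> spec T}"
  define s where "s = Sup A"
  have A1: "1 \<in> A" using z0 by (simp add: A_def)
  have bdd: "bdd_above A"
  proof (rule bdd_aboveI[of _ "max C 0 / cmod z0"])
    fix t assume "t \<in> A"
    then have "1 \<le> t" "cmod (of_real t * z0) \<le> max C 0"
      using spec_bounded[OF T] by (auto simp: A_def)
    then show "t \<le> max C 0 / cmod z0" using z0(2) by (simp add: norm_mult field_simps)
  qed
  have s1: "1 \<le> s" unfolding s_def by (rule cSup_upper[OF A1 bdd])
  have "\<exists>f\<in>V. N (\<lambda>x. (of_real s * z0) *\<^sub>C f x - T f x) < \<delta> * N f" if \<delta>: "0 < \<delta>" for \<delta>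
  proof (rule ccontr)
    assume "\<not> ?thesis"
    then have low: "\<delta> * N f \<le> N (\<lambda>x. (of_real s * z0) *\<^sub>C f x - T f x)" if "f \<in> V" for f
      using that by fastforce
    \<comment> \<open>The spectral point \<open>t z0\<close> found below lies at distance at most \<open>2 e |z0| = \<delta> / 4\<close> from \<open>(s + e) z0\<close>.\<close>
    define e where "e = \<delta> / (8 * cmod z0)"
    have e: "0 < e" "e * cmod z0 = \<delta> / 8" using \<delta> z0(2) by (simp_all add: e_def)
    have "s + e \<notin> A" using cSup_upper[OF _ bdd, of "s + e"] e(1) unfolding s_def by fastforce
    then have "of_real (s + e) * z0 \<notin> spec T" using s1 e(1) by (simp add: A_def)
    then obtain R B where R: "bounded_by B R" "inverse_at T (of_real (s + e) * z0) R"
      unfolding spec_def by blast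
    note Rl = bounded_by_linear[OF R(1)]
    have "N (R f) \<le> 2 / \<delta> * N f" if f: "f \<in> V" for f
    proof -
      have g: "R f \<in> V" (is "?g \<in> V") by (rule linear_opD(1)[OF Rl f])
      have "f = (\<lambda>x. (of_real (s + e) * z0) *\<^sub>C ?g x - T ?g x)"
        using R(2) f unfolding inverse_at_def by simp
      then have "(\<lambda>x. (of_real s * z0) *\<^sub>C ?g x - T ?g x) = (\<lambda>x. f x - (of_real e * z0) *\<^sub>C ?g x)"
        by (subst \<open>f = _\<close>) (simp add: scaleC_add_left ring_distribs fun_eq_iff)
      then have "\<delta> * N ?g \<le> N (\<lambda>x. f x - (of_real e * z0) *\<^sub>C ?g x)" using low[OF g] by simp
      also have "\<dots> \<le> N f + N (\<lambda>x. (of_real e * z0) *\<^sub>C ?g x)"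
        by (intro N_diff_le f scale_mem g)
      also have "N (\<lambda>x. (of_real e * z0) *\<^sub>C ?g x) = \<delta> / 8 * N ?g"
        using N_scale[OF g] e by (simp add: norm_mult)
      finally have "\<delta> * N ?g \<le> 2 * N f" using \<delta> N_nonneg[OF g] N_nonneg[OF f]
        mult_nonneg_nonneg[of \<delta> "N ?g"] by simp
      then show ?thesis using \<delta> by (simp add: field_simps)
    qed
    then have R': "bounded_by (2 / \<delta>) R" using Rl by (simp add: bounded_by_def)
    obtain t where t: "t \<in> A" "s - e < t" using less_cSup_iff[of A "s - e"] A1 bdd e(1)
      unfolding s_def by auto
    have "t \<le> s" unfolding s_def by (rule cSup_upper[OF t(1) bdd])
    then have "cmod (of_real t * z0 - of_real (s + e) * z0) \<le> (2 * e) * cmod z0"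
      using t(2) e(1) by (simp add: left_diff_distrib[symmetric] norm_mult mult_right_mono
          flip: of_real_add of_real_diff)
    also have "\<dots> = \<delta> / 4" using e(2) by simp
    finally have "cmod (of_real t * z0 - of_real (s + e) * z0) * (2 / \<delta>) \<le> \<delta> / 4 * (2 / \<delta>)"
      using \<delta> by (intro mult_right_mono) simp_all
    also have "\<dots> < 1" using \<delta> by simp
    finally have "of_real t * z0 \<notin> spec T"
      using spec_perturb[OF Tl R' R(2)] \<delta> by simp
    then show False using t(1) by (simp add: A_def)
  qed
  moreover have "cmod z0 \<le> cmod (of_real s * z0)" using s1 by (simp add: norm_mult mult_le_cancel_right1)
  ultimately show ?thesis using that by blast
qed

end

section \<open>The Hilbert space of square summable functions\<close>

lemma summable_Rep_ell2: "(\<lambda>y. (cmod (Rep_ell2 f y))\<^sup>2) summable_on UNIV"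
  using Rep_ell2[of f] by simp

lemma norm_ell2_square: "(norm f)\<^sup>2 = (\<Sum>\<^sub>\<infinity>y. (cmod (Rep_ell2 f y))\<^sup>2)"
  by (simp add: norm_ell2.rep_eq infsum_nonneg)

lemma ell2_eqI: "(\<And>y. Rep_ell2 f y = Rep_ell2 g y) \<Longrightarrow> f = g"
  by (simp add: Rep_ell2_inject[symmetric] ext)

lemma finite_sum_le_norm_ell2: "finite A \<Longrightarrow> (\<Sum>y\<in>A. (cmod (Rep_ell2 f y))\<^sup>2) \<le> (norm f)\<^sup>2"
  unfolding norm_ell2_square by (rule finite_sum_le_infsum[OF summable_Rep_ell2]) auto

lemma cmod_Rep_le_norm: "cmod (Rep_ell2 f y) \<le> norm f"
  using finite_sum_le_norm_ell2[of "{y}" f] by (simp add: power2_le_iff_abs_le)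

lemma ell2_norm_le:
  assumes "\<And>A. finite A \<Longrightarrow> (\<Sum>y\<in>A. (cmod (Rep_ell2 f y))\<^sup>2) \<le> B\<^sup>2" and "0 \<le> B"
  shows "norm f \<le> B"
proof -
  have "(norm f)\<^sup>2 \<le> B\<^sup>2"
    unfolding norm_ell2_square by (rule infsum_le_finite_sums[OF summable_Rep_ell2]) (use assms in auto)
  then show ?thesis using assms(2) by (simp add: power2_le_iff_abs_le)
qed

lemma ell2_norm_mono:
  assumes "\<And>y. cmod (Rep_ell2 f y) \<le> cmod (Rep_ell2 g y)"
  shows "norm f \<le> norm g"
proof (rule ell2_norm_le)
  fix A :: "'a set" assume "finite A"
  have "(\<Sum>y\<in>A. (cmod (Rep_ell2 f y))\<^sup>2) \<le> (\<Sum>y\<in>A. (cmod (Rep_ell2 g y))\<^sup>2)"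
    by (intro sum_mono power_mono assms) simp
  also have "\<dots> \<le> (norm g)\<^sup>2" by (rule finite_sum_le_norm_ell2[OF \<open>finite A\<close>])
  finally show "(\<Sum>y\<in>A. (cmod (Rep_ell2 f y))\<^sup>2) \<le> (norm g)\<^sup>2" .
qed simp

instance ell2 :: (type) complete_space
proof
  fix p :: "nat \<Rightarrow> 'a ell2" assume Cp: "Cauchy p"
  have "Cauchy (\<lambda>n. Rep_ell2 (p n) y)" for y
  proof (rule metric_CauchyI)
    fix e :: real assume "0 < e"
    then obtain M where "\<forall>m\<ge>M. \<forall>n\<ge>M. dist (p m) (p n) < e" using Cp unfolding Cauchy_def by blast
    moreover have "dist (Rep_ell2 (p m) y) (Rep_ell2 (p n) y) \<le> dist (p m) (p n)" for m n
      using cmod_Rep_le_norm[of "p m - p n" y] by (simp add: dist_norm minus_ell2.rep_eq)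
    ultimately show "\<exists>M. \<forall>m\<ge>M. \<forall>n\<ge>M. dist (Rep_ell2 (p m) y) (Rep_ell2 (p n) y) < e"
      using order_le_less_trans by blast
  qed
  then have "convergent (\<lambda>n. Rep_ell2 (p n) y)" for y by (rule Cauchy_convergent)
  then have "\<forall>y. \<exists>l. (\<lambda>n. Rep_ell2 (p n) y) \<longlonglongrightarrow> l" unfolding convergent_def by blast
  then obtain f where f: "\<And>y. (\<lambda>n. Rep_ell2 (p n) y) \<longlonglongrightarrow> f y" by (rule choice[THEN exE]) blast
  have tail: "(\<Sum>y\<in>A. (cmod (f y - Rep_ell2 (p n) y))\<^sup>2) \<le> e\<^sup>2"
    if "finite A" and close: "\<And>m. m \<ge> M \<Longrightarrow> norm (p m - p n) \<le> e" for A n e M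
  proof (rule LIMSEQ_le_const2)
    show "(\<lambda>m. \<Sum>y\<in>A. (cmod (Rep_ell2 (p m) y - Rep_ell2 (p n) y))\<^sup>2)
            \<longlonglongrightarrow> (\<Sum>y\<in>A. (cmod (f y - Rep_ell2 (p n) y))\<^sup>2)"
      by (intro tendsto_sum tendsto_power tendsto_norm tendsto_diff f tendsto_const)
    have "(\<Sum>y\<in>A. (cmod (Rep_ell2 (p m) y - Rep_ell2 (p n) y))\<^sup>2) \<le> e\<^sup>2" if m: "m \<ge> M" for m
    proof -
      have "(\<Sum>y\<in>A. (cmod (Rep_ell2 (p m) y - Rep_ell2 (p n) y))\<^sup>2) \<le> (norm (p m - p n))\<^sup>2"
        using finite_sum_le_norm_ell2[OF \<open>finite A\<close>, of "p m - p n"] by (simp add: minus_ell2.rep_eq)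
      also have "\<dots> \<le> e\<^sup>2" by (intro power_mono close m) simp
      finally show ?thesis .
    qed
    then show "\<exists>M. \<forall>m\<ge>M. (\<Sum>y\<in>A. (cmod (Rep_ell2 (p m) y - Rep_ell2 (p n) y))\<^sup>2) \<le> e\<^sup>2" by blast
  qed
  have Cn: "\<exists>M. \<forall>m\<ge>M. \<forall>n\<ge>M. norm (p m - p n) < e" if "0 < e" for e
    using Cp that unfolding Cauchy_def dist_norm by blast
  obtain M where M: "\<And>m n. m \<ge> M \<Longrightarrow> n \<ge> M \<Longrightarrow> norm (p m - p n) < 1" using Cn[of 1] by auto
  have "(\<lambda>y. (cmod (f y - Rep_ell2 (p M) y))\<^sup>2) summable_on UNIV"
    by (rule nonneg_bdd_above_summable_on)
      (auto intro!: bdd_aboveI[of _ "1\<^sup>2"] tail less_imp_le[OF M])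
  from ell2_minkowski(1)[OF this summable_Rep_ell2[of "p M"]]
  have "(\<lambda>y. (cmod (f y))\<^sup>2) summable_on UNIV" by simp
  then have Rf: "Rep_ell2 (Abs_ell2 f) = f" by (simp add: Abs_ell2_inverse)
  have "p \<longlonglongrightarrow> Abs_ell2 f"
  proof (rule LIMSEQ_I)
    fix e :: real assume e: "0 < e"
    obtain K where K: "\<And>m n. m \<ge> K \<Longrightarrow> n \<ge> K \<Longrightarrow> norm (p m - p n) < e / 2" using Cn[of "e/2"] e by auto
    have "norm (Abs_ell2 f - p n) \<le> e / 2" if "n \<ge> K" for n
      by (rule ell2_norm_le) (use e that in \<open>auto simp: minus_ell2.rep_eq Rf intro!: tail less_imp_le[OF K]\<close>)
    then have "norm (p n - Abs_ell2 f) < e" if "n \<ge> K" for n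
      using that e by (fastforce simp: norm_minus_commute)
    then show "\<exists>K. \<forall>n\<ge>K. norm (p n - Abs_ell2 f) < e" by blast
  qed
  then show "convergent p" by (rule convergentI)
qed

instance ell2 :: (type) banach ..

lemma tendsto_Rep_ell2:
  assumes "(p \<longlongrightarrow> f) net"
  shows "((\<lambda>n. Rep_ell2 (p n) y) \<longlongrightarrow> Rep_ell2 f y) net"
proof (rule Lim_null[THEN iffD2], rule Lim_null_comparison)
  show "\<forall>\<^sub>F n in net. norm (Rep_ell2 (p n) y - Rep_ell2 f y) \<le> norm (p n - f)"
    using cmod_Rep_le_norm[of "p _ - f" y] by (simp add: minus_ell2.rep_eq)
  show "((\<lambda>n. norm (p n - f)) \<longlongrightarrow> 0) net"
    using tendsto_norm_zero[OF Lim_null[THEN iffD1, OF assms]] .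
qed

instantiation ell2 :: (type) real_inner
begin

definition inner_ell2 :: "'a ell2 \<Rightarrow> 'a ell2 \<Rightarrow> real" where
  "inner_ell2 f g = (\<Sum>\<^sub>\<infinity>y. Rep_ell2 f y \<bullet> Rep_ell2 g y)"

lemma summable_inner_ell2: "(\<lambda>y. Rep_ell2 f y \<bullet> Rep_ell2 g y) summable_on UNIV"
proof (rule summable_on_iff_abs_summable_on_real[THEN iffD2], rule Infinite_Sum.abs_summable_on_comparison_test')
  show "(\<lambda>y. (cmod (Rep_ell2 f y))\<^sup>2 + (cmod (Rep_ell2 g y))\<^sup>2) summable_on UNIV"
    by (intro summable_on_add summable_Rep_ell2)
  show "norm (Rep_ell2 f y \<bullet> Rep_ell2 g y) \<le> (cmod (Rep_ell2 f y))\<^sup>2 + (cmod (Rep_ell2 g y))\<^sup>2" for y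
    using Cauchy_Schwarz_ineq2[of "Rep_ell2 f y" "Rep_ell2 g y"]
      sum_squares_bound[of "cmod (Rep_ell2 f y)" "cmod (Rep_ell2 g y)"]
      mult_nonneg_nonneg[OF norm_ge_zero norm_ge_zero, of "Rep_ell2 f y" "Rep_ell2 g y"]
    by simp
qed

instance
proof
  fix f g h :: "'a ell2" and r :: real
  show "f \<bullet> g = g \<bullet> f" by (simp add: inner_ell2_def inner_commute)
  show "(f + g) \<bullet> h = f \<bullet> h + g \<bullet> h"
    unfolding inner_ell2_def plus_ell2.rep_eq inner_add_left
    by (rule infsum_add) (rule summable_inner_ell2)+
  show "(r *\<^sub>R f) \<bullet> g = r * (f \<bullet> g)"
    unfolding inner_ell2_def scaleR_ell2.rep_eq
    by (simp flip: scaleR_conv_of_real infsum_cmult_right')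
  have sq: "f \<bullet> f = (norm f)\<^sup>2" for f :: "'a ell2"
    by (simp add: inner_ell2_def norm_ell2_square power2_norm_eq_inner)
  show "0 \<le> f \<bullet> f" "(f \<bullet> f = 0) = (f = 0)" "norm f = sqrt (f \<bullet> f)" by (simp_all add: sq)
qed

end

text \<open>The pointwise absolute value. It forgets the phases of approximate eigenvectors and commutes with
  permutations of the coordinates.\<close>

lift_definition modulus :: "'y ell2 \<Rightarrow> 'y ell2" is "\<lambda>f y. complex_of_real (cmod (f y))"
  by simp

lemma norm_modulus [simp]: "norm (modulus f) = norm f"
  by (simp add: norm_ell2.rep_eq modulus.rep_eq)

lemma norm_modulus_diff_le: "norm (modulus f - modulus g) \<le> norm (f - g)"
  by (rule ell2_norm_mono)
    (simp add: minus_ell2.rep_eq modulus.rep_eq norm_triangle_ineq3 of_real_diff[symmetric] del: of_real_diff)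

lemma modulus_scaleC: "modulus (c *\<^sub>C f) = cmod c *\<^sub>R modulus f"
  by (rule ell2_eqI) (simp add: scaleC_ell2.rep_eq scaleR_ell2.rep_eq modulus.rep_eq norm_mult)

lemma modulus_scaleR: "modulus (r *\<^sub>R f) = \<bar>r\<bar> *\<^sub>R modulus f"
  using modulus_scaleC[of "of_real r" f] by (simp add: scaleC_of_real)

text \<open>Both the induced representation of a group element and the passage between a \<open>G\<close>-set and a copy of it in
  another type pull vectors back along a map of index sets.\<close>

definition reindex :: "'z set \<Rightarrow> ('z \<Rightarrow> 'y) \<Rightarrow> 'y ell2 \<Rightarrow> 'z ell2" where
  "reindex Z j f = Abs_ell2 (\<lambda>z. if z \<in> Z then Rep_ell2 f (j z) else 0)"

lemma Rep_reindex:
  assumes "inj_on j Z"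
  shows "Rep_ell2 (reindex Z j f) z = (if z \<in> Z then Rep_ell2 f (j z) else 0)"
proof -
  have "(\<lambda>y. (cmod (Rep_ell2 f y))\<^sup>2) summable_on j ` Z"
    by (rule summable_on_subset_banach[OF summable_Rep_ell2 subset_UNIV])
  then have "(\<lambda>z. (cmod (Rep_ell2 f (j z)))\<^sup>2) summable_on Z"
    using summable_on_reindex[OF assms, of "\<lambda>y. (cmod (Rep_ell2 f y))\<^sup>2"] by (simp add: o_def)
  then have "(\<lambda>z. (cmod (if z \<in> Z then Rep_ell2 f (j z) else 0))\<^sup>2) summable_on UNIV"
    by (rule summable_on_cong_neutral[THEN iffD1, rotated -1]) auto
  then show ?thesis unfolding reindex_def by (subst Abs_ell2_inverse) auto
qed

lemma reindex_linear:
  assumes "inj_on j Z"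
  shows "reindex Z j (f + g) = reindex Z j f + reindex Z j g"
    "reindex Z j (f - g) = reindex Z j f - reindex Z j g"
    "reindex Z j (c *\<^sub>C f) = c *\<^sub>C reindex Z j f"
    "reindex Z j (r *\<^sub>R f) = r *\<^sub>R reindex Z j f"
    "reindex Z j 0 = 0"
    "modulus (reindex Z j f) = reindex Z j (modulus f)"
    "reindex Z j f \<in> ell2_on Z"
  using assms
  by (simp_all add: Rep_reindex plus_ell2.rep_eq minus_ell2.rep_eq scaleC_ell2.rep_eq
      scaleR_ell2.rep_eq zero_ell2.rep_eq modulus.rep_eq ell2_on_def Rep_ell2_inject[symmetric] fun_eq_iff)

lemma reindex_sum:
  assumes "inj_on j Z"
  shows "reindex Z j (\<Sum>i\<in>I. f i) = (\<Sum>i\<in>I. reindex Z j (f i))"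
  by (induction I rule: infinite_finite_induct) (simp_all add: reindex_linear[OF assms])

lemma norm_reindex:
  assumes "inj_on j Z" and "f \<in> ell2_on (j ` Z)"
  shows "norm (reindex Z j f) = norm f"
proof -
  have "(norm (reindex Z j f))\<^sup>2 = (\<Sum>\<^sub>\<infinity>z\<in>Z. (cmod (Rep_ell2 f (j z)))\<^sup>2)"
    unfolding norm_ell2_square by (rule infsum_cong_neutral) (auto simp: Rep_reindex[OF assms(1)])
  also have "\<dots> = (\<Sum>\<^sub>\<infinity>y\<in>j ` Z. (cmod (Rep_ell2 f y))\<^sup>2)"
    using infsum_reindex[OF assms(1), of "\<lambda>y. (cmod (Rep_ell2 f y))\<^sup>2"] by (simp add: o_def)
  also have "\<dots> = (norm f)\<^sup>2"
    unfolding norm_ell2_square by (rule infsum_cong_neutral) (use assms(2) in \<open>auto simp: ell2_on_def\<close>)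
  finally show ?thesis by simp
qed

lemma norm_reindex_le:
  assumes "inj_on j Z"
  shows "norm (reindex Z j f) \<le> norm f"
proof -
  have "(norm (reindex Z j f))\<^sup>2 = (\<Sum>\<^sub>\<infinity>z\<in>Z. (cmod (Rep_ell2 f (j z)))\<^sup>2)"
    unfolding norm_ell2_square by (rule infsum_cong_neutral) (auto simp: Rep_reindex[OF assms(1)])
  also have "\<dots> = (\<Sum>\<^sub>\<infinity>y\<in>j ` Z. (cmod (Rep_ell2 f y))\<^sup>2)"
    using infsum_reindex[OF assms(1), of "\<lambda>y. (cmod (Rep_ell2 f y))\<^sup>2"] by (simp add: o_def)
  also have "\<dots> \<le> (norm f)\<^sup>2"
    unfolding norm_ell2_square
    using summable_on_subset_banach[OF summable_Rep_ell2 subset_UNIV] summable_Rep_ell2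
    by (rule infsum_mono_neutral) simp_all
  finally show ?thesis by (simp add: power2_le_iff_abs_le)
qed

lemma reindex_reindex:
  assumes "inj_on j Z" "inj_on k W" "k ` W \<subseteq> Z"
  shows "reindex W k (reindex Z j f) = reindex W (\<lambda>w. j (k w)) f"
proof -
  have "inj_on (\<lambda>w. j (k w)) W"
    using comp_inj_on[OF assms(2) inj_on_subset[OF assms(1,3)]] by (simp add: o_def)
  then show ?thesis using assms by (auto intro!: ell2_eqI simp: Rep_reindex image_subset_iff)
qed

lemma reindex_cong:
  "(\<And>z. z \<in> Z \<Longrightarrow> j z = k z) \<Longrightarrow> reindex Z j f = reindex Z k f"
  unfolding reindex_def by (rule arg_cong[where f = Abs_ell2]) auto

lemma reindex_id:
  assumes "f \<in> ell2_on Z"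
  shows "reindex Z (\<lambda>z. z) f = f"
  using assms by (auto intro!: ell2_eqI simp: Rep_reindex ell2_on_def)

lemma ell2_on_linear:
  shows "0 \<in> ell2_on Y" "\<lbrakk>f \<in> ell2_on Y; g \<in> ell2_on Y\<rbrakk> \<Longrightarrow> f + g \<in> ell2_on Y"
    "f \<in> ell2_on Y \<Longrightarrow> c *\<^sub>C f \<in> ell2_on Y" "f \<in> ell2_on Y \<Longrightarrow> r *\<^sub>R f \<in> ell2_on Y"
    "\<lbrakk>f \<in> ell2_on Y; g \<in> ell2_on Y\<rbrakk> \<Longrightarrow> f - g \<in> ell2_on Y"
    "f \<in> ell2_on Y \<Longrightarrow> modulus f \<in> ell2_on Y"
  by (auto simp: ell2_on_def plus_ell2.rep_eq minus_ell2.rep_eq scaleC_ell2.rep_eq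
      scaleR_ell2.rep_eq zero_ell2.rep_eq modulus.rep_eq)

lemma Rep_ell2_sum: "Rep_ell2 (\<Sum>i\<in>I. f i) y = (\<Sum>i\<in>I. Rep_ell2 (f i) y)"
  by (induction I rule: infinite_finite_induct) (simp_all add: plus_ell2.rep_eq zero_ell2.rep_eq)

lemma sum_in_ell2_on: "(\<And>i. i \<in> I \<Longrightarrow> f i \<in> ell2_on Y) \<Longrightarrow> (\<Sum>i\<in>I. f i) \<in> ell2_on Y"
  by (induction I rule: infinite_finite_induct) (simp_all add: ell2_on_linear)

lemma reindex_inv_into:
  assumes "bij_betw j Z Y" "f \<in> ell2_on Y"
  shows "reindex Y (inv_into Z j) (reindex Z j f) = f"
proof -
  have inj: "inj_on j Z" "inj_on (inv_into Z j) Y" "inv_into Z j ` Y = Z"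
    using assms(1) bij_betw_inv_into[OF assms(1)] by (auto simp: bij_betw_def)
  have "reindex Y (inv_into Z j) (reindex Z j f) = reindex Y (\<lambda>y. j (inv_into Z j y)) f"
    by (rule reindex_reindex) (use inj in simp_all)
  also have "\<dots> = reindex Y (\<lambda>y. y) f"
    by (rule reindex_cong) (use assms(1) bij_betw_inv_into_right in fastforce)
  finally show ?thesis by (simp add: reindex_id assms(2))
qed

lemma ell2_on_closed:
  assumes "\<And>n. p n \<in> ell2_on Y" "p \<longlonglongrightarrow> f"
  shows "f \<in> ell2_on Y"
  unfolding ell2_on_def
proof (intro CollectI allI impI)
  fix y assume "y \<notin> Y"
  then have "Rep_ell2 (p n) y = 0" for n using assms(1) by (auto simp: ell2_on_def)
  then show "Rep_ell2 f y = 0" using LIMSEQ_unique[OF tendsto_Rep_ell2[OF assms(2), of y]] by simp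
qed

lemma countable_support_ell2: "countable {y. Rep_ell2 f y \<noteq> 0}"
  using summable_countable_real[OF summable_Rep_ell2[of f]] by simp

text \<open>The weighted variance of the \<open>v i\<close> about their average is at most \<open>1\<close> minus the squared norm of the
  average, and a single term of the variance is at most the whole sum.\<close>

lemma uniformly_convex_average:
  fixes v :: "'i \<Rightarrow> 'e::real_inner"
  assumes fin: "finite I" and p: "\<And>i. i \<in> I \<Longrightarrow> 0 \<le> p i" "(\<Sum>i\<in>I. p i) \<le> 1"
    and v: "\<And>i. i \<in> I \<Longrightarrow> norm (v i) \<le> 1" and i: "i \<in> I"
  shows "p i * (norm (v i - (\<Sum>k\<in>I. p k *\<^sub>R v k)))\<^sup>2 \<le> 1 - (norm (\<Sum>k\<in>I. p k *\<^sub>R v k))\<^sup>2"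
proof -
  define w where "w = (\<Sum>k\<in>I. p k *\<^sub>R v k)"
  have "p i * (norm (v i - w))\<^sup>2 \<le> (\<Sum>k\<in>I. p k * (norm (v k - w))\<^sup>2)"
    by (rule member_le_sum[OF i _ fin, of "\<lambda>k. p k * (norm (v k - w))\<^sup>2"]) (use p in simp)
  also have "\<dots> = (\<Sum>k\<in>I. p k * (norm (v k))\<^sup>2 - 2 * ((p k *\<^sub>R v k) \<bullet> w) + p k * (norm w)\<^sup>2)"
    by (simp add: power2_norm_eq_inner inner_diff_left inner_diff_right inner_commute algebra_simps)
  also have "\<dots> = (\<Sum>k\<in>I. p k * (norm (v k))\<^sup>2) - 2 * (norm w)\<^sup>2 + (\<Sum>k\<in>I. p k) * (norm w)\<^sup>2"
    by (simp add: sum.distrib sum_subtractf sum_distrib_left[symmetric] sum_distrib_right[symmetric]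
        inner_sum_left[symmetric] w_def[symmetric] power2_norm_eq_inner del: inner_scaleR_left)
  also have "\<dots> \<le> 1 - 2 * (norm w)\<^sup>2 + 1 * (norm w)\<^sup>2"
  proof (intro add_mono diff_mono mult_right_mono p(2))
    have "(\<Sum>k\<in>I. p k * (norm (v k))\<^sup>2) \<le> (\<Sum>k\<in>I. p k * 1)"
      using v by (intro sum_mono mult_left_mono p(1)) (simp_all add: power_le_one)
    then show "(\<Sum>k\<in>I. p k * (norm (v k))\<^sup>2) \<le> 1" using p(2) by simp
  qed simp_all
  finally show ?thesis unfolding w_def by simp
qed

section \<open>Coverings of groups by cosets\<close>

context group begin

lemma inv_cancel_left:
  assumes "x \<in> carrier G" "y \<in> carrier G"
  shows "x \<otimes> (inv x \<otimes> y) = y" "inv x \<otimes> (x \<otimes> y) = y"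
  using assms by (simp_all add: m_assoc[symmetric])

text \<open>B. H. Neumann's lemma. If the given cosets of \<open>H\<close> do not already cover the group, then a missing
  coset \<open>H b\<close> is covered by the cosets of the other subgroups. Right translates of this covering cover every coset
  of \<open>H\<close>, so \<open>H\<close> can be dropped from the list.\<close>

lemma neumann_covering:
  assumes "finite \<H>" and "\<And>H. H \<in> \<H> \<Longrightarrow> subgroup H G"
    and "\<And>H. H \<in> \<H> \<Longrightarrow> finite (A H) \<and> A H \<subseteq> carrier G"
    and "\<And>g. g \<in> carrier G \<Longrightarrow> \<exists>H\<in>\<H>. \<exists>h\<in>H. \<exists>a\<in>A H. g = h \<otimes> a"
  shows "\<exists>H\<in>\<H>. \<exists>B. finite B \<and> B \<subseteq> carrier G \<and> (\<forall>g\<in>carrier G. \<exists>h\<in>H. \<exists>b\<in>B. g = h \<otimes> b)"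
  using assms
proof (induction \<H> arbitrary: A rule: finite_induct)
  case empty
  from empty.prems(3)[OF one_closed] show ?case by simp
next
  case (insert H \<H>)
  have H: "subgroup H G" and AH: "finite (A H)" "A H \<subseteq> carrier G" using insert.prems by auto
  interpret H: subgroup H G by fact
  show ?case
  proof (cases "\<forall>g\<in>carrier G. \<exists>h\<in>H. \<exists>b\<in>A H. g = h \<otimes> b")
    case True
    then show ?thesis using AH by blast
  next
    case False
    then obtain b where b: "b \<in> carrier G" "\<And>h a. h \<in> H \<Longrightarrow> a \<in> A H \<Longrightarrow> b \<noteq> h \<otimes> a" by blast
    define A' where "A' K = A K \<union> (\<lambda>(a', a). a' \<otimes> (inv b \<otimes> a)) ` (A K \<times> A H)" for K
    have "\<exists>K\<in>\<H>. \<exists>B. finite B \<and> B \<subseteq> carrier G \<and> (\<forall>g\<in>carrier G. \<exists>h\<in>K. \<exists>b\<in>B. g = h \<otimes> b)"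
    proof (rule insert.IH[of A'])
      fix K assume K: "K \<in> \<H>"
      show "subgroup K G" using K insert.prems by blast
      have "finite (A K)" "A K \<subseteq> carrier G" using K insert.prems(2)[of K] by auto
      then show "finite (A' K) \<and> A' K \<subseteq> carrier G" using AH b(1) unfolding A'_def by auto
    next
      fix g assume g: "g \<in> carrier G"
      obtain K h a where K: "K \<in> insert H \<H>" "h \<in> K" "a \<in> A K" "g = h \<otimes> a"
        using insert.prems(3)[OF g] by blast
      show "\<exists>K\<in>\<H>. \<exists>h\<in>K. \<exists>a\<in>A' K. g = h \<otimes> a"
      proof (cases "K = H")
        case True
        have ac: "a \<in> carrier G" and hc: "h \<in> carrier G" using True K AH by auto
        obtain K' h' a' where K': "K' \<in> insert H \<H>" "h' \<in> K'" "a' \<in> A K'" "h \<otimes> b = h' \<otimes> a'"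
          using insert.prems(3)[of "h \<otimes> b"] hc b(1) by blast
        have a'c: "a' \<in> carrier G" "h' \<in> carrier G"
          using K' insert.prems(1)[of K'] insert.prems(2)[of K'] subgroup.mem_carrier[of K' G h'] by auto
        have "K' \<noteq> H"
        proof
          assume eq: "K' = H"
          have "b = inv h \<otimes> (h \<otimes> b)" using hc b(1) by (simp add: m_assoc[symmetric])
          also have "\<dots> = (inv h \<otimes> h') \<otimes> a'" using K'(4) hc a'c by (simp add: m_assoc)
          finally show False using b(2)[of "inv h \<otimes> h'" a'] K K' True eq by simp
        qed
        then have K'2: "K' \<in> \<H>" using K'(1) by simp
        have "g = (h \<otimes> b) \<otimes> (inv b \<otimes> a)" using K(4) hc b(1) ac by (simp add: m_assoc inv_cancel_left)
        also have "\<dots> = h' \<otimes> (a' \<otimes> (inv b \<otimes> a))" using K'(4) a'c b(1) ac by (simp add: m_assoc)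
        finally have "g = h' \<otimes> (a' \<otimes> (inv b \<otimes> a))" .
        moreover have "a' \<otimes> (inv b \<otimes> a) \<in> A' K'" using K K' True unfolding A'_def by auto
        ultimately show ?thesis using K'(2) K'2 by blast
      next
        case False
        then show ?thesis using K unfolding A'_def by blast
      qed
    qed
    then show ?thesis by blast
  qed
qed

lemma conjugate_subgroup:
  assumes H: "subgroup H G" and u: "u \<in> carrier G"
  shows "subgroup ((\<lambda>h. u \<otimes> h \<otimes> inv u) ` H) G"
proof -
  interpret H: subgroup H G by fact
  show ?thesis
  proof (rule subgroupI)
    show "(\<lambda>h. u \<otimes> h \<otimes> inv u) ` H \<subseteq> carrier G" using u by auto
    show "(\<lambda>h. u \<otimes> h \<otimes> inv u) ` H \<noteq> {}" using H.one_closed by blast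
  next
    fix x assume "x \<in> (\<lambda>h. u \<otimes> h \<otimes> inv u) ` H"
    then obtain h where h: "h \<in> H" "x = u \<otimes> h \<otimes> inv u" by blast
    then have "inv x = u \<otimes> inv h \<otimes> inv u" using u by (simp add: inv_mult_group m_assoc)
    then show "inv x \<in> (\<lambda>h. u \<otimes> h \<otimes> inv u) ` H" using h by blast
    fix y assume "y \<in> (\<lambda>h. u \<otimes> h \<otimes> inv u) ` H"
    then obtain k where k: "k \<in> H" "y = u \<otimes> k \<otimes> inv u" by blast
    have "x \<otimes> y = u \<otimes> (h \<otimes> k) \<otimes> inv u"
      using u h k by (simp add: m_assoc inv_cancel_left)
    then show "x \<otimes> y \<in> (\<lambda>h. u \<otimes> h \<otimes> inv u) ` H" using h k by blast
  qed
qed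

text \<open>Since \<open>u H u'\<close> is a right coset of the conjugate \<open>u H u\<^sup>-\<^sup>1\<close>, Neumann's lemma provides a conjugate of finite
  index, and then \<open>H\<close> has finite index too.\<close>

lemma finite_left_transversal:
  assumes H: "subgroup H G" and U: "finite U" "U \<subseteq> carrier G"
    and cover: "\<And>g. g \<in> carrier G \<Longrightarrow> \<exists>u\<in>U. \<exists>h\<in>H. \<exists>u'\<in>U. g = u \<otimes> h \<otimes> u'"
  obtains R where "finite R" "R \<subseteq> carrier G"
    "\<And>g. g \<in> carrier G \<Longrightarrow> \<exists>t\<in>R. inv t \<otimes> g \<in> H"
    "\<And>t t'. \<lbrakk>t \<in> R; t' \<in> R; inv t \<otimes> t' \<in> H\<rbrakk> \<Longrightarrow> t = t'"
proof -
  interpret H: subgroup H G by fact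
  define \<H> where "\<H> = (\<lambda>u. (\<lambda>h. u \<otimes> h \<otimes> inv u) ` H) ` U"
  define A where "A = (\<lambda>(u, u'). u \<otimes> u') ` (U \<times> U)"
  have "\<exists>K\<in>\<H>. \<exists>B. finite B \<and> B \<subseteq> carrier G \<and> (\<forall>g\<in>carrier G. \<exists>h\<in>K. \<exists>b\<in>B. g = h \<otimes> b)"
  proof (rule neumann_covering[where A = "\<lambda>_. A"])
    show "finite \<H>" using U by (simp add: \<H>_def)
    show "subgroup K G" if "K \<in> \<H>" for K
      using that U conjugate_subgroup[OF H] by (auto simp: \<H>_def)
    show "finite A \<and> A \<subseteq> carrier G" using U by (auto simp: A_def)
    fix g assume "g \<in> carrier G"
    then obtain u h u' where *: "u \<in> U" "h \<in> H" "u' \<in> U" "g = u \<otimes> h \<otimes> u'" using cover by blast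
    have "u \<in> carrier G" "u' \<in> carrier G" using * U by auto
    moreover from this have "inv u \<otimes> (u \<otimes> u') = u'" by (simp add: m_assoc[symmetric])
    ultimately have "g = (u \<otimes> h \<otimes> inv u) \<otimes> (u \<otimes> u')" using * by (simp add: m_assoc)
    moreover have "u \<otimes> u' \<in> A" using * by (auto simp: A_def)
    moreover have "u \<otimes> h \<otimes> inv u \<in> (\<lambda>h. u \<otimes> h \<otimes> inv u) ` H" using * by blast
    ultimately show "\<exists>K\<in>\<H>. \<exists>h\<in>K. \<exists>a\<in>A. g = h \<otimes> a" using * unfolding \<H>_def by blast
  qed
  then obtain K B where K: "K \<in> \<H>" and B: "finite B" "B \<subseteq> carrier G"
    and KB: "\<forall>g\<in>carrier G. \<exists>h\<in>K. \<exists>b\<in>B. g = h \<otimes> b" by meson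
  obtain u where u: "u \<in> U" and K_eq: "K = (\<lambda>h. u \<otimes> h \<otimes> inv u) ` H" using K unfolding \<H>_def by (rule imageE)
  have uB: "\<exists>h\<in>H. \<exists>b\<in>B. g = u \<otimes> h \<otimes> inv u \<otimes> b" if "g \<in> carrier G" for g
    using bspec[OF KB that] unfolding K_eq bex_simps by blast
  have uc: "u \<in> carrier G" using u U by blast
  define C where "C = (\<lambda>b. inv b \<otimes> u) ` B"
  have C: "finite C" "C \<subseteq> carrier G" using B uc by (auto simp: C_def)
  have C_cover: "\<exists>t\<in>C. inv t \<otimes> g \<in> H" if g: "g \<in> carrier G" for g
  proof -
    obtain h b where hb: "h \<in> H" "b \<in> B" "u \<otimes> inv g = u \<otimes> h \<otimes> inv u \<otimes> b"
      using uB[of "u \<otimes> inv g"] uc g by blast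
    have bc: "b \<in> carrier G" using hb B by blast
    have "u \<otimes> inv g = u \<otimes> (h \<otimes> (inv u \<otimes> b))" using hb bc uc by (simp add: m_assoc)
    then have "inv g = h \<otimes> (inv u \<otimes> b)" using hb bc uc g by simp
    then have "inv (inv g) = inv (h \<otimes> (inv u \<otimes> b))" by simp
    then have "g = (inv b \<otimes> u) \<otimes> inv h" using hb(1) bc uc g by (simp add: inv_mult_group)
    then have "inv (inv b \<otimes> u) \<otimes> g = inv h"
      using inv_cancel_left(2)[of "inv b \<otimes> u" "inv h"] hb(1) bc uc by simp
    then have "inv (inv b \<otimes> u) \<otimes> g \<in> H" using H.m_inv_closed[OF hb(1)] by simp
    then show ?thesis using hb(2) unfolding C_def by (rule bexI[OF _ imageI])
  qed
  \<comment> \<open>The predicate under \<open>SOME\<close> depends only on the coset \<open>g H\<close>, so each coset gets exactly one representative.\<close>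
  define f where "f g = (SOME t. t \<in> C \<and> inv t \<otimes> g \<in> H)" for g
  have f: "f g \<in> C" "inv (f g) \<otimes> g \<in> H" if "g \<in> carrier G" for g
    using someI_ex[of "\<lambda>t. t \<in> C \<and> inv t \<otimes> g \<in> H"] C_cover[OF that] unfolding f_def by blast+
  have trans: "inv x \<otimes> z \<in> H"
    if "inv x \<otimes> y \<in> H" "inv y \<otimes> z \<in> H" "x \<in> carrier G" "y \<in> carrier G" "z \<in> carrier G" for x y z
  proof -
    have "(inv x \<otimes> y) \<otimes> (inv y \<otimes> z) = inv x \<otimes> z" using that(3-5) by (simp add: m_assoc inv_cancel_left)
    then show ?thesis using H.m_closed[OF that(1,2)] by simp
  qed
  have sym: "inv y \<otimes> x \<in> H" if "inv x \<otimes> y \<in> H" "x \<in> carrier G" "y \<in> carrier G" for x y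
    using H.m_inv_closed[OF that(1)] that(2,3) by (simp add: inv_mult_group)
  show ?thesis
  proof (rule that[of "f ` carrier G"])
    have sub: "f ` carrier G \<subseteq> C" using f(1) by blast
    show "finite (f ` carrier G)" using finite_subset[OF sub C(1)] .
    show "f ` carrier G \<subseteq> carrier G" using sub C(2) by blast
    show "\<exists>t\<in>f ` carrier G. inv t \<otimes> g \<in> H" if "g \<in> carrier G" for g using f(2)[OF that] that by blast
    fix t t' assume t: "t \<in> f ` carrier G" "t' \<in> f ` carrier G" "inv t \<otimes> t' \<in> H"
    then obtain g g' where g: "g \<in> carrier G" "t = f g" "g' \<in> carrier G" "t' = f g'" by blast
    have tc: "t \<in> carrier G" "t' \<in> carrier G" using t sub C(2) by auto
    have tg: "inv t \<otimes> g \<in> H" "inv t' \<otimes> g' \<in> H" using f(2) g by auto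
    have "inv g \<otimes> g' \<in> H"
      using trans[OF sym[OF tg(1)] trans[OF t(3) tg(2)]] tc g by simp
    then have "inv x \<otimes> g \<in> H \<longleftrightarrow> inv x \<otimes> g' \<in> H" if "x \<in> C" for x
      using trans[of x g g'] trans[of x g' g] sym[of g g'] that C(2) g by blast
    then have "f g = f g'" unfolding f_def by metis
    then show "t = t'" using g by simp
  qed
qed

lemma countable_generate:
  assumes "countable A" "A \<subseteq> carrier G"
  shows "countable (generate G A)"
proof -
  have "generate G A \<subseteq> (\<lambda>xs. foldr (\<otimes>) xs \<one>) ` lists (A \<union> m_inv G ` A)"
  proof
    fix g assume "g \<in> generate G A"
    then show "g \<in> (\<lambda>xs. foldr (\<otimes>) xs \<one>) ` lists (A \<union> m_inv G ` A)"
    proof (induction rule: generate.induct)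
      case one
      show ?case by (rule image_eqI[of _ _ "[]"]) auto
    next
      case (incl h)
      then show ?case using assms(2) by (intro image_eqI[of _ _ "[h]"]) auto
    next
      case (inv h)
      then show ?case using assms(2) by (intro image_eqI[of _ _ "[inv h]"]) auto
    next
      case (eng h1 h2)
      then obtain xs ys where xs: "xs \<in> lists (A \<union> m_inv G ` A)" "h1 = foldr (\<otimes>) xs \<one>"
        and ys: "ys \<in> lists (A \<union> m_inv G ` A)" "h2 = foldr (\<otimes>) ys \<one>" by blast
      have ys_closed: "foldr (\<otimes>) ys \<one> \<in> carrier G"
        using ys(1) assms(2) by (induction ys) auto
      have "foldr (\<otimes>) (xs @ ys) \<one> = foldr (\<otimes>) xs \<one> \<otimes> foldr (\<otimes>) ys \<one> \<and> foldr (\<otimes>) xs \<one> \<in> carrier G"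
        using xs(1) assms(2) ys_closed by (induction xs) (auto simp: m_assoc subset_iff)
      then show ?case using xs ys by (intro image_eqI[of _ _ "xs @ ys"]) auto
    qed
  qed
  then show ?thesis by (rule countable_subset) (use assms in auto)
qed

end

section \<open>Hoelder spaces\<close>

definition holder_real_norm ::
    "real \<Rightarrow> (nat \<Rightarrow> 'a) set \<Rightarrow> ((nat \<Rightarrow> 'a) \<Rightarrow> 'e::real_normed_vector) \<Rightarrow> real" where
  "holder_real_norm \<alpha> X \<Phi> = enn2real (holder_norm \<alpha> X \<Phi>)"

text \<open>Pairs of equal points may be added to the second supremum, because \<open>0 / 0 = 0\<close>. Over a nonempty \<open>X\<close> both suprema then
  range over nonempty sets and merge into one.\<close>

lemma holder_norm_le_iff:
  assumes C: "0 \<le> C"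
  shows "holder_norm \<alpha> X \<Phi> \<le> ennreal C \<longleftrightarrow>
    (\<forall>x\<in>X. \<forall>y\<in>X. \<forall>y'\<in>X. norm (\<Phi> x) + norm (\<Phi> y - \<Phi> y') / shift_dist y y' powr \<alpha> \<le> C)"
proof (cases "X = {}")
  case True
  then show ?thesis by (simp add: holder_norm_def bot_ennreal)
next
  case False
  define D where "D = (\<lambda>(y, y'). ennreal (norm (\<Phi> y - \<Phi> y') / shift_dist y y' powr \<alpha>))"
  define P where "P = {(x, y). x \<in> X \<and> y \<in> X \<and> x \<noteq> y}"
  have D0: "D (y, y) = 0" for y by (simp add: D_def)
  have "(SUP p\<in>P. D p) = (SUP p\<in>X \<times> X. D p)"
  proof (rule antisym)
    show "(SUP p\<in>P. D p) \<le> (SUP p\<in>X \<times> X. D p)" by (rule SUP_subset_mono) (auto simp: P_def)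
    show "(SUP p\<in>X \<times> X. D p) \<le> (SUP p\<in>P. D p)"
    proof (rule SUP_least)
      fix p assume "p \<in> X \<times> X"
      then show "D p \<le> (SUP p\<in>P. D p)"
        by (cases "p \<in> P") (auto intro: SUP_upper simp: P_def D0)
    qed
  qed
  then have "holder_norm \<alpha> X \<Phi> = (SUP x\<in>X. ennreal (norm (\<Phi> x))) + (SUP p\<in>X \<times> X. D p)"
    by (simp add: holder_norm_def D_def P_def)
  also have "\<dots> = (SUP p\<in>X \<times> X. SUP x\<in>X. ennreal (norm (\<Phi> x)) + D p)"
    using False by (simp add: ennreal_SUP_add_left ennreal_SUP_add_right)
  finally have "holder_norm \<alpha> X \<Phi> \<le> ennreal C \<longleftrightarrow>
      (\<forall>p\<in>X \<times> X. \<forall>x\<in>X. ennreal (norm (\<Phi> x)) + D p \<le> ennreal C)"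
    by (simp add: SUP_le_iff)
  also have "\<dots> \<longleftrightarrow> (\<forall>x\<in>X. \<forall>y\<in>X. \<forall>y'\<in>X.
      norm (\<Phi> x) + norm (\<Phi> y - \<Phi> y') / shift_dist y y' powr \<alpha> \<le> C)"
    using C by (auto simp: D_def simp flip: ennreal_plus)
  finally show ?thesis .
qed

lemma holder_norm_finite_iff:
  "holder_norm \<alpha> X \<Phi> < \<infinity> \<longleftrightarrow> (\<exists>C\<ge>0. \<forall>x\<in>X. \<forall>y\<in>X. \<forall>y'\<in>X.
     norm (\<Phi> x) + norm (\<Phi> y - \<Phi> y') / shift_dist y y' powr \<alpha> \<le> C)"
proof
  assume fin: "holder_norm \<alpha> X \<Phi> < \<infinity>"
  then have "holder_norm \<alpha> X \<Phi> \<le> ennreal (enn2real (holder_norm \<alpha> X \<Phi>))"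
    by (simp add: ennreal_enn2real)
  then show "\<exists>C\<ge>0. \<forall>x\<in>X. \<forall>y\<in>X. \<forall>y'\<in>X.
      norm (\<Phi> x) + norm (\<Phi> y - \<Phi> y') / shift_dist y y' powr \<alpha> \<le> C"
    using holder_norm_le_iff[of "enn2real (holder_norm \<alpha> X \<Phi>)" \<alpha> X \<Phi>] enn2real_nonneg by blast
next
  assume "\<exists>C\<ge>0. \<forall>x\<in>X. \<forall>y\<in>X. \<forall>y'\<in>X.
      norm (\<Phi> x) + norm (\<Phi> y - \<Phi> y') / shift_dist y y' powr \<alpha> \<le> C"
  then obtain C where "holder_norm \<alpha> X \<Phi> \<le> ennreal C" using holder_norm_le_iff by blast
  then show "holder_norm \<alpha> X \<Phi> < \<infinity>" using order_le_less_trans ennreal_less_top by fastforce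
qed

lemma ennreal_holder_real_norm:
  "holder_norm \<alpha> X \<Phi> < \<infinity> \<Longrightarrow> ennreal (holder_real_norm \<alpha> X \<Phi>) = holder_norm \<alpha> X \<Phi>"
  by (simp add: holder_real_norm_def ennreal_enn2real)

lemma holder_real_norm_le_iff:
  assumes "holder_norm \<alpha> X \<Phi> < \<infinity>" "0 \<le> C"
  shows "holder_real_norm \<alpha> X \<Phi> \<le> C \<longleftrightarrow>
    (\<forall>x\<in>X. \<forall>y\<in>X. \<forall>y'\<in>X. norm (\<Phi> x) + norm (\<Phi> y - \<Phi> y') / shift_dist y y' powr \<alpha> \<le> C)"
  using holder_norm_le_iff[OF assms(2), of \<alpha> X \<Phi>] assms
  by (simp flip: ennreal_holder_real_norm)

lemma holder_real_norm_bound: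
  assumes "holder_norm \<alpha> X \<Phi> < \<infinity>" "x \<in> X" "y \<in> X" "y' \<in> X"
  shows "norm (\<Phi> x) + norm (\<Phi> y - \<Phi> y') / shift_dist y y' powr \<alpha> \<le> holder_real_norm \<alpha> X \<Phi>"
  using holder_real_norm_le_iff[OF assms(1), of "holder_real_norm \<alpha> X \<Phi>"] assms(2-)
  by (simp add: holder_real_norm_def)

lemma holder_variation_bound:
  assumes "holder_norm \<alpha> X \<Phi> < \<infinity>" "y \<in> X" "y' \<in> X"
  shows "norm (\<Phi> y - \<Phi> y') \<le> holder_real_norm \<alpha> X \<Phi> * shift_dist y y' powr \<alpha>"
proof (cases "y = y'")
  case False
  then have "0 < shift_dist y y' powr \<alpha>" by (simp add: shift_dist_def)
  moreover have "norm (\<Phi> y - \<Phi> y') / shift_dist y y' powr \<alpha> \<le> holder_real_norm \<alpha> X \<Phi>"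
    using holder_real_norm_bound[OF assms(1,2,2,3)] norm_ge_zero[of "\<Phi> y"] by linarith
  ultimately show ?thesis by (simp add: field_simps)
qed (simp add: shift_dist_def)

lemma holder_spaceI:
  assumes "\<And>x. x \<in> X \<Longrightarrow> \<Phi> x \<in> E" "\<And>x. x \<notin> X \<Longrightarrow> \<Phi> x = 0"
    and A: "\<And>x. x \<in> X \<Longrightarrow> norm (\<Phi> x) \<le> A"
    and B: "\<And>y y'. \<lbrakk>y \<in> X; y' \<in> X\<rbrakk> \<Longrightarrow> norm (\<Phi> y - \<Phi> y') \<le> B * shift_dist y y' powr \<alpha>"
    and nonneg: "0 \<le> A" "0 \<le> B"
  shows "\<Phi> \<in> holder_space \<alpha> X E" "holder_real_norm \<alpha> X \<Phi> \<le> A + B"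
proof -
  have le: "norm (\<Phi> x) + norm (\<Phi> y - \<Phi> y') / shift_dist y y' powr \<alpha> \<le> A + B"
    if "x \<in> X" "y \<in> X" "y' \<in> X" for x y y'
  proof (rule add_mono[OF A[OF that(1)]])
    show "norm (\<Phi> y - \<Phi> y') / shift_dist y y' powr \<alpha> \<le> B"
      using B[OF that(2,3)] nonneg by (cases "y = y'") (auto simp: shift_dist_def divide_le_eq)
  qed
  then have fin: "holder_norm \<alpha> X \<Phi> < \<infinity>"
    unfolding holder_norm_finite_iff using nonneg by (intro exI[of _ "A + B"]) simp
  then show "\<Phi> \<in> holder_space \<alpha> X E" using assms(1,2) by (simp add: holder_space_def)
  show "holder_real_norm \<alpha> X \<Phi> \<le> A + B" using holder_real_norm_le_iff[OF fin] le nonneg by simp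
qed

text \<open>A bound on the Hoelder norm is a conjunction of inequalities between finitely many values, and
  each of these passes to pointwise limits.\<close>

lemma function_space_holder:
  fixes E :: "'e::{complex_normed_vector,banach} set"
  assumes E0: "0 \<in> E" and Eadd: "\<And>u v. \<lbrakk>u \<in> E; v \<in> E\<rbrakk> \<Longrightarrow> u + v \<in> E"
    and Escale: "\<And>c v. v \<in> E \<Longrightarrow> c *\<^sub>C v \<in> E"
    and Eclosed: "\<And>p v. \<lbrakk>\<And>n::nat. p n \<in> E; p \<longlonglongrightarrow> v\<rbrakk> \<Longrightarrow> v \<in> E"
  shows "function_space (holder_space \<alpha> X E) (holder_real_norm \<alpha> X)"
proof
  note bound = holder_real_norm_bound and fin_iff = holder_norm_finite_iff
  have fin: "holder_norm \<alpha> X \<Phi> < \<infinity>" if "\<Phi> \<in> holder_space \<alpha> X E" for \<Phi>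
    using that by (simp add: holder_space_def)
  have nn: "0 \<le> holder_real_norm \<alpha> X \<Phi>" for \<Phi> :: "_ \<Rightarrow> 'e" by (simp add: holder_real_norm_def)
  show "(\<lambda>_. 0) \<in> holder_space \<alpha> X E"
    by (rule holder_spaceI(1)[where A = 0 and B = 0]) (use E0 in auto)
  fix f g :: "(nat \<Rightarrow> 'a) \<Rightarrow> 'e" and c
  assume f: "f \<in> holder_space \<alpha> X E"
  show "norm (f x) \<le> holder_real_norm \<alpha> X f" for x
  proof (cases "x \<in> X")
    case True
    then show ?thesis using bound[OF fin[OF f], of x x x] by simp
  next
    case False
    then show ?thesis using f nn by (simp add: holder_space_def)
  qed
  {
    assume g: "g \<in> holder_space \<alpha> X E"
    have le: "norm (f x + g x) + norm ((f y + g y) - (f y' + g y')) / shift_dist y y' powr \<alpha>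
        \<le> holder_real_norm \<alpha> X f + holder_real_norm \<alpha> X g" if "x \<in> X" "y \<in> X" "y' \<in> X" for x y y'
    proof -
      have "norm ((f y + g y) - (f y' + g y')) / shift_dist y y' powr \<alpha>
          \<le> (norm (f y - f y') + norm (g y - g y')) / shift_dist y y' powr \<alpha>"
        by (intro divide_right_mono norm_diff_triangle_ineq) simp
      then show ?thesis
        using bound[OF fin[OF f] that] bound[OF fin[OF g] that] norm_triangle_ineq[of "f x" "g x"]
        by (simp add: add_divide_distrib)
    qed
    then have fin': "holder_norm \<alpha> X (\<lambda>x. f x + g x) < \<infinity>"
      unfolding fin_iff using le nn
      by (intro exI[of _ "holder_real_norm \<alpha> X f + holder_real_norm \<alpha> X g"]) simp
    then show "(\<lambda>x. f x + g x) \<in> holder_space \<alpha> X E"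
      using f g Eadd by (simp add: holder_space_def)
    show "holder_real_norm \<alpha> X (\<lambda>x. f x + g x) \<le> holder_real_norm \<alpha> X f + holder_real_norm \<alpha> X g"
      using holder_real_norm_le_iff[OF fin'] le nn by simp
  }
  have scale_le: "holder_norm \<alpha> X (\<lambda>x. c *\<^sub>C h x) < \<infinity> \<and>
      holder_real_norm \<alpha> X (\<lambda>x. c *\<^sub>C h x) \<le> cmod c * holder_real_norm \<alpha> X h"
    if h: "holder_norm \<alpha> X h < \<infinity>" for c and h :: "(nat \<Rightarrow> 'a) \<Rightarrow> 'e"
  proof -
    have le: "norm (c *\<^sub>C h x) + norm (c *\<^sub>C h y - c *\<^sub>C h y') / shift_dist y y' powr \<alpha>
        \<le> cmod c * holder_real_norm \<alpha> X h" if "x \<in> X" "y \<in> X" "y' \<in> X" for x y y'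
      using mult_left_mono[OF bound[OF h that], of "cmod c"]
      by (simp add: norm_scaleC distrib_left flip: scaleC_diff_right)
    then have fin': "holder_norm \<alpha> X (\<lambda>x. c *\<^sub>C h x) < \<infinity>"
      unfolding fin_iff using nn by (intro exI[of _ "cmod c * holder_real_norm \<alpha> X h"]) simp
    show ?thesis using holder_real_norm_le_iff[OF fin'] le nn fin' by simp
  qed
  show mem: "(\<lambda>x. c *\<^sub>C f x) \<in> holder_space \<alpha> X E"
    using f Escale scale_le[OF fin[OF f], of c] by (simp add: holder_space_def)
  show "holder_real_norm \<alpha> X (\<lambda>x. c *\<^sub>C f x) = cmod c * holder_real_norm \<alpha> X f"
  proof (rule antisym)
    show "holder_real_norm \<alpha> X (\<lambda>x. c *\<^sub>C f x) \<le> cmod c * holder_real_norm \<alpha> X f"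
      using scale_le[OF fin[OF f]] by blast
    show "cmod c * holder_real_norm \<alpha> X f \<le> holder_real_norm \<alpha> X (\<lambda>x. c *\<^sub>C f x)"
    proof (cases "c = 0")
      case False
      have "holder_real_norm \<alpha> X (\<lambda>x. inverse c *\<^sub>C c *\<^sub>C f x)
          \<le> cmod (inverse c) * holder_real_norm \<alpha> X (\<lambda>x. c *\<^sub>C f x)"
        using scale_le[OF fin[OF mem]] by blast
      then have "cmod c * holder_real_norm \<alpha> X f
          \<le> cmod c * (inverse (cmod c) * holder_real_norm \<alpha> X (\<lambda>x. c *\<^sub>C f x))"
        using False by (intro mult_left_mono) (simp_all add: scaleC_scaleC norm_inverse)
      then show ?thesis using False by (simp add: mult.assoc[symmetric])
    qed (use nn in simp)
  qed
next
  fix p :: "nat \<Rightarrow> (nat \<Rightarrow> 'a) \<Rightarrow> 'e" and C f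
  assume p: "\<And>n. p n \<in> holder_space \<alpha> X E" and C: "\<And>n. holder_real_norm \<alpha> X (p n) \<le> C"
    and lim: "\<And>x. (\<lambda>n. p n x) \<longlonglongrightarrow> f x"
  have fin: "holder_norm \<alpha> X (p n) < \<infinity>" for n using p by (simp add: holder_space_def)
  have "0 \<le> holder_real_norm \<alpha> X (p 0)" by (simp add: holder_real_norm_def)
  then have C0: "0 \<le> C" using C[of 0] by linarith
  have le: "norm (f x) + norm (f y - f y') / shift_dist y y' powr \<alpha> \<le> C"
    if "x \<in> X" "y \<in> X" "y' \<in> X" for x y y'
  proof (rule LIMSEQ_le_const2)
    show "(\<lambda>n. norm (p n x) + norm (p n y - p n y') / shift_dist y y' powr \<alpha>)
        \<longlonglongrightarrow> norm (f x) + norm (f y - f y') / shift_dist y y' powr \<alpha>"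
      unfolding divide_inverse by (intro tendsto_add tendsto_mult tendsto_norm tendsto_diff lim tendsto_const)
    show "\<exists>M. \<forall>n\<ge>M. norm (p n x) + norm (p n y - p n y') / shift_dist y y' powr \<alpha> \<le> C"
      using holder_real_norm_bound[OF fin that] C order_trans by blast
  qed
  then have fin': "holder_norm \<alpha> X f < \<infinity>" unfolding holder_norm_finite_iff using C0 by blast
  have "f x \<in> E" if "x \<in> X" for x
    using Eclosed[OF _ lim[of x]] p that by (simp add: holder_space_def)
  moreover have "f x = 0" if "x \<notin> X" for x
    using LIMSEQ_unique[OF lim[of x]] p that by (simp add: holder_space_def)
  ultimately show "f \<in> holder_space \<alpha> X E \<and> holder_real_norm \<alpha> X f \<le> C"
    using fin' holder_real_norm_le_iff[OF fin' C0] le by (simp add: holder_space_def)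
qed

lemma holder_contraction:
  assumes f: "f \<in> holder_space \<alpha> X E"
    and J: "\<And>v. norm (J v) \<le> norm v" "\<And>u v. J (u - v) = J u - J v" "\<And>v. v \<in> E \<Longrightarrow> J v \<in> E'"
  shows "(\<lambda>x. J (f x)) \<in> holder_space \<alpha> X E'"
    "holder_real_norm \<alpha> X (\<lambda>x. J (f x)) \<le> holder_real_norm \<alpha> X f"
proof -
  have fin: "holder_norm \<alpha> X f < \<infinity>" using f by (simp add: holder_space_def)
  have nn: "0 \<le> holder_real_norm \<alpha> X f" by (simp add: holder_real_norm_def)
  have le: "norm (J (f x)) + norm (J (f y) - J (f y')) / shift_dist y y' powr \<alpha> \<le> holder_real_norm \<alpha> X f"
    if "x \<in> X" "y \<in> X" "y' \<in> X" for x y y'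
  proof -
    have "norm (J (f y) - J (f y')) / shift_dist y y' powr \<alpha> \<le> norm (f y - f y') / shift_dist y y' powr \<alpha>"
      using J(1)[of "f y - f y'"] by (intro divide_right_mono) (simp_all add: J(2))
    then show ?thesis using J(1)[of "f x"] holder_real_norm_bound[OF fin that] by linarith
  qed
  then have fin': "holder_norm \<alpha> X (\<lambda>x. J (f x)) < \<infinity>"
    unfolding holder_norm_finite_iff using nn by (intro exI[of _ "holder_real_norm \<alpha> X f"]) simp
  have "J 0 = 0" using J(1)[of 0] by simp
  then show "(\<lambda>x. J (f x)) \<in> holder_space \<alpha> X E'"
    using f J(3) fin' by (auto simp: holder_space_def)
  show "holder_real_norm \<alpha> X (\<lambda>x. J (f x)) \<le> holder_real_norm \<alpha> X f"
    using holder_real_norm_le_iff[OF fin' nn] le by blast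
qed

lemma holder_spectrum_eq_spec:
  fixes E :: "'e::{complex_normed_vector,banach} set"
  assumes fs: "function_space (holder_space \<alpha> X E) (holder_real_norm \<alpha> X)"
  shows "bounded_op \<alpha> X E T \<longleftrightarrow>
      (\<exists>C. function_space.bounded_by (holder_space \<alpha> X E) (holder_real_norm \<alpha> X) C T)"
    "holder_spectrum \<alpha> X E T = function_space.spec (holder_space \<alpha> X E) (holder_real_norm \<alpha> X) T"
proof -
  interpret function_space "holder_space \<alpha> X E" "holder_real_norm \<alpha> X" by (rule fs)
  have eq: "ennreal (holder_real_norm \<alpha> X \<Phi>) = holder_norm \<alpha> X \<Phi>" if "\<Phi> \<in> holder_space \<alpha> X E" for \<Phi>
    using that ennreal_holder_real_norm[of \<alpha> X \<Phi>] by (simp add: holder_space_def)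
  have norm_iff: "holder_norm \<alpha> X (T \<Phi>) \<le> ennreal C * holder_norm \<alpha> X \<Phi> \<longleftrightarrow>
      holder_real_norm \<alpha> X (T \<Phi>) \<le> max 0 C * holder_real_norm \<alpha> X \<Phi>"
    if "T \<Phi> \<in> holder_space \<alpha> X E" "\<Phi> \<in> holder_space \<alpha> X E" for \<Phi> C T
  proof -
    have "ennreal C * holder_norm \<alpha> X \<Phi> = ennreal (max 0 C * holder_real_norm \<alpha> X \<Phi>)"
      using N_nonneg[OF that(2)] by (simp add: max_def ennreal_mult' ennreal_neg flip: eq[OF that(2)])
    then show ?thesis using N_nonneg[OF that(2)] by (simp flip: eq[OF that(1)])
  qed
  show iff: "bounded_op \<alpha> X E T \<longleftrightarrow> (\<exists>C. bounded_by C T)" for T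
  proof
    assume op: "bounded_op \<alpha> X E T"
    then have lin: "linear_op T" unfolding bounded_op_def linear_op_def by blast
    obtain C where "\<forall>\<Phi>\<in>holder_space \<alpha> X E. holder_norm \<alpha> X (T \<Phi>) \<le> ennreal C * holder_norm \<alpha> X \<Phi>"
      using op unfolding bounded_op_def by blast
    then have "bounded_by (max 0 C) T"
      using lin norm_iff linear_opD(1)[OF lin] unfolding bounded_by_def by blast
    then show "\<exists>C. bounded_by C T" by blast
  next
    assume "\<exists>C. bounded_by C T"
    then obtain C where C: "bounded_by C T" by blast
    note lin = bounded_by_linear[OF C]
    have "holder_norm \<alpha> X (T \<Phi>) \<le> ennreal C * holder_norm \<alpha> X \<Phi>" if \<Phi>: "\<Phi> \<in> holder_space \<alpha> X E" for \<Phi>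
    proof -
      have "holder_real_norm \<alpha> X (T \<Phi>) \<le> C * holder_real_norm \<alpha> X \<Phi>" by (rule bounded_byD[OF C \<Phi>])
      also have "\<dots> \<le> max 0 C * holder_real_norm \<alpha> X \<Phi>" by (intro mult_right_mono N_nonneg \<Phi>) simp
      finally show ?thesis
        using norm_iff[where T = T and \<Phi> = \<Phi> and C = C] linear_opD(1)[OF lin \<Phi>] \<Phi> by blast
    qed
    then show "bounded_op \<alpha> X E T"
      using linear_opD[OF lin] unfolding bounded_op_def by blast
  qed
  show "holder_spectrum \<alpha> X E T = spec T"
    unfolding holder_spectrum_def spec_def inverse_at_def iff by blast
qed

section \<open>Irreducible subshifts of finite type\<close>

definition agree :: "nat \<Rightarrow> (nat \<Rightarrow> 'a) \<Rightarrow> (nat \<Rightarrow> 'a) \<Rightarrow> bool" where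
  "agree k x y \<longleftrightarrow> (\<forall>i<k. x i = y i)"

definition graft :: "nat \<Rightarrow> (nat \<Rightarrow> 'a) \<Rightarrow> (nat \<Rightarrow> 'a) \<Rightarrow> nat \<Rightarrow> 'a" where
  "graft n x y = (\<lambda>i. if i < n then x i else y (i - n))"

lemma agree_refl [simp]: "agree k x x"
  by (simp add: agree_def)

lemma agree_sym: "agree k x y \<Longrightarrow> agree k y x"
  by (simp add: agree_def)

lemma agree_trans: "agree k x y \<Longrightarrow> agree k y z \<Longrightarrow> agree k x z"
  by (simp add: agree_def)

lemma agree_mono: "agree k x y \<Longrightarrow> l \<le> k \<Longrightarrow> agree l x y"
  by (simp add: agree_def)

lemma funpow_shift: "(shift ^^ n) x i = x (n + i)"
  by (induction n arbitrary: i) (simp_all add: shift_def)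

lemma funpow_shift_graft [simp]: "(shift ^^ n) (graft n x y) = y"
  by (rule ext) (simp add: funpow_shift graft_def)

lemma shift_graft_1 [simp]: "shift (graft 1 x y) = y"
  using funpow_shift_graft[of 1 x y] by simp

lemma agree_graft: "agree n x (graft n x y)"
  by (simp add: agree_def graft_def)

lemma agree_graft_overlap:
  assumes "agree k ((shift ^^ n) x) y"
  shows "agree (n + k) x (graft n x y)"
  unfolding agree_def
proof (intro allI impI)
  fix i assume i: "i < n + k"
  show "x i = graft n x y i"
  proof (cases "i < n")
    case False
    then have "(shift ^^ n) x (i - n) = y (i - n)" using assms i by (simp add: agree_def)
    then show ?thesis using False by (simp add: graft_def funpow_shift)
  qed (simp add: graft_def)
qed

lemma agree_funpow_shift: "agree (n + k) x y \<Longrightarrow> agree k ((shift ^^ n) x) ((shift ^^ n) y)"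
  by (simp add: agree_def funpow_shift)

lemma shift_dist_le:
  assumes "agree k x y"
  shows "shift_dist x y \<le> exp (- real k)"
proof (cases "x = y")
  case False
  then obtain n where "x n \<noteq> y n" by blast
  then have "x (LEAST n. x n \<noteq> y n) \<noteq> y (LEAST n. x n \<noteq> y n)" by (rule LeastI)
  then have "k \<le> (LEAST n. x n \<noteq> y n)" using assms unfolding agree_def by (meson not_le_imp_less)
  then show ?thesis using False by (simp add: shift_dist_def)
qed (simp add: shift_dist_def)

lemma shift_dist_ge:
  assumes "\<not> agree k x y"
  shows "exp (- real k) \<le> shift_dist x y"
proof -
  obtain n where n: "n < k" "x n \<noteq> y n" using assms by (auto simp: agree_def)
  then have "(LEAST n. x n \<noteq> y n) \<le> n" by (intro Least_le)
  then show ?thesis using n by (auto simp: shift_dist_def)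
qed

lemma shift_dist_shift:
  assumes "x 0 = y 0"
  shows "shift_dist x y = exp (- 1) * shift_dist (shift x) (shift y)"
proof (cases "x = y")
  case False
  then obtain n where n: "x n \<noteq> y n" by blast
  then have "shift x \<noteq> shift y"
    using assms unfolding shift_def fun_eq_iff by (metis not0_implies_Suc)
  moreover have "(LEAST n. x n \<noteq> y n) = Suc (LEAST n. x (Suc n) \<noteq> y (Suc n))"
    by (rule Least_Suc[of _ n]) (use n assms in auto)
  ultimately show ?thesis using False by (simp add: shift_dist_def shift_def mult_exp_exp)
qed (simp add: shift_dist_def)

text \<open>The two properties through which an irreducible subshift of finite type is used: points
  that overlap in \<open>m\<close> letters can be glued, and every point has a backward orbit that ends in any given
  cylinder of length \<open>m\<close>. The memory \<open>m\<close> is a parameter so that it can be chosen large enough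
  for a given locally constant function.\<close>

locale irreducible_sft =
  fixes X :: "(nat \<Rightarrow> 'a::finite) set" and m :: nat
  assumes nonempty: "X \<noteq> {}"
    and m_pos: "0 < m"
    and shift_mem: "x \<in> X \<Longrightarrow> shift x \<in> X"
    and graft_mem: "\<lbrakk>x \<in> X; y \<in> X; agree m ((shift ^^ n) x) y\<rbrakk> \<Longrightarrow> graft n x y \<in> X"
    and connect: "\<lbrakk>x \<in> X; y \<in> X\<rbrakk> \<Longrightarrow> \<exists>z\<in>X. \<exists>n>0. agree m x z \<and> (shift ^^ n) z = y"

text \<open>A window of length \<open>N \<le> m\<close> in a glued sequence lies entirely in one of the two overlapping pieces.\<close>

lemma irreducible_sftI:
  fixes X :: "(nat \<Rightarrow> 'a::finite) set"
  assumes sub: "subshift X" and trans: "topologically_transitive X" and nonempty: "X \<noteq> {}"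
    and N: "\<And>x. x \<in> X \<longleftrightarrow> (\<forall>i. admissible X (subword x i N))" and m: "N \<le> m" "0 < m"
  shows "irreducible_sft X m"
proof
  show "X \<noteq> {}" "0 < m" by fact+
  show "shift x \<in> X" if "x \<in> X" for x using sub that by (auto simp: subshift_def)
  show graft: "graft n x y \<in> X" if x: "x \<in> X" and y: "y \<in> X" and ag: "agree m ((shift ^^ n) x) y" for x y n
    unfolding N
  proof
    fix i
    show "admissible X (subword (graft n x y) i N)"
    proof (cases "i \<le> n")
      case True
      have "subword (graft n x y) i N = subword x i N"
        unfolding subword_def
        using agree_graft_overlap[OF ag] True m by (intro map_cong) (auto simp: agree_def)
      then show ?thesis using x N by simp
    next
      case False
      have "subword (graft n x y) i N = subword y (i - n) N"
        unfolding subword_def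
        by (rule nth_equalityI) (use False in \<open>auto simp: graft_def nth_append\<close>)
      then show ?thesis using y N by simp
    qed
  qed
  fix x y assume x: "x \<in> X" and y: "y \<in> X"
  have adm: "admissible X (subword x 0 m)" if "x \<in> X" for x
    using that by (auto simp: admissible_def subword_def)
  obtain w where "admissible X (subword x 0 m @ w @ subword y 0 m)" (is "admissible X ?w")
    using trans adm[OF x] adm[OF y] unfolding topologically_transitive_def by blast
  then obtain u where u: "u \<in> X" "?w = subword u 0 (length ?w)" unfolding admissible_def by blast
  define n where "n = m + length w"
  have nth: "?w ! i = u i" if "i < m + length w + m" for i
    using arg_cong[OF u(2), of "\<lambda>v. v ! i"] that by (simp add: subword_def)
  have "x i = u i" if "i < m" for i using nth[of i] that by (simp add: subword_def nth_append)
  then have xu: "agree m x u" by (simp add: agree_def)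
  have "u (n + i) = y i" if "i < m" for i
    using nth[of "n + i"] that by (simp add: subword_def nth_append n_def)
  then have uy: "agree m ((shift ^^ n) u) y" by (simp add: agree_def funpow_shift)
  have "agree m u (graft n u y)" by (rule agree_mono[OF agree_graft]) (simp add: n_def)
  then have "agree m x (graft n u y)" by (rule agree_trans[OF xu])
  moreover have "0 < n" using m by (simp add: n_def)
  ultimately show "\<exists>z\<in>X. \<exists>n>0. agree m x z \<and> (shift ^^ n) z = y"
    using graft[OF u(1) y uy] by (intro bexI[of _ "graft n u y"] exI[of _ n]) simp_all
qed

text \<open>Koenig's lemma. Call a prefix bad if no \<open>k\<close> works for the points that begin with it. A bad
  prefix has a bad extension by one letter, since there are finitely many letters. A sequence all of whose prefixes
  are bad lies in \<open>X\<close>, because \<open>X\<close> is of finite type, and contradicts local constancy.\<close>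

lemma locally_constant_imp_uniform:
  fixes X :: "(nat \<Rightarrow> 'a::finite) set"
  assumes ft: "finite_type X" and lc: "locally_constant_on X \<theta>"
  obtains k where "\<And>x y. \<lbrakk>x \<in> X; y \<in> X; agree k x y\<rbrakk> \<Longrightarrow> \<theta> x = \<theta> y"
proof (rule ccontr)
  assume contr: "\<not> thesis"
  obtain N where N: "\<And>x. x \<in> X \<longleftrightarrow> (\<forall>i. admissible X (subword x i N))"
    using ft unfolding finite_type_def by blast
  define bad where "bad n x \<longleftrightarrow> (\<forall>k. \<exists>y\<in>X. \<exists>z\<in>X. agree n x y \<and> agree k y z \<and> \<theta> y \<noteq> \<theta> z)" for n x
  have extend: "\<exists>y. bad (Suc n) y \<and> agree n x y" if bad: "bad n x" for n x
  proof (rule ccontr)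
    assume none: "\<nexists>y. bad (Suc n) y \<and> agree n x y"
    have "agree n x (x(n := a))" for a by (simp add: agree_def)
    then have "\<not> bad (Suc n) (x(n := a))" for a using none by blast
    then have "\<exists>k. \<forall>y\<in>X. \<forall>z\<in>X. agree (Suc n) (x(n := a)) y \<longrightarrow> agree k y z \<longrightarrow> \<theta> y = \<theta> z" for a
      unfolding bad_def by blast
    then obtain k where k: "\<And>a y z. \<lbrakk>y \<in> X; z \<in> X; agree (Suc n) (x(n := a)) y; agree (k a) y z\<rbrakk>
        \<Longrightarrow> \<theta> y = \<theta> z" by metis
    obtain y z where yz: "y \<in> X" "z \<in> X" "agree n x y" "agree (Max (range k)) y z" "\<theta> y \<noteq> \<theta> z"
      using bad unfolding bad_def by blast
    have "agree (Suc n) (x(n := y n)) y" using yz(3) by (auto simp: agree_def less_Suc_eq)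
    moreover have "agree (k (y n)) y z" by (rule agree_mono[OF yz(4)]) simp
    ultimately show False using k yz by blast
  qed
  have "\<exists>f. \<forall>n. bad n (f n) \<and> agree n (f n) (f (Suc n))"
  proof (rule dependent_nat_choice)
    have "\<exists>y\<in>X. \<exists>z\<in>X. agree k y z \<and> \<theta> y \<noteq> \<theta> z" for k using that[of k] contr by blast
    then show "\<exists>x. bad 0 x" unfolding bad_def by (simp add: agree_def)
  qed (use extend in blast)
  then obtain f where f: "\<And>n. bad n (f n)" "\<And>n. agree n (f n) (f (Suc n))" by blast
  have chain: "agree n (f n) (f (n + j))" for n j
  proof (induction j)
    case (Suc j)
    then show ?case using agree_mono[OF f(2)[of "n + j"], of n] agree_trans by fastforce
  qed simp
  define x where "x i = f (Suc i) i" for i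
  have "f (Suc i) i = f n i" if "i < n" for i n
    using chain[of "Suc i" "n - Suc i"] that by (simp add: agree_def)
  then have xf: "agree n x (f n)" for n by (simp add: agree_def x_def)
  then have bad: "bad n x" for n using f(1)[of n] unfolding bad_def by (meson agree_trans)
  have "admissible X (subword x i N)" for i
  proof -
    obtain y where y: "y \<in> X" "agree (i + N) x y" using bad[of "i + N"] unfolding bad_def by blast
    then have "subword x i N = subword y i N"
      unfolding subword_def by (intro map_cong) (auto simp: agree_def)
    then show ?thesis using N y by simp
  qed
  then have x: "x \<in> X" using N by blast
  obtain r where r: "0 < r" "\<And>y. y \<in> X \<Longrightarrow> shift_dist x y < r \<Longrightarrow> \<theta> y = \<theta> x"
    using lc x unfolding locally_constant_on_def by blast
  obtain n where n: "exp (- real n) < r"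
  proof -
    obtain n :: nat where "- ln r < real n" using reals_Archimedean2 by blast
    then have "exp (- real n) < exp (ln r)" by simp
    then show ?thesis using that r(1) by simp
  qed
  obtain y z where yz: "y \<in> X" "z \<in> X" "agree n x y" "agree n y z" "\<theta> y \<noteq> \<theta> z"
    using bad[of n] unfolding bad_def by blast
  then show False
    using r(2)[of y] r(2)[of z] shift_dist_le[of n x y] shift_dist_le[of n x z] n
      agree_trans[of n x y z] by fastforce
qed

context irreducible_sft begin

lemma funpow_shift_mem: "x \<in> X \<Longrightarrow> (shift ^^ n) x \<in> X"
  by (induction n) (simp_all add: shift_mem)

text \<open>Finitely many pairs of words of length \<open>m\<close> occur. An orbit that connects one pair of points can be
  redirected, by gluing, to any other pair with the same prefixes.\<close>

lemma connect_uniform: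
  obtains J where
    "\<And>x y. \<lbrakk>x \<in> X; y \<in> X\<rbrakk> \<Longrightarrow> \<exists>z\<in>X. \<exists>n\<le>J. agree m x z \<and> (shift ^^ n) z = y"
proof -
  define P where "P p n \<longleftrightarrow> (\<exists>z\<in>X. map z [0..<m] = fst p \<and> map ((shift ^^ n) z) [0..<m] = snd p)" for p n
  define W where "W = (\<lambda>(x, y). (map x [0..<m], map y [0..<m])) ` (X \<times> X)"
  have pref: "map x [0..<m] = map y [0..<m] \<longleftrightarrow> agree m x y" for x y :: "nat \<Rightarrow> 'a"
    by (auto simp: agree_def)
  have "W \<subseteq> {w. set w \<subseteq> UNIV \<and> length w = m} \<times> {w. set w \<subseteq> UNIV \<and> length w = m}"
    by (auto simp: W_def)
  then have fin: "finite W"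
    by (rule finite_subset) (intro finite_cartesian_product finite_lists_length_eq finite)
  have "\<forall>p\<in>W. \<exists>n. P p n"
  proof
    fix p assume "p \<in> W"
    then obtain x y where xy: "x \<in> X" "y \<in> X" "p = (map x [0..<m], map y [0..<m])"
      by (auto simp: W_def)
    obtain z n where "z \<in> X" "agree m x z" "(shift ^^ n) z = y" using connect[OF xy(1,2)] by blast
    then show "\<exists>n. P p n" unfolding P_def xy(3) fst_conv snd_conv pref by (blast intro: agree_sym agree_refl)
  qed
  then obtain n where n: "\<And>p. p \<in> W \<Longrightarrow> P p (n p)" by metis
  show ?thesis
  proof (rule that[of "Max (n ` W)"])
    fix x y assume xy: "x \<in> X" "y \<in> X"
    define p where "p = (map x [0..<m], map y [0..<m])"
    have p: "p \<in> W" using xy by (auto simp: W_def p_def)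
    obtain z where z: "z \<in> X" "agree m z x" "agree m ((shift ^^ n p) z) y"
      using n[OF p] unfolding P_def by (auto simp: p_def pref simp del: map_eq_conv)
    have "agree m z (graft (n p) z y)" by (rule agree_mono[OF agree_graft_overlap[OF z(3)]]) simp
    then have "agree m x (graft (n p) z y)" using z(2) agree_sym agree_trans by blast
    moreover have "n p \<le> Max (n ` W)" using fin p by simp
    ultimately show "\<exists>z\<in>X. \<exists>k\<le>Max (n ` W). agree m x z \<and> (shift ^^ k) z = y"
      using graft_mem[OF z(1) xy(2) z(3)] by (intro bexI[of _ "graft (n p) z y"] exI[of _ "n p"]) simp_all
  qed
qed

definition pre :: "(nat \<Rightarrow> 'a) \<Rightarrow> (nat \<Rightarrow> 'a) set" where
  "pre x = {y \<in> X. shift y = x}"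

lemma pre_subset: "pre x \<subseteq> (\<lambda>a. graft 1 (\<lambda>_. a) x) ` UNIV"
proof
  fix y assume "y \<in> pre x"
  then have "y = graft 1 (\<lambda>_. y 0) x" by (auto simp: pre_def graft_def shift_def fun_eq_iff dest!: gr0_implies_Suc)
  then show "y \<in> (\<lambda>a. graft 1 (\<lambda>_. a) x) ` UNIV" by blast
qed

lemma finite_pre: "finite (pre x)"
  using pre_subset by (rule finite_subset) simp

lemma card_pre_le: "card (pre x) \<le> CARD('a)"
  by (rule order_trans[OF card_mono[OF _ pre_subset] card_image_le]) simp_all

lemma pre_nonempty:
  assumes "x \<in> X"
  shows "pre x \<noteq> {}"
proof -
  obtain z n where z: "z \<in> X" "0 < n" "(shift ^^ n) z = x" using connect[OF assms assms] by blast
  then have "shift ((shift ^^ (n - 1)) z) = x" by (cases n) simp_all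
  then show ?thesis using funpow_shift_mem[OF z(1), of "n - 1"] by (auto simp: pre_def)
qed

lemma funpow_shift_surj:
  assumes "x \<in> X"
  shows "\<exists>y\<in>X. (shift ^^ n) y = x"
proof (induction n)
  case (Suc n)
  then obtain y where "y \<in> X" "(shift ^^ n) y = x" by blast
  moreover obtain z where "z \<in> X" "shift z = y" using pre_nonempty[OF \<open>y \<in> X\<close>] by (auto simp: pre_def)
  ultimately show ?case by (intro bexI[of _ z]) (simp_all add: funpow_swap1)
qed (use assms in auto)

lemma graft_pre:
  assumes "y \<in> pre x" "x' \<in> X" "agree m x x'"
  shows "graft 1 y x' \<in> pre x'" "agree (Suc m) y (graft 1 y x')"
    "shift_dist y (graft 1 y x') = exp (- 1) * shift_dist x x'"
proof -
  have y: "y \<in> X" "shift y = x" using assms by (auto simp: pre_def)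
  then have "graft 1 y x' \<in> X" using graft_mem[OF y(1) assms(2), of 1] assms(3) by simp
  then show "graft 1 y x' \<in> pre x'" by (simp add: pre_def del: One_nat_def)
  show "agree (Suc m) y (graft 1 y x')"
    using agree_graft_overlap[of m 1 y x'] y assms(3) by simp
  show "shift_dist y (graft 1 y x') = exp (- 1) * shift_dist x x'"
    using shift_dist_shift[of y "graft 1 y x'"] y by (simp add: graft_def del: One_nat_def)
      (simp add: graft_def shift_def)
qed

lemma bij_betw_graft_pre:
  assumes "x \<in> X" "x' \<in> X" "agree m x x'"
  shows "bij_betw (\<lambda>y. graft 1 y x') (pre x) (pre x')"
proof (rule bij_betw_byWitness[where f' = "\<lambda>y. graft 1 y x"])
  show "\<forall>y\<in>pre x. graft 1 (graft 1 y x') x = y"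
    by (auto simp: pre_def graft_def shift_def fun_eq_iff dest!: gr0_implies_Suc)
  show "\<forall>y\<in>pre x'. graft 1 (graft 1 y x) x' = y"
    by (auto simp: pre_def graft_def shift_def fun_eq_iff dest!: gr0_implies_Suc)
  show "(\<lambda>y. graft 1 y x') ` pre x \<subseteq> pre x'" using graft_pre(1)[OF _ assms(2,3)] by blast
  show "(\<lambda>y. graft 1 y x) ` pre x' \<subseteq> pre x"
    using graft_pre(1)[OF _ assms(1) agree_sym[OF assms(3)]] by blast
qed

end

section \<open>Growth rate and superharmonic functions\<close>

lemma exp_minus_one_le: "exp t - 1 \<le> t * exp t" for t :: real
proof -
  have "exp t * (1 - t) \<le> exp t * exp (- t)"
    using exp_ge_add_one_self[of "- t"] by (intro mult_left_mono) simp_all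
  then show ?thesis by (simp add: algebra_simps flip: exp_add)
qed

lemma abs_diff_le_of_exp_ratio:
  fixes a b t :: real
  assumes "0 \<le> a" "b \<le> exp t * a" "a \<le> exp t * b"
  shows "\<bar>a - b\<bar> \<le> (exp t - 1) * a"
proof -
  have "b - a \<le> (exp t - 1) * a" using assms(2) by (simp add: algebra_simps)
  moreover have "exp (- t) * a \<le> b" using assms(3) by (simp add: exp_minus field_simps)
  moreover have "(1 - exp (- t)) * a \<le> (exp t - 1) * a"
  proof (rule mult_right_mono)
    have "1 + t \<le> exp t" "1 - t \<le> exp (- t)"
      using exp_ge_add_one_self[of t] exp_ge_add_one_self[of "-t"] by simp_all
    then show "1 - exp (- t) \<le> exp t - 1" by linarith
  qed (use assms(1) in simp)
  ultimately show ?thesis by (simp add: abs_le_iff algebra_simps)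
qed

locale weighted_sft = irreducible_sft X m for X :: "(nat \<Rightarrow> 'a::finite) set" and m +
  fixes F :: "(nat \<Rightarrow> 'a) \<Rightarrow> real" and \<alpha> c :: real
  assumes \<alpha>_pos: "0 < \<alpha>"
    and F_pos: "x \<in> X \<Longrightarrow> 0 < F x"
    and ln_F_bound: "x \<in> X \<Longrightarrow> \<bar>ln (F x)\<bar> \<le> c"
    and ln_F_variation: "\<lbrakk>x \<in> X; y \<in> X\<rbrakk> \<Longrightarrow> \<bar>ln (F x) - ln (F y)\<bar> \<le> c * shift_dist x y powr \<alpha>"
begin

text \<open>The distance with respect to which functions in the Hoelder space are Lipschitz.\<close>

definition hdist :: "(nat \<Rightarrow> 'a) \<Rightarrow> (nat \<Rightarrow> 'a) \<Rightarrow> real" where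
  "hdist x y = shift_dist x y powr \<alpha>"

lemma hdist_nonneg [simp]: "0 \<le> hdist x y"
  by (simp add: hdist_def)

lemma exp_powr_\<alpha>: "exp (- real k) powr \<alpha> = exp (- \<alpha> * k)"
  by (simp add: powr_def)

lemma hdist_le: assumes "agree k x y" shows "hdist x y \<le> exp (- \<alpha> * k)"
proof -
  have "hdist x y \<le> exp (- real k) powr \<alpha>"
    unfolding hdist_def
    by (rule powr_mono2) (use \<alpha>_pos shift_dist_le[OF assms] in \<open>simp_all add: shift_dist_def\<close>)
  then show ?thesis by (simp only: exp_powr_\<alpha>)
qed

lemma hdist_le_1: "hdist x y \<le> 1"
  using hdist_le[of 0 x y] by (simp add: agree_def)

lemma hdist_ge: assumes "\<not> agree k x y" shows "exp (- \<alpha> * k) \<le> hdist x y"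
proof -
  have "exp (- real k) powr \<alpha> \<le> hdist x y"
    unfolding hdist_def by (rule powr_mono2) (use \<alpha>_pos shift_dist_ge[OF assms] in simp_all)
  then show ?thesis by (simp only: exp_powr_\<alpha>)
qed

lemma hdist_graft:
  assumes "y \<in> pre x" "x' \<in> X" "agree m x x'"
  shows "hdist y (graft 1 y x') = exp (- \<alpha>) * hdist x x'"
  using exp_powr_\<alpha>[of 1]
  by (simp add: hdist_def graft_pre(3)[OF assms] powr_mult del: One_nat_def) 

lemma c_nonneg: "0 \<le> c"
proof -
  obtain x where "x \<in> X" using nonempty by blast
  from ln_F_bound[OF this] show ?thesis by linarith
qed

lemma F_bounds: assumes "x \<in> X" shows "exp (- c) \<le> F x" "F x \<le> exp c"
proof -
  have "exp (ln (F x)) = F x" using F_pos[OF assms] by simp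
  moreover have "- c \<le> ln (F x)" "ln (F x) \<le> c" using ln_F_bound[OF assms] by linarith+
  ultimately show "exp (- c) \<le> F x" "F x \<le> exp c" by (metis exp_le_cancel_iff)+
qed

lemma F_ratio: assumes "x \<in> X" "y \<in> X" shows "F x \<le> exp (c * hdist x y) * F y"
proof -
  have "ln (F x) \<le> c * hdist x y + ln (F y)"
    using ln_F_variation[OF assms] by (simp add: hdist_def abs_le_iff)
  then have "exp (ln (F x)) \<le> exp (c * hdist x y + ln (F y))" by simp
  then show ?thesis using F_pos assms by (simp add: exp_add)
qed

lemma hdist_commute: "hdist x y = hdist y x"
  using Metric_space.commute[OF Metric_space_shift_dist] by (metis hdist_def iso_tuple_UNIV_I)

lemma exp_hdist_minus_one_le: assumes "0 \<le> t" shows "exp (t * hdist x y) - 1 \<le> t * exp t * hdist x y"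
proof -
  have "t * hdist x y \<le> t" using mult_left_mono[OF hdist_le_1 assms] by simp
  then have "t * hdist x y * exp (t * hdist x y) \<le> t * hdist x y * exp t"
    using assms by (intro mult_left_mono) simp_all
  then show ?thesis using exp_minus_one_le[of "t * hdist x y"] by (simp add: mult_ac)
qed

lemma F_diff:
  assumes "x \<in> X" "y \<in> X"
  shows "\<bar>F x - F y\<bar> \<le> c * exp c * hdist x y * F x"
proof -
  define t where "t = c * hdist x y"
  have F: "0 < F x" by (rule F_pos[OF assms(1)])
  have "F y \<le> exp t * F x" "F x \<le> exp t * F y"
    using F_ratio[OF assms] F_ratio[OF assms(2,1)] hdist_commute[of x y] by (simp_all add: t_def)
  then have "\<bar>F x - F y\<bar> \<le> (exp t - 1) * F x" using F by (intro abs_diff_le_of_exp_ratio) simp_all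
  also have "\<dots> \<le> (c * exp c * hdist x y) * F x"
    using exp_hdist_minus_one_le[OF c_nonneg] F by (intro mult_right_mono) (simp_all add: t_def)
  finally show ?thesis .
qed

definition L :: "((nat \<Rightarrow> 'a) \<Rightarrow> real) \<Rightarrow> (nat \<Rightarrow> 'a) \<Rightarrow> real" where
  "L f x = (\<Sum>y\<in>pre x. F y * f y)"

text \<open>The solution of \<open>(c + \<kappa>) e\<^sup>-\<^sup>\<alpha> = \<kappa>\<close>, which makes the following cone of functions invariant under the
  transfer operator: taking preimages contracts \<open>hdist\<close> by \<open>e\<^sup>-\<^sup>\<alpha>\<close>, and multiplication by \<open>F\<close> adds \<open>c\<close> to the
  logarithmic Lipschitz constant.\<close>

definition \<kappa> :: real where
  "\<kappa> = c * exp (- \<alpha>) / (1 - exp (- \<alpha>))"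

lemma \<kappa>_nonneg: "0 \<le> \<kappa>"
  using c_nonneg \<alpha>_pos by (simp add: \<kappa>_def)

lemma \<kappa>_fixed_point: "(c + \<kappa>) * exp (- \<alpha>) = \<kappa>"
  using \<alpha>_pos by (simp add: \<kappa>_def field_simps)

definition regular :: "((nat \<Rightarrow> 'a) \<Rightarrow> real) \<Rightarrow> bool" where
  "regular f \<longleftrightarrow> (\<forall>x\<in>X. 0 \<le> f x) \<and>
     (\<forall>x\<in>X. \<forall>y\<in>X. agree m x y \<longrightarrow> f x \<le> exp (\<kappa> * hdist x y) * f y)"

lemma pre_mem: "y \<in> pre x \<Longrightarrow> y \<in> X"
  by (simp add: pre_def)

lemma F_pre_pos: "y \<in> pre x \<Longrightarrow> 0 < F y"
  using F_pos pre_mem by blast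

lemma regular_one: "regular (\<lambda>_. 1)"
  using \<kappa>_nonneg by (simp add: regular_def)

lemma regular_L:
  assumes f: "regular f"
  shows "regular (L f)"
  unfolding regular_def
proof (intro conjI ballI impI)
  fix x assume x: "x \<in> X"
  show "0 \<le> L f x"
    unfolding L_def using f F_pre_pos pre_mem
    by (intro sum_nonneg mult_nonneg_nonneg) (auto simp: regular_def less_imp_le)
  fix x' assume x': "x' \<in> X" and ag: "agree m x x'"
  have "L f x \<le> (\<Sum>y\<in>pre x. exp (\<kappa> * hdist x x') * (F (graft 1 y x') * f (graft 1 y x')))"
    unfolding L_def
  proof (rule sum_mono)
    fix y assume y: "y \<in> pre x"
    define y' where "y' = graft 1 y x'"
    have y': "y' \<in> X" "agree m y y'" "hdist y y' = exp (- \<alpha>) * hdist x x'"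
      using graft_pre(1,2)[OF y x' ag] hdist_graft[OF y x' ag] pre_mem agree_mono[of "Suc m" y y' m]
      by (auto simp: y'_def)
    have yX: "y \<in> X" using y by (rule pre_mem)
    have fy: "f y \<le> exp (\<kappa> * hdist y y') * f y'" "0 \<le> f y"
      using f yX y'(1,2) unfolding regular_def by blast+
    have "F y * f y \<le> (exp (c * hdist y y') * F y') * (exp (\<kappa> * hdist y y') * f y')"
      by (rule mult_mono[OF F_ratio[OF yX y'(1)] fy(1) _ fy(2)]) (use F_pos[OF y'(1)] in simp)
    also have "\<dots> = exp ((c + \<kappa>) * exp (- \<alpha>) * hdist x x') * (F y' * f y')"
    proof -
      have "exp ((c + \<kappa>) * exp (- \<alpha>) * hdist x x') = exp (c * hdist y y') * exp (\<kappa> * hdist y y')"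
        unfolding y'(3) exp_add[symmetric] by (simp add: algebra_simps)
      then show ?thesis by simp
    qed
    also have "\<dots> = exp (\<kappa> * hdist x x') * (F y' * f y')" by (simp only: \<kappa>_fixed_point)
    finally show "F y * f y \<le> exp (\<kappa> * hdist x x') * (F (graft 1 y x') * f (graft 1 y x'))"
      unfolding y'_def .
  qed
  also have "\<dots> = exp (\<kappa> * hdist x x') * L f x'"
    unfolding L_def sum_distrib_left
    using sum.reindex_bij_betw[OF bij_betw_graft_pre[OF x x' ag],
        of "\<lambda>y. exp (\<kappa> * hdist x x') * (F y * f y)"] by simp
  finally show "L f x \<le> exp (\<kappa> * hdist x x') * L f x'" .
qed

lemma L_mono: "(\<And>y. y \<in> X \<Longrightarrow> f y \<le> g y) \<Longrightarrow> L f x \<le> L g x"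
  unfolding L_def using F_pre_pos pre_mem by (intro sum_mono mult_left_mono) (auto simp: less_imp_le)

lemma L_scale: "L (\<lambda>y. k * f y) x = k * L f x"
  unfolding L_def by (simp add: sum_distrib_left mult_ac)

text \<open>The lower bound \<open>1\<close> is a normalisation that makes norms of functions comparable with and without the weight \<open>1 / h\<close>.\<close>

definition superharmonic :: "real \<Rightarrow> ((nat \<Rightarrow> 'a) \<Rightarrow> real) \<Rightarrow> bool" where
  "superharmonic r h \<longleftrightarrow> regular h \<and> (\<forall>x\<in>X. 1 \<le> h x \<and> L h x \<le> r * h x)"

lemma superharmonicD:
  assumes "superharmonic r h" "x \<in> X"
  shows "1 \<le> h x" "L h x \<le> r * h x" "0 < h x"
    "\<lbrakk>y \<in> X; agree m x y\<rbrakk> \<Longrightarrow> h x \<le> exp (\<kappa> * hdist x y) * h y"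
  using assms unfolding superharmonic_def regular_def by fastforce+

text \<open>A Harnack inequality. From \<open>F z h z \<le> L h (\<sigma> z) \<le> r h (\<sigma> z)\<close>, the function \<open>h\<close> drops at most by the factor
  \<open>e\<^sup>-\<^sup>c / r\<close> in one step along an orbit. Every point is reached within \<open>J\<close> steps from the cylinder of any other point,
  and within a cylinder \<open>h\<close> varies by at most \<open>e\<^sup>\<kappa>\<close>. That \<open>D\<close> depends only on \<open>R\<close> makes the
  estimates below uniform as \<open>r\<close> approaches the growth rate.\<close>

lemma superharmonic_bounded_ratio:
  assumes "0 < R"
  obtains D where "1 \<le> D"
    "\<And>r h x y. \<lbrakk>0 < r; r \<le> R; superharmonic r h; x \<in> X; y \<in> X\<rbrakk> \<Longrightarrow> h x \<le> D * h y"
proof -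
  obtain J where J: "\<And>x y. \<lbrakk>x \<in> X; y \<in> X\<rbrakk> \<Longrightarrow> \<exists>z\<in>X. \<exists>n\<le>J. agree m x z \<and> (shift ^^ n) z = y"
    using connect_uniform by blast
  define q where "q = min 1 (exp (- c) / R)"
  have q: "0 < q" "q \<le> 1" using assms by (simp_all add: q_def)
  have qJ: "0 < q ^ J" "q ^ J \<le> 1" using q by (simp_all add: power_le_one)
  show ?thesis
  proof (rule that[of "exp \<kappa> / q ^ J"])
    have "1 \<le> exp \<kappa>" using \<kappa>_nonneg by simp
    then have "q ^ J \<le> exp \<kappa>" using qJ(2) by linarith
    then show "1 \<le> exp \<kappa> / q ^ J" using qJ by (simp add: le_divide_eq)
    fix r h x y assume r: "0 < r" "r \<le> R" and h: "superharmonic r h" and xy: "x \<in> X" "y \<in> X"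
    have step: "q * h z \<le> h (shift z)" if z: "z \<in> X" for z
    proof -
      have hz: "0 < h z" by (rule superharmonicD(3)[OF h z])
      have "exp (- c) * h z \<le> F z * h z" using F_bounds(1)[OF z] hz by (intro mult_right_mono) simp_all
      also have "\<dots> \<le> L h (shift z)"
        unfolding L_def
        by (rule member_le_sum[of z "pre (shift z)" "\<lambda>y. F y * h y"])
          (use z superharmonicD(3)[OF h] F_pos finite_pre in \<open>auto simp: pre_def intro: less_imp_le\<close>)
      also have "\<dots> \<le> r * h (shift z)" by (rule superharmonicD(2)[OF h shift_mem[OF z]])
      also have "\<dots> \<le> R * h (shift z)"
        using r superharmonicD(3)[OF h shift_mem[OF z]] by (intro mult_right_mono) simp_all
      finally have "exp (- c) / R * h z \<le> h (shift z)" using assms by (simp add: field_simps)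
      moreover have "q * h z \<le> exp (- c) / R * h z" using hz by (intro mult_right_mono) (simp_all add: q_def)
      ultimately show ?thesis by linarith
    qed
    have steps: "q ^ n * h z \<le> h ((shift ^^ n) z)" if "z \<in> X" for z n
    proof (induction n)
      case (Suc n)
      have "q * (q ^ n * h z) \<le> q * h ((shift ^^ n) z)" using Suc q by (intro mult_left_mono) simp_all
      also have "\<dots> \<le> h (shift ((shift ^^ n) z))" by (rule step[OF funpow_shift_mem[OF that]])
      finally show ?case by simp
    qed simp
    obtain z n where z: "z \<in> X" "n \<le> J" "agree m x z" "(shift ^^ n) z = y" using J[OF xy] by blast
    have "h x \<le> exp (\<kappa> * hdist x z) * h z" by (rule superharmonicD(4)[OF h xy(1) z(1,3)])
    also have "\<dots> \<le> exp \<kappa> * h z"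
      using mult_left_mono[OF hdist_le_1 \<kappa>_nonneg, of x z] superharmonicD(3)[OF h z(1)]
      by (intro mult_right_mono) simp_all
    also have "\<dots> \<le> exp \<kappa> * (h y / q ^ J)"
    proof (rule mult_left_mono)
      have "q ^ J * h z \<le> q ^ n * h z"
        using z(2) q superharmonicD(3)[OF h z(1)] by (intro mult_right_mono power_decreasing) simp_all
      also have "\<dots> \<le> h y" using steps[OF z(1), of n] z(4) by simp
      finally show "h z \<le> h y / q ^ J" using qJ by (simp add: field_simps)
    qed simp
    finally show "h x \<le> exp \<kappa> / q ^ J * h y" by simp
  qed
qed

definition iter :: "nat \<Rightarrow> (nat \<Rightarrow> 'a) \<Rightarrow> real" where
  "iter n = (L ^^ n) (\<lambda>_. 1)"

lemma iter_0: "iter 0 x = 1" and iter_Suc: "iter (Suc n) = L (iter n)"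
  by (simp_all add: iter_def)

lemma regular_iter: "regular (iter n)"
  by (induction n) (simp_all add: iter_def regular_one regular_L)

lemma iter_nonneg: "x \<in> X \<Longrightarrow> 0 \<le> iter n x"
  using regular_iter unfolding regular_def by blast

text \<open>An upper bound for \<open>L 1\<close>: every point has at most as many preimages as there are letters.\<close>

definition mass_bound :: real where "mass_bound = CARD('a) * exp c"

lemma mass_bound_pos: "0 < mass_bound"
  by (simp add: mass_bound_def card_gt_0_iff)

lemma L_const_le: assumes "0 \<le> k" shows "L (\<lambda>_. k) x \<le> mass_bound * k"
proof -
  have "L (\<lambda>_. k) x \<le> (\<Sum>y\<in>pre x. exp c * k)"
    unfolding L_def using F_bounds(2) pre_mem assms by (intro sum_mono mult_right_mono) auto
  also have "\<dots> = card (pre x) * (exp c * k)" by simp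
  also have "\<dots> \<le> CARD('a) * (exp c * k)"
    using card_pre_le assms by (intro mult_right_mono) simp_all
  finally show ?thesis by (simp add: mass_bound_def)
qed

lemma iter_le: "x \<in> X \<Longrightarrow> iter n x \<le> mass_bound ^ n"
proof (induction n arbitrary: x)
  case (Suc n)
  have "iter (Suc n) x \<le> L (\<lambda>_. mass_bound ^ n) x" unfolding iter_Suc by (rule L_mono) (rule Suc.IH)
  also have "\<dots> \<le> mass_bound * mass_bound ^ n" by (rule L_const_le) (use mass_bound_pos in simp)
  finally show ?case by simp
qed (simp add: iter_0)

lemma iter_ge: "x \<in> X \<Longrightarrow> exp (- c) ^ n \<le> iter n x"
proof (induction n arbitrary: x)
  case (Suc n)
  obtain y where y: "y \<in> pre x" using pre_nonempty[OF Suc.prems] by blast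
  have "exp (- c) * exp (- c) ^ n \<le> F y * iter n y"
    using F_bounds(1)[OF pre_mem[OF y]] Suc.IH[OF pre_mem[OF y]] F_pre_pos[OF y]
    by (intro mult_mono) simp_all
  also have "\<dots> \<le> iter (Suc n) x"
    unfolding iter_Suc L_def
    by (rule member_le_sum[OF y, of "\<lambda>y. F y * iter n y"])
      (auto simp: finite_pre intro!: mult_nonneg_nonneg less_imp_le[OF F_pre_pos] iter_nonneg[OF pre_mem])
  finally show ?case by simp
qed (simp add: iter_0)

definition green_finite :: "real \<Rightarrow> bool" where
  "green_finite r \<longleftrightarrow> 0 < r \<and> (\<exists>B. \<forall>N. \<forall>x\<in>X. (\<Sum>n<N. iter n x / r ^ n) \<le> B)"

text \<open>The exponential growth rate of \<open>L\<^sup>n 1\<close>, defined as the critical parameter of the Green series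
  \<open>\<Sum>n. r\<^sup>-\<^sup>n L\<^sup>n 1\<close>.\<close>

definition growth :: real where
  "growth = Inf {r. green_finite r}"

definition green :: "real \<Rightarrow> (nat \<Rightarrow> 'a) \<Rightarrow> real" where
  "green r x = (\<Sum>n. iter n x / r ^ n)"

lemma geometric_partial_sum:
  fixes q :: real
  assumes "0 \<le> q" "q < 1"
  shows "(\<Sum>n<N. q ^ n) \<le> 1 / (1 - q)"
proof -
  have "(\<Sum>n<N. q ^ n) = (1 - q ^ N) / (1 - q)" using assms by (simp add: sum_gp_strict)
  also have "\<dots> \<le> 1 / (1 - q)" using assms by (intro divide_right_mono) simp_all
  finally show ?thesis .
qed

lemma green_finite_geometric:
  assumes "0 \<le> q" "q < r" and B: "0 \<le> B" "\<And>n x. x \<in> X \<Longrightarrow> iter n x \<le> B * q ^ n"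
  shows "green_finite r"
  unfolding green_finite_def
proof (intro conjI exI[of _ "B * (1 / (1 - q / r))"] allI ballI)
  show r: "0 < r" using assms by linarith
  fix N x assume x: "x \<in> X"
  have "(\<Sum>n<N. iter n x / r ^ n) \<le> (\<Sum>n<N. B * (q / r) ^ n)"
    using B(2)[OF x] r by (intro sum_mono) (simp add: power_divide divide_right_mono)
  also have "\<dots> = B * (\<Sum>n<N. (q / r) ^ n)" by (simp add: sum_distrib_left)
  also have "\<dots> \<le> B * (1 / (1 - q / r))"
    using assms r by (intro mult_left_mono geometric_partial_sum) simp_all
  finally show "(\<Sum>n<N. iter n x / r ^ n) \<le> B * (1 / (1 - q / r))" .
qed

lemma green_finite_ex: "\<exists>r. green_finite r"
  using green_finite_geometric[of mass_bound "2 * mass_bound" 1] mass_bound_pos iter_le by fastforce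

lemma green_finite_gt: assumes "green_finite r" shows "exp (- c) < r"
proof (rule ccontr)
  assume "\<not> exp (- c) < r"
  then have le: "r \<le> exp (- c)" by simp
  obtain B where r: "0 < r" and B: "\<And>N x. x \<in> X \<Longrightarrow> (\<Sum>n<N. iter n x / r ^ n) \<le> B"
    using assms unfolding green_finite_def by blast
  obtain x where x: "x \<in> X" using nonempty by blast
  have "1 \<le> iter n x / r ^ n" for n
  proof -
    have "r ^ n \<le> exp (- c) ^ n" using le r by (intro power_mono) simp_all
    also have "\<dots> \<le> iter n x" by (rule iter_ge[OF x])
    finally show ?thesis using r by (simp add: le_divide_eq)
  qed
  then have "(\<Sum>n<N. 1) \<le> (\<Sum>n<N. iter n x / r ^ n)" for N by (intro sum_mono)
  then have "real N \<le> (\<Sum>n<N. iter n x / r ^ n)" for N by simp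
  then have "real N \<le> B" for N using B[OF x, of N] by (rule order_trans)
  then show False using reals_Archimedean2[of B] by (meson not_le)
qed

lemma bdd_below_green_finite: "bdd_below {r. green_finite r}"
  using green_finite_gt by (intro bdd_belowI[of _ "exp (- c)"]) (auto intro: less_imp_le)

lemma growth_pos: "0 < growth"
proof -
  have "exp (- c) \<le> growth"
    unfolding growth_def using green_finite_ex green_finite_gt by (intro cInf_greatest) (auto intro: less_imp_le)
  then show ?thesis using exp_gt_zero[of "- c"] by linarith
qed

lemma green_finite_mono:
  assumes "green_finite r" "r \<le> r'"
  shows "green_finite r'"
proof -
  obtain B where r: "0 < r" and B: "\<And>N x. x \<in> X \<Longrightarrow> (\<Sum>n<N. iter n x / r ^ n) \<le> B"
    using assms unfolding green_finite_def by blast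
  have "(\<Sum>n<N. iter n x / r' ^ n) \<le> B" if x: "x \<in> X" for N x
  proof -
    have "(\<Sum>n<N. iter n x / r' ^ n) \<le> (\<Sum>n<N. iter n x / r ^ n)"
      using r assms(2) iter_nonneg[OF x] by (intro sum_mono divide_left_mono power_mono) simp_all
    then show ?thesis using B[OF x, of N] by linarith
  qed
  then show ?thesis using r assms(2) unfolding green_finite_def by (meson less_le_trans)
qed

lemma green_finite_above_growth: assumes "growth < r" shows "green_finite r"
proof -
  obtain r' where "green_finite r'" "r' < r"
    using cInf_lessD[of "{r. green_finite r}" r] green_finite_ex assms unfolding growth_def by blast
  then show ?thesis using green_finite_mono by simp
qed

context
  fixes r assumes r: "green_finite r"
begin

lemma green_summable: assumes "x \<in> X" shows "summable (\<lambda>n. iter n x / r ^ n)"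
proof -
  obtain B where "0 < r" and B: "\<And>N. (\<Sum>n<N. iter n x / r ^ n) \<le> B"
    using r assms unfolding green_finite_def by blast
  then show ?thesis
    using iter_nonneg[OF assms] by (intro summableI_nonneg_bounded[of _ B]) simp_all
qed

lemma partial_le_green: assumes "x \<in> X" shows "(\<Sum>n<N. iter n x / r ^ n) \<le> green r x"
  unfolding green_def
  using iter_nonneg[OF assms] r by (intro sum_le_suminf green_summable assms) (auto simp: green_finite_def)

lemma green_ge_1: "x \<in> X \<Longrightarrow> 1 \<le> green r x"
  using partial_le_green[of x 1] by (simp add: iter_0)

lemma green_bounded: "\<exists>B. \<forall>x\<in>X. green r x \<le> B"
proof -
  obtain B where B: "\<And>N x. x \<in> X \<Longrightarrow> (\<Sum>n<N. iter n x / r ^ n) \<le> B"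
    using r unfolding green_finite_def by blast
  have "green r x \<le> B" if "x \<in> X" for x
    unfolding green_def by (rule suminf_le_const[OF green_summable[OF that] B[OF that]])
  then show ?thesis by blast
qed

lemma L_green: assumes "x \<in> X" shows "L (green r) x = r * (green r x - 1)"
proof -
  have r0: "0 < r" using r by (simp add: green_finite_def)
  have "(\<lambda>n. \<Sum>y\<in>pre x. F y * (iter n y / r ^ n)) sums (\<Sum>y\<in>pre x. F y * green r y)"
    unfolding green_def by (intro sums_sum sums_mult summable_sums green_summable pre_mem)
  moreover have "(\<Sum>y\<in>pre x. F y * (iter n y / r ^ n)) = r * (iter (Suc n) x / r ^ Suc n)" for n
    using r0 by (simp add: iter_Suc L_def sum_distrib_left sum_divide_distrib)
  ultimately have "(\<lambda>n. r * (iter (Suc n) x / r ^ Suc n)) sums L (green r) x" by (simp add: L_def)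
  moreover have "(\<lambda>n. iter (Suc n) x / r ^ Suc n) sums (green r x - 1)"
  proof (rule sums_Suc_iff[where f = "\<lambda>n. iter n x / r ^ n", THEN iffD2])
    show "(\<lambda>n. iter n x / r ^ n) sums (green r x - 1 + iter 0 x / r ^ 0)"
      using summable_sums[OF green_summable[OF assms]] by (simp add: green_def[symmetric] iter_0)
  qed
  then have "(\<lambda>n. r * (iter (Suc n) x / r ^ Suc n)) sums (r * (green r x - 1))" by (rule sums_mult)
  ultimately show ?thesis by (rule sums_unique2)
qed

lemma superharmonic_green: "superharmonic r (green r)"
  unfolding superharmonic_def regular_def
proof (intro conjI ballI impI)
  fix x assume x: "x \<in> X"
  show "1 \<le> green r x" by (rule green_ge_1[OF x])
  then show "0 \<le> green r x" by linarith
  have r0: "0 < r" using r by (simp add: green_finite_def)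
  then show "L (green r) x \<le> r * green r x" by (simp add: L_green[OF x])
  fix y assume y: "y \<in> X" "agree m x y"
  have "green r x \<le> (\<Sum>n. exp (\<kappa> * hdist x y) * (iter n y / r ^ n))"
    unfolding green_def
  proof (rule suminf_le)
    show "iter n x / r ^ n \<le> exp (\<kappa> * hdist x y) * (iter n y / r ^ n)" for n
      using regular_iter[of n] x y r0 unfolding regular_def by (simp add: divide_right_mono)
    show "summable (\<lambda>n. iter n x / r ^ n)" by (rule green_summable[OF x])
    show "summable (\<lambda>n. exp (\<kappa> * hdist x y) * (iter n y / r ^ n))"
      by (rule summable_mult[OF green_summable[OF y(1)]])
  qed
  also have "\<dots> = exp (\<kappa> * hdist x y) * green r y"
    unfolding green_def by (rule suminf_mult[OF green_summable[OF y(1)]])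
  finally show "green r x \<le> exp (\<kappa> * hdist x y) * green r y" .
qed

end

text \<open>If the Green function were bounded by \<open>B\<close> at the critical parameter, the identity \<open>L h = r (h - 1)\<close> would give
  \<open>L h \<le> r (1 - 1 / (B + 1)) h\<close>, and iterating this shows that \<open>L\<^sup>n 1\<close> grows at a strictly smaller rate.\<close>

lemma not_green_finite_growth: "\<not> green_finite growth"
proof
  assume adm: "green_finite growth"
  obtain B where B: "\<And>x. x \<in> X \<Longrightarrow> green growth x \<le> B" using green_bounded[OF adm] by blast
  obtain x0 where "x0 \<in> X" using nonempty by blast
  then have B1: "1 \<le> B" using green_ge_1[OF adm] B order_trans by blast
  define r where "r = growth * (1 - 1 / (B + 1))"
  have r: "0 < r" "r < growth" using B1 growth_pos by (simp_all add: r_def field_simps)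
  have Lh: "L (green growth) x \<le> r * green growth x" if x: "x \<in> X" for x
  proof -
    have "green growth x / (B + 1) \<le> 1" using B[OF x] B1 by simp
    then have "green growth x - 1 \<le> (1 - 1 / (B + 1)) * green growth x" by (simp add: algebra_simps)
    then have "growth * (green growth x - 1) \<le> growth * ((1 - 1 / (B + 1)) * green growth x)"
      using growth_pos by (intro mult_left_mono) simp_all
    then show ?thesis by (simp add: L_green[OF adm x] r_def mult.assoc)
  qed
  have iter_le_green: "iter n x \<le> r ^ n * green growth x" if "x \<in> X" for n x
    using that
  proof (induction n arbitrary: x)
    case 0
    then show ?case using green_ge_1[OF adm] by (simp add: iter_0)
  next
    case (Suc n)
    have "iter (Suc n) x \<le> L (\<lambda>y. r ^ n * green growth y) x" unfolding iter_Suc by (rule L_mono) (rule Suc.IH)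
    also have "\<dots> = r ^ n * L (green growth) x" by (rule L_scale)
    also have "\<dots> \<le> r ^ n * (r * green growth x)" using r by (intro mult_left_mono Lh Suc.prems) simp
    finally show ?case by (simp add: mult_ac)
  qed
  have "iter n x \<le> B * r ^ n" if x: "x \<in> X" for n x
  proof -
    have "r ^ n * green growth x \<le> r ^ n * B" using r by (intro mult_left_mono B x) simp
    then show ?thesis using iter_le_green[OF x, of n] by (simp add: mult_ac)
  qed
  then have "green_finite ((r + growth) / 2)" using r B1 by (intro green_finite_geometric[of r _ B]) simp_all
  then have "growth \<le> (r + growth) / 2" unfolding growth_def[symmetric]
    by (subst growth_def) (intro cInf_lower bdd_below_green_finite, simp)
  then show False using r by simp
qed

lemma green_unbounded_near_growth:
  "\<forall>\<^sub>F r in at_right growth. \<exists>x\<in>X. B < green r x"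
proof -
  obtain N x where x: "x \<in> X" "B < (\<Sum>n<N. iter n x / growth ^ n)"
    using not_green_finite_growth growth_pos unfolding green_finite_def by (meson not_le)
  have "((\<lambda>r. \<Sum>n<N. iter n x / r ^ n) \<longlongrightarrow> (\<Sum>n<N. iter n x / growth ^ n)) (at_right growth)"
    using growth_pos by (intro tendsto_intros) simp_all
  then have "\<forall>\<^sub>F r in at_right growth. B < (\<Sum>n<N. iter n x / r ^ n)"
    by (rule order_tendstoD(1)) (rule x(2))
  moreover have "\<forall>\<^sub>F r in at_right growth. growth < r" by (rule eventually_at_right_less)
  ultimately show ?thesis
  proof eventually_elim
    case (elim r)
    then have "B < green r x" using partial_le_green[OF green_finite_above_growth x(1), of r N] by linarith
    then show ?case using x(1) by blast
  qed
qed

end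

section \<open>Twisted transfer operators\<close>

context weighted_sft begin

text \<open>\<open>twist_const\<close> is the constant of the Lasota--Yorke inequality for a single step, and \<open>holder_const\<close> the resulting bound for the
  Hoelder constant of a normalised approximate eigenvector.\<close>

definition twist_const :: real where "twist_const = c * exp c * exp \<kappa>"

lemma twist_const_nonneg: "0 \<le> twist_const"
  using c_nonneg by (simp add: twist_const_def)

definition holder_const :: real where "holder_const = 2 * (twist_const + 1) / (1 - exp (- \<alpha> / 2))"

lemma regular_diff:
  assumes f: "regular f" and xy: "x \<in> X" "y \<in> X" "agree m x y"
  shows "\<bar>f x - f y\<bar> \<le> \<kappa> * exp \<kappa> * hdist x y * f x"
proof -
  define t where "t = \<kappa> * hdist x y"
  have fx: "0 \<le> f x" using f xy(1) by (simp add: regular_def)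
  have "f x \<le> exp t * f y" using f xy by (simp add: regular_def t_def)
  moreover have "f y \<le> exp t * f x"
    using f xy agree_sym[OF xy(3)] unfolding t_def hdist_commute[of x y] by (simp add: regular_def)
  ultimately have "\<bar>f x - f y\<bar> \<le> (exp t - 1) * f x" using fx by (intro abs_diff_le_of_exp_ratio)
  also have "\<dots> \<le> (\<kappa> * exp \<kappa> * hdist x y) * f x"
    using exp_hdist_minus_one_le[OF \<kappa>_nonneg] fx by (intro mult_right_mono) (simp_all add: t_def)
  finally show ?thesis .
qed

end

text \<open>The operator \<open>\<L>\<close> is the case in which every \<open>U y\<close> is the identity of the complex numbers, and
  \<open>\<L>\<^sub>\<lambda>\<close> is the case \<open>U y = \<lambda>(\<theta>(y))\<^sup>-\<^sup>1\<close> on \<open>\<ell>\<^sup>2(Y)\<close>.\<close>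

locale twisted_transfer = weighted_sft X m F \<alpha> c
  for X :: "(nat \<Rightarrow> 'a::finite) set" and m F \<alpha> c +
  fixes E :: "'e::{complex_normed_vector,banach} set" and U :: "(nat \<Rightarrow> 'a) \<Rightarrow> 'e \<Rightarrow> 'e"
  assumes E_zero: "0 \<in> E" and E_add: "\<lbrakk>u \<in> E; v \<in> E\<rbrakk> \<Longrightarrow> u + v \<in> E"
    and E_scale: "v \<in> E \<Longrightarrow> b *\<^sub>C v \<in> E"
    and E_closed: "\<lbrakk>\<And>n::nat. p n \<in> E; p \<longlonglongrightarrow> v\<rbrakk> \<Longrightarrow> v \<in> E"
    and U_mem: "\<lbrakk>y \<in> X; v \<in> E\<rbrakk> \<Longrightarrow> U y v \<in> E"
    and U_add: "y \<in> X \<Longrightarrow> U y (u + v) = U y u + U y v"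
    and U_scale: "y \<in> X \<Longrightarrow> U y (b *\<^sub>C v) = b *\<^sub>C U y v"
    and U_norm: "y \<in> X \<Longrightarrow> norm (U y v) \<le> norm v"
    and U_agree: "\<lbrakk>y \<in> X; y' \<in> X; agree m y y'\<rbrakk> \<Longrightarrow> U y = U y'"
begin

abbreviation "H \<equiv> holder_space \<alpha> X E"
abbreviation "N \<equiv> holder_real_norm \<alpha> X"

sublocale function_space H N
  by (rule function_space_holder) (fact E_zero E_add E_scale E_closed)+

definition T :: "((nat \<Rightarrow> 'a) \<Rightarrow> 'e) \<Rightarrow> (nat \<Rightarrow> 'a) \<Rightarrow> 'e" where
  "T \<Phi> x = (if x \<in> X then \<Sum>y\<in>pre x. F y *\<^sub>R U y (\<Phi> y) else 0)"

lemma U_diff: assumes "y \<in> X" shows "U y (u - v) = U y u - U y v"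
  using U_add[OF assms, of "u - v" v] by simp

lemma E_scaleR: "v \<in> E \<Longrightarrow> r *\<^sub>R v \<in> E"
  using E_scale[of v "of_real r"] by (simp add: scaleC_of_real)

lemma E_sum: "(\<And>i. i \<in> I \<Longrightarrow> v i \<in> E) \<Longrightarrow> (\<Sum>i\<in>I. v i) \<in> E"
  by (induction I rule: infinite_finite_induct) (simp_all add: E_zero E_add)

lemma holder_mem: "\<Phi> \<in> H \<Longrightarrow> x \<in> X \<Longrightarrow> \<Phi> x \<in> E" "\<Phi> \<in> H \<Longrightarrow> x \<notin> X \<Longrightarrow> \<Phi> x = 0"
  by (simp_all add: holder_space_def)

lemma holder_variation:
  "\<lbrakk>\<Phi> \<in> H; x \<in> X; y \<in> X\<rbrakk> \<Longrightarrow> norm (\<Phi> x - \<Phi> y) \<le> N \<Phi> * hdist x y"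
  unfolding hdist_def using holder_variation_bound by (auto simp: holder_space_def)

text \<open>Points that differ within the first \<open>m\<close> letters have distance bounded below, so for them the sup norm suffices.\<close>

lemma locally_holder_mem:
  assumes mem: "\<And>x. x \<in> X \<Longrightarrow> \<Phi> x \<in> E" "\<And>x. x \<notin> X \<Longrightarrow> \<Phi> x = 0"
    and A: "\<And>x. x \<in> X \<Longrightarrow> norm (\<Phi> x) \<le> A" "0 \<le> A"
    and B: "\<And>x y. \<lbrakk>x \<in> X; y \<in> X; agree m x y\<rbrakk> \<Longrightarrow> norm (\<Phi> x - \<Phi> y) \<le> B * hdist x y" "0 \<le> B"
  shows "\<Phi> \<in> H" "N \<Phi> \<le> A + (B + 2 * A * exp (\<alpha> * m))"
proof -
  have "norm (\<Phi> x - \<Phi> y) \<le> (B + 2 * A * exp (\<alpha> * m)) * hdist x y" if xy: "x \<in> X" "y \<in> X" for x y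
  proof (cases "agree m x y")
    case True
    have "B * hdist x y \<le> (B + 2 * A * exp (\<alpha> * m)) * hdist x y"
      using A(2) by (intro mult_right_mono) simp_all
    then show ?thesis using B(1)[OF xy True] by linarith
  next
    case False
    have "norm (\<Phi> x - \<Phi> y) \<le> 2 * A"
      using norm_triangle_ineq4[of "\<Phi> x" "\<Phi> y"] A(1) xy by (smt (verit))
    also have "\<dots> = 2 * A * exp (\<alpha> * m) * exp (- \<alpha> * m)" by (simp flip: exp_add)
    also have "\<dots> \<le> 2 * A * exp (\<alpha> * m) * hdist x y"
      using hdist_ge[OF False] A(2) by (intro mult_left_mono) simp_all
    also have "\<dots> \<le> (B + 2 * A * exp (\<alpha> * m)) * hdist x y"
      using B(2) by (intro mult_right_mono) simp_all
    finally show ?thesis .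
  qed
  note * = this[unfolded hdist_def]
  have nn: "0 \<le> B + 2 * A * exp (\<alpha> * m)" using A(2) B(2) by simp
  show "\<Phi> \<in> H" by (rule holder_spaceI(1)[OF mem A(1) * A(2) nn])
  show "N \<Phi> \<le> A + (B + 2 * A * exp (\<alpha> * m))" by (rule holder_spaceI(2)[OF mem A(1) * A(2) nn])
qed

lemma T_mem_E: "(\<And>y. y \<in> X \<Longrightarrow> \<Phi> y \<in> E) \<Longrightarrow> T \<Phi> x \<in> E"
  by (simp add: T_def E_zero E_sum E_scaleR U_mem pre_mem)

lemma norm_T_le:
  assumes "\<And>y. y \<in> X \<Longrightarrow> norm (\<Phi> y) \<le> s * h y" "x \<in> X"
  shows "norm (T \<Phi> x) \<le> s * L h x"
proof -
  have "norm (T \<Phi> x) \<le> (\<Sum>y\<in>pre x. norm (F y *\<^sub>R U y (\<Phi> y)))"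
    using assms(2) by (simp add: T_def norm_sum del: norm_scaleR)
  also have "\<dots> \<le> (\<Sum>y\<in>pre x. F y * (s * h y))"
  proof (rule sum_mono)
    fix y assume y: "y \<in> pre x"
    have "norm (U y (\<Phi> y)) \<le> s * h y"
      using U_norm[OF pre_mem[OF y], of "\<Phi> y"] assms(1)[OF pre_mem[OF y]] by linarith
    then show "norm (F y *\<^sub>R U y (\<Phi> y)) \<le> F y * (s * h y)"
      using F_pre_pos[OF y] by (simp add: mult_left_mono)
  qed
  finally show ?thesis by (simp add: L_def sum_distrib_left mult_ac)
qed

text \<open>Lasota--Yorke inequality. Measuring sizes and variations relative to \<open>h\<close> gives the contraction factor \<open>e\<^sup>-\<^sup>\<alpha>\<close> after a
  single application of \<open>T\<close>, because the weights \<open>F y h y / (r h x)\<close> have total mass at most \<open>1\<close>.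
  Nearby preimages carry the same contraction \<open>U y\<close>, so the twist contributes no variation.\<close>

lemma T_variation:
  assumes h: "superharmonic r h" and nn: "0 \<le> s" "0 \<le> B"
    and s: "\<And>y. y \<in> X \<Longrightarrow> norm (\<Phi> y) \<le> s * h y"
    and B: "\<And>y y'. \<lbrakk>y \<in> X; y' \<in> X; agree m y y'\<rbrakk> \<Longrightarrow> norm (\<Phi> y - \<Phi> y') \<le> B * h y * hdist y y'"
    and x: "x \<in> X" "x' \<in> X" "agree m x x'"
  shows "norm (T \<Phi> x - T \<Phi> x') \<le> r * h x * exp (- \<alpha>) * (B + twist_const * s) * hdist x x'"
proof -
  define g where "g y = graft 1 y x'" for y
  have "T \<Phi> x' = (\<Sum>y\<in>pre x. F (g y) *\<^sub>R U (g y) (\<Phi> (g y)))"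
    unfolding T_def g_def
    using x sum.reindex_bij_betw[OF bij_betw_graft_pre[OF x], of "\<lambda>y. F y *\<^sub>R U y (\<Phi> y)"] by simp
  then have "T \<Phi> x - T \<Phi> x' = (\<Sum>y\<in>pre x. F y *\<^sub>R U y (\<Phi> y) - F (g y) *\<^sub>R U (g y) (\<Phi> (g y)))"
    using x by (simp add: T_def sum_subtractf)
  also have "norm \<dots> \<le> (\<Sum>y\<in>pre x. F y * h y * (exp (- \<alpha>) * (B + twist_const * s) * hdist x x'))"
  proof (rule sum_norm_le)
    fix y assume y: "y \<in> pre x"
    have yX: "y \<in> X" by (rule pre_mem[OF y])
    have gX: "g y \<in> X" and ag: "agree m y (g y)" and d: "hdist y (g y) = exp (- \<alpha>) * hdist x x'"
      using graft_pre(1,2)[OF y x(2,3)] hdist_graft[OF y x(2,3)] pre_mem agree_mono[of "Suc m" y "g y" m]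
      by (auto simp: g_def)
    have Fy: "0 < F y" by (rule F_pos[OF yX])
    have eq: "F y *\<^sub>R U y (\<Phi> y) - F (g y) *\<^sub>R U (g y) (\<Phi> (g y))
        = F y *\<^sub>R U y (\<Phi> y - \<Phi> (g y)) + (F y - F (g y)) *\<^sub>R U y (\<Phi> (g y))"
      unfolding U_agree[OF gX yX agree_sym[OF ag]] U_diff[OF yX] by (simp add: algebra_simps)
    have "norm (F y *\<^sub>R U y (\<Phi> y - \<Phi> (g y))) \<le> F y * (B * h y * hdist y (g y))"
      using U_norm[OF yX, of "\<Phi> y - \<Phi> (g y)"] B[OF yX gX ag] Fy by (simp add: mult_left_mono)
    moreover have "norm ((F y - F (g y)) *\<^sub>R U y (\<Phi> (g y))) \<le> F y * (twist_const * s * h y * hdist y (g y))"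
    proof -
      have "norm (U y (\<Phi> (g y))) \<le> s * h (g y)" using U_norm[OF yX, of "\<Phi> (g y)"] s[OF gX] by linarith
      also have "\<dots> \<le> s * (exp \<kappa> * h y)"
      proof (rule mult_left_mono[OF _ nn(1)])
        have "h (g y) \<le> exp (\<kappa> * hdist (g y) y) * h y"
          by (rule superharmonicD(4)[OF h gX yX agree_sym[OF ag]])
        also have "\<dots> \<le> exp \<kappa> * h y"
          using mult_left_mono[OF hdist_le_1 \<kappa>_nonneg, of "g y" y] superharmonicD(3)[OF h yX]
          by (intro mult_right_mono) simp_all
        finally show "h (g y) \<le> exp \<kappa> * h y" .
      qed
      finally have "\<bar>F y - F (g y)\<bar> * norm (U y (\<Phi> (g y)))
          \<le> (c * exp c * hdist y (g y) * F y) * (s * (exp \<kappa> * h y))"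
        using F_diff[OF yX gX] Fy c_nonneg by (intro mult_mono) simp_all
      then show ?thesis by (simp add: twist_const_def mult_ac)
    qed
    ultimately have "norm (F y *\<^sub>R U y (\<Phi> y) - F (g y) *\<^sub>R U (g y) (\<Phi> (g y)))
        \<le> F y * (B * h y * hdist y (g y)) + F y * (twist_const * s * h y * hdist y (g y))"
      unfolding eq by (intro order_trans[OF norm_triangle_ineq] add_mono)
    then show "norm (F y *\<^sub>R U y (\<Phi> y) - F (g y) *\<^sub>R U (g y) (\<Phi> (g y)))
        \<le> F y * h y * (exp (- \<alpha>) * (B + twist_const * s) * hdist x x')"
      unfolding d by (simp add: algebra_simps)
  qed
  also have "\<dots> = L h x * (exp (- \<alpha>) * (B + twist_const * s) * hdist x x')"
    by (simp add: L_def sum_distrib_right)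
  also have "\<dots> \<le> r * h x * (exp (- \<alpha>) * (B + twist_const * s) * hdist x x')"
    using superharmonicD(2)[OF h x(1)] nn twist_const_nonneg by (intro mult_right_mono) simp_all
  finally show ?thesis by (simp add: mult_ac)
qed

lemma superharmonic_one: "superharmonic mass_bound (\<lambda>_. 1)"
  using regular_one L_const_le[of 1] by (simp add: superharmonic_def)

lemma T_bounded: "\<exists>B. bounded_by B T"
proof -
  define B where "B = mass_bound + (mass_bound * (1 + twist_const) + 2 * mass_bound * exp (\<alpha> * m))"
  have main: "T \<Phi> \<in> H \<and> N (T \<Phi>) \<le> B * N \<Phi>" if \<Phi>: "\<Phi> \<in> H" for \<Phi>
  proof -
    have NN: "0 \<le> N \<Phi>" by (rule N_nonneg[OF \<Phi>])
    have A: "norm (T \<Phi> x) \<le> mass_bound * N \<Phi>" if x: "x \<in> X" for x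
    proof -
      have "norm (T \<Phi> x) \<le> N \<Phi> * L (\<lambda>_. 1) x"
        by (rule norm_T_le) (use norm_le_N[OF \<Phi>] x in simp_all)
      also have "\<dots> \<le> N \<Phi> * mass_bound"
        using superharmonicD(2)[OF superharmonic_one x] NN by (intro mult_left_mono) simp_all
      finally show ?thesis by (simp add: mult.commute)
    qed
    have Bd: "norm (T \<Phi> x - T \<Phi> y) \<le> mass_bound * (1 + twist_const) * N \<Phi> * hdist x y"
      if xy: "x \<in> X" "y \<in> X" "agree m x y" for x y
    proof -
      have "norm (T \<Phi> x - T \<Phi> y) \<le> mass_bound * 1 * exp (- \<alpha>) * (N \<Phi> + twist_const * N \<Phi>) * hdist x y"
        by (rule T_variation[OF superharmonic_one NN NN _ _ xy])
          (use norm_le_N[OF \<Phi>] holder_variation[OF \<Phi>] in simp_all)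
      also have "\<dots> \<le> mass_bound * 1 * 1 * (N \<Phi> + twist_const * N \<Phi>) * hdist x y"
        using NN twist_const_nonneg mass_bound_pos \<alpha>_pos by (intro mult_right_mono mult_left_mono) simp_all
      finally show ?thesis by (simp add: algebra_simps)
    qed
    have mem: "T \<Phi> x \<in> E" "x \<notin> X \<Longrightarrow> T \<Phi> x = 0" for x
      using T_mem_E[of \<Phi> x] holder_mem[OF \<Phi>] by (auto simp: T_def)
    have nn: "0 \<le> mass_bound * N \<Phi>" "0 \<le> mass_bound * (1 + twist_const) * N \<Phi>" using NN twist_const_nonneg mass_bound_pos by simp_all
    show ?thesis
      using locally_holder_mem[OF mem A nn(1) Bd nn(2)] by (simp add: B_def algebra_simps)
  qed
  have "bounded_by B T"
    unfolding bounded_by_def linear_op_def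
  proof (intro conjI ballI allI)
    fix \<Phi> assume \<Phi>: "\<Phi> \<in> H"
    show "T \<Phi> \<in> H" "N (T \<Phi>) \<le> B * N \<Phi>" using main[OF \<Phi>] by auto
    show "T (\<lambda>x. \<Phi> x + \<Psi> x) = (\<lambda>x. T \<Phi> x + T \<Psi> x)" for \<Psi>
      by (auto simp: T_def fun_eq_iff U_add pre_mem scaleR_add_right sum.distrib intro!: sum.cong)
    show "T (\<lambda>x. b *\<^sub>C \<Phi> x) = (\<lambda>x. b *\<^sub>C T \<Phi> x)" for b
    proof -
      interpret sc: bounded_linear "\<lambda>v. b *\<^sub>C v :: 'e" by (rule bounded_linear_scaleC)
      show ?thesis by (auto simp: T_def fun_eq_iff U_scale pre_mem sc.sum sc.scaleR intro!: sum.cong)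
    qed
  qed
  then show ?thesis by blast
qed

lemma T_linear: "linear_op T"
  using T_bounded bounded_by_linear by blast

lemma bdd_above_spec: "bdd_above (insert 0 (cmod ` spec T))"
proof -
  obtain B where "bounded_by B T" using T_bounded by blast
  then show ?thesis using spec_bounded by (intro bdd_aboveI[of _ "max B 0"]) auto
qed

lemma spectral_radius_eq: "spectral_radius \<alpha> X E T = Sup (insert 0 (cmod ` spec T))"
  unfolding spectral_radius_def holder_spectrum_eq_spec(2)[OF function_space_axioms] ..

lemma spec_le_spectral_radius: "z \<in> spec T \<Longrightarrow> cmod z \<le> spectral_radius \<alpha> X E T"
  unfolding spectral_radius_eq by (rule cSup_upper[OF _ bdd_above_spec]) simp

lemma spectral_radius_nonneg: "0 \<le> spectral_radius \<alpha> X E T"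
  unfolding spectral_radius_eq by (rule cSup_upper[OF _ bdd_above_spec]) simp

lemma approximate_eigenvalue_above:
  assumes "b < spectral_radius \<alpha> X E T" "0 \<le> b"
  obtains z where "b < cmod z"
    "\<And>\<tau>. 0 < \<tau> \<Longrightarrow> \<exists>\<Phi>\<in>H. N (\<lambda>x. z *\<^sub>C \<Phi> x - T \<Phi> x) < \<tau> * N \<Phi>"
proof -
  obtain z0 where z0: "z0 \<in> spec T" "b < cmod z0"
    using assms less_cSup_iff[OF _ bdd_above_spec, of b] unfolding spectral_radius_eq by auto
  have "z0 \<noteq> 0" using z0 assms(2) by auto
  obtain B where B: "bounded_by B T" using T_bounded by blast
  show ?thesis
  proof (rule spec_imp_approximate_eigenvectors[OF B z0(1) \<open>z0 \<noteq> 0\<close>])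
    fix z assume z: "cmod z0 \<le> cmod z"
      and approx: "\<And>\<tau>. 0 < \<tau> \<Longrightarrow> \<exists>\<Phi>\<in>H. N (\<lambda>x. z *\<^sub>C \<Phi> x - T \<Phi> x) < \<tau> * N \<Phi>"
    show ?thesis
    proof (rule that)
      show "b < cmod z" using z0(2) z by linarith
      show "\<exists>\<Phi>\<in>H. N (\<lambda>x. z *\<^sub>C \<Phi> x - T \<Phi> x) < \<tau> * N \<Phi>" if "0 < \<tau>" for \<tau>
        by (rule approx[OF that])
    qed
  qed
qed

text \<open>Let \<open>s\<close> be the supremum of \<open>\<parallel>\<Phi>\<parallel> / h\<close> and \<open>B\<close> the best local Hoelder constant of \<open>\<Phi>\<close> relative to \<open>h\<close>. Applied to
  \<open>z \<Phi> \<approx> T \<Phi>\<close>, the Lasota--Yorke inequality gives \<open>B \<le> e\<^sup>-\<^sup>\<alpha>\<^sup>/\<^sup>2 (B + twist_const s)\<close> up to a small error, since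
  \<open>|z| \<ge> r e\<^sup>-\<^sup>\<alpha>\<^sup>/\<^sup>2\<close>. Hence \<open>B\<close> is bounded by a multiple of \<open>s\<close> that depends only on \<open>\<alpha>\<close> and \<open>c\<close>, and errors measured in the
  Hoelder norm become errors relative to \<open>s\<close>.\<close>

lemma normalised_approximate_eigenvector:
  assumes h: "superharmonic r h" and r: "0 < r" and hB: "\<And>x. x \<in> X \<Longrightarrow> h x \<le> hB"
    and z: "r * exp (- \<alpha> / 2) \<le> cmod z"
    and approx: "\<And>\<tau>. 0 < \<tau> \<Longrightarrow> \<exists>\<Phi>\<in>H. N (\<lambda>x. z *\<^sub>C \<Phi> x - T \<Phi> x) < \<tau> * N \<Phi>"
    and \<tau>: "0 < \<tau>"
  obtains \<Phi> s x0 where "\<Phi> \<in> H" "0 < s" "x0 \<in> X" "(1 - \<tau>) * s * h x0 \<le> norm (\<Phi> x0)"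
    "\<And>x. x \<in> X \<Longrightarrow> norm (\<Phi> x) \<le> s * h x"
    "\<And>x. x \<in> X \<Longrightarrow> norm (z *\<^sub>C \<Phi> x - T \<Phi> x) \<le> \<tau> * s * r * h x"
    "\<And>x y. \<lbrakk>x \<in> X; y \<in> X; agree m x y\<rbrakk> \<Longrightarrow> norm (\<Phi> x - \<Phi> y) \<le> holder_const * s * h x * hdist x y"
proof -
  define e \<beta> where "e = exp (- \<alpha> / 2)" and "\<beta> = 1 - e"
  have \<beta>: "0 < \<beta>" "\<beta> < 1" and e: "0 < e" "e < 1" "e * e = exp (- \<alpha>)"
    using \<alpha>_pos by (simp_all add: \<beta>_def e_def flip: exp_add)
  have holder_const: "0 < holder_const" "holder_const * \<beta> = 2 * (twist_const + 1)"
  proof -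
    have "holder_const = 2 * (twist_const + 1) / \<beta>" by (simp add: holder_const_def \<beta>_def e_def)
    then show "0 < holder_const" "holder_const * \<beta> = 2 * (twist_const + 1)" using \<beta> twist_const_nonneg by simp_all
  qed
  have zr: "r * e \<le> cmod z" using z by (simp add: e_def)
  have z_pos: "0 < cmod z" using less_le_trans[OF mult_pos_pos[OF r e(1)] zr] .
  obtain x1 where x1: "x1 \<in> X" using nonempty by blast
  have hB1: "1 \<le> hB" using superharmonicD(1)[OF h x1] hB[OF x1] by linarith
  define C3 where "C3 = hB * (1 + 2 * exp (\<alpha> * m))"
  have C3: "0 < C3" using hB1 by (auto simp: C3_def intro!: mult_pos_pos add_pos_pos)
  \<comment> \<open>The first bound lets the error be absorbed on the left of the inequality for \<open>B\<close>; the
  second makes it at most \<open>\<tau> s r h\<close> in the end.\<close>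
  define t where "t = min (cmod z * \<beta> / (2 * C3)) (\<tau> * r / (C3 * (1 + holder_const)))"
  have t: "0 < t" "t * C3 / cmod z \<le> \<beta> / 2" "t * C3 * (1 + holder_const) \<le> \<tau> * r"
  proof -
    show "0 < t" using z_pos C3 holder_const \<beta> \<tau> r by (simp add: t_def)
    have "t \<le> cmod z * \<beta> / (2 * C3)" by (simp add: t_def)
    then show "t * C3 / cmod z \<le> \<beta> / 2" using z_pos C3 by (simp add: field_simps)
    have "t \<le> \<tau> * r / (C3 * (1 + holder_const))" by (simp add: t_def)
    then show "t * C3 * (1 + holder_const) \<le> \<tau> * r"
      using C3 holder_const by (simp add: le_divide_eq mult.assoc mult_pos_pos)
  qed
  obtain \<Phi> where \<Phi>: "\<Phi> \<in> H" and small: "N (\<lambda>x. z *\<^sub>C \<Phi> x - T \<Phi> x) < t * N \<Phi>" using approx[OF t(1)] by blast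
  define \<Xi> where "\<Xi> = (\<lambda>x. z *\<^sub>C \<Phi> x - T \<Phi> x)"
  have \<Xi>: "\<Xi> \<in> H" unfolding \<Xi>_def by (intro diff_mem scale_mem \<Phi> linear_opD(1)[OF T_linear])
  have N\<Xi>: "N \<Xi> < t * N \<Phi>" using small by (simp add: \<Xi>_def)
  have N\<Phi>: "0 < N \<Phi>" using N\<Xi> N_nonneg[OF \<Xi>] t(1) by (meson le_less_trans zero_less_mult_pos)
  have h1: "1 \<le> h x" "0 < h x" if "x \<in> X" for x using superharmonicD(1,3)[OF h that] by auto
  define s where "s = (SUP x\<in>X. norm (\<Phi> x) / h x)"
  have le_NPhi: "norm (\<Phi> x) / h x \<le> N \<Phi>" if "x \<in> X" for x
  proof -
    have "norm (\<Phi> x) \<le> N \<Phi> * 1" using norm_le_N[OF \<Phi>] by simp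
    also have "\<dots> \<le> N \<Phi> * h x" using h1(1)[OF that] N\<Phi> by (intro mult_left_mono) simp_all
    finally show ?thesis using h1(2)[OF that] by (simp add: divide_le_eq)
  qed
  have bdd_s: "bdd_above ((\<lambda>x. norm (\<Phi> x) / h x) ` X)" using le_NPhi by (intro bdd_aboveI[of _ "N \<Phi>"]) auto
  have s_le: "norm (\<Phi> x) \<le> s * h x" if "x \<in> X" for x
    using cSUP_upper[OF that bdd_s] h1(2)[OF that] by (simp add: s_def divide_le_eq)
  have s0: "0 \<le> s"
    using cSUP_upper[OF x1 bdd_s] h1(2)[OF x1] unfolding s_def
    by (meson divide_nonneg_pos norm_ge_zero order_trans)
  define P where "P = {(x, y). x \<in> X \<and> y \<in> X \<and> agree m x y}"
  define quot where "quot = (\<lambda>(x, y). norm (\<Phi> x - \<Phi> y) / (h x * hdist x y))"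
  define B where "B = (SUP p\<in>P. quot p)"
  have P0: "(x1, x1) \<in> P" using x1 by (simp add: P_def)
  have hdist_pos: "0 < hdist x y" if "x \<noteq> y" for x y using that by (simp add: hdist_def shift_dist_def)
  have bdd_B: "bdd_above (quot ` P)"
  proof (rule bdd_aboveI[of _ "N \<Phi>"])
    fix q assume "q \<in> quot ` P"
    then obtain x y where xy: "x \<in> X" "y \<in> X" and q: "q = norm (\<Phi> x - \<Phi> y) / (h x * hdist x y)"
      by (auto simp: P_def quot_def)
    show "q \<le> N \<Phi>"
    proof (cases "x = y")
      case False
      have "norm (\<Phi> x - \<Phi> y) \<le> N \<Phi> * hdist x y * 1" using holder_variation[OF \<Phi> xy] by simp
      also have "\<dots> \<le> N \<Phi> * hdist x y * h x" using h1(1)[OF xy(1)] N\<Phi> by (intro mult_left_mono) simp_all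
      finally show ?thesis using hdist_pos[OF False] h1(2)[OF xy(1)] by (simp add: q divide_le_eq mult_ac)
    qed (use N\<Phi> q in simp)
  qed
  have B0: "0 \<le> B" using cSUP_upper[OF P0 bdd_B] by (simp add: B_def quot_def)
  have B_le: "norm (\<Phi> x - \<Phi> y) \<le> B * h x * hdist x y" if xy: "x \<in> X" "y \<in> X" "agree m x y" for x y
  proof (cases "x = y")
    case False
    have "quot (x, y) \<le> B" unfolding B_def using xy by (intro cSUP_upper bdd_B) (simp add: P_def)
    then show ?thesis
      using hdist_pos[OF False] h1(2)[OF xy(1)] by (simp add: quot_def divide_le_eq mult_ac)
  qed (simp add: hdist_def shift_dist_def)
  have N_le: "N \<Phi> \<le> C3 * (s + B)"
  proof -
    have "norm (\<Phi> x) \<le> s * hB" if "x \<in> X" for x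
      using s_le[OF that] mult_left_mono[OF hB[OF that] s0] by linarith
    moreover have "norm (\<Phi> x - \<Phi> y) \<le> B * hB * hdist x y" if xy: "x \<in> X" "y \<in> X" "agree m x y" for x y
    proof -
      have "B * h x * hdist x y \<le> B * hB * hdist x y"
        using hB[OF xy(1)] B0 by (intro mult_right_mono mult_left_mono) simp_all
      then show ?thesis using B_le[OF xy] by linarith
    qed
    ultimately have "N \<Phi> \<le> s * hB + (B * hB + 2 * (s * hB) * exp (\<alpha> * m))"
      using s0 B0 hB1 holder_mem[OF \<Phi>] by (intro locally_holder_mem(2)) simp_all
    also have "\<dots> \<le> C3 * (s + B)" using s0 B0 hB1 by (simp add: C3_def algebra_simps)
    finally show ?thesis .
  qed
  have "quot p \<le> e * (B + twist_const * s) + \<beta> / 2 * (s + B)" if p: "p \<in> P" for p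
  proof -
    obtain x y where xy: "p = (x, y)" "x \<in> X" "y \<in> X" "agree m x y" using p by (auto simp: P_def)
    show ?thesis
    proof (cases "x = y")
      case True
      then show ?thesis using xy e \<beta> s0 B0 twist_const_nonneg by (simp add: quot_def)
    next
      case False
      have "z *\<^sub>C \<Phi> w = T \<Phi> w + \<Xi> w" for w by (simp add: \<Xi>_def)
      then have "z *\<^sub>C (\<Phi> x - \<Phi> y) = (T \<Phi> x - T \<Phi> y) + (\<Xi> x - \<Xi> y)"
        by (simp add: scaleC_diff_right)
      then have "cmod z * norm (\<Phi> x - \<Phi> y) \<le> norm (T \<Phi> x - T \<Phi> y) + norm (\<Xi> x - \<Xi> y)"
        using norm_triangle_ineq[of "T \<Phi> x - T \<Phi> y" "\<Xi> x - \<Xi> y"] by (simp flip: norm_scaleC)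
      also have "\<dots> \<le> r * h x * exp (- \<alpha>) * (B + twist_const * s) * hdist x y + t * C3 * (s + B) * (h x * hdist x y)"
      proof (rule add_mono)
        show "norm (T \<Phi> x - T \<Phi> y) \<le> r * h x * exp (- \<alpha>) * (B + twist_const * s) * hdist x y"
          by (rule T_variation[OF h s0 B0 s_le B_le xy(2-4)])
        have "norm (\<Xi> x - \<Xi> y) \<le> N \<Xi> * hdist x y" by (rule holder_variation[OF \<Xi> xy(2,3)])
        also have "\<dots> \<le> t * (C3 * (s + B)) * (h x * hdist x y)"
        proof (rule mult_mono)
          show "N \<Xi> \<le> t * (C3 * (s + B))"
            using N\<Xi> mult_left_mono[OF N_le less_imp_le[OF t(1)]] by linarith
          show "hdist x y \<le> h x * hdist x y" using mult_right_mono[OF h1(1)[OF xy(2)] hdist_nonneg, of x y] by simp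
        qed (use t C3 s0 B0 in simp_all)
        finally show "norm (\<Xi> x - \<Xi> y) \<le> t * C3 * (s + B) * (h x * hdist x y)" by (simp add: mult.assoc)
      qed
      also have "\<dots> = h x * hdist x y * (r * e * (e * (B + twist_const * s)) + t * C3 * (s + B))"
        by (simp add: e(3)[symmetric] algebra_simps)
      also have "\<dots> \<le> h x * hdist x y * (cmod z * (e * (B + twist_const * s)) + t * C3 * (s + B))"
        using zr h1(2)[OF xy(2)] e s0 B0 twist_const_nonneg
        by (intro mult_left_mono add_right_mono mult_right_mono) simp_all
      also have "\<dots> = cmod z * (h x * hdist x y * (e * (B + twist_const * s) + t * C3 / cmod z * (s + B)))"
        using z_pos by (simp add: field_simps)
      finally have "norm (\<Phi> x - \<Phi> y) \<le> h x * hdist x y * (e * (B + twist_const * s) + t * C3 / cmod z * (s + B))"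
        using z_pos by simp
      also have "\<dots> \<le> h x * hdist x y * (e * (B + twist_const * s) + \<beta> / 2 * (s + B))"
        using t(2) s0 B0 h1(2)[OF xy(2)] by (intro mult_left_mono add_left_mono mult_right_mono) simp_all
      finally show ?thesis
        using h1(2)[OF xy(2)] hdist_pos[OF False] by (simp add: quot_def xy(1) divide_le_eq mult_ac)
    qed
  qed
  then have "B \<le> e * (B + twist_const * s) + \<beta> / 2 * (s + B)" unfolding B_def using P0 by (intro cSUP_least) auto
  then have "B - e * B - \<beta> / 2 * B \<le> (twist_const * e + \<beta> / 2) * s"
    by (simp add: algebra_simps add_divide_distrib)
  moreover have "B - e * B - \<beta> / 2 * B = B * \<beta> / 2" by (simp add: \<beta>_def field_simps)
  ultimately have "B * \<beta> \<le> (twist_const * e + \<beta> / 2) * s * 2" by linarith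
  also have "\<dots> \<le> (twist_const + 1) * s * 2"
  proof (intro mult_right_mono add_mono)
    show "twist_const * e \<le> twist_const" using twist_const_nonneg e by (simp add: mult_left_le)
  qed (use \<beta> s0 in simp_all)
  also have "\<dots> = holder_const * s * \<beta>" using holder_const(2) by (simp add: mult_ac)
  finally have BK1: "B \<le> holder_const * s" using \<beta> by simp
  have s_pos: "0 < s"
  proof (rule ccontr)
    assume "\<not> 0 < s"
    then have "s = 0" using s0 by simp
    then have "N \<Phi> \<le> 0" using BK1 B0 N_le by simp
    then show False using N\<Phi> by simp
  qed
  have "(1 - \<tau>) * s < s" using s_pos \<tau> by (simp add: algebra_simps)
  then obtain x0 where x0: "x0 \<in> X" "(1 - \<tau>) * s < norm (\<Phi> x0) / h x0"
    using less_cSUP_iff[OF _ bdd_s] nonempty unfolding s_def by blast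
  show ?thesis
  proof (rule that[OF \<Phi> s_pos x0(1)])
    show "(1 - \<tau>) * s * h x0 \<le> norm (\<Phi> x0)" using x0(2) h1(2)[OF x0(1)] by (simp add: less_divide_eq)
    show "norm (\<Phi> x) \<le> s * h x" if "x \<in> X" for x by (rule s_le[OF that])
    show "norm (\<Phi> x - \<Phi> y) \<le> holder_const * s * h x * hdist x y" if xy: "x \<in> X" "y \<in> X" "agree m x y" for x y
    proof -
      have "B * h x * hdist x y \<le> holder_const * s * h x * hdist x y"
        using BK1 h1(2)[OF xy(1)] by (intro mult_right_mono) simp_all
      then show ?thesis using B_le[OF xy] by linarith
    qed
    fix x assume x: "x \<in> X"
    have "norm (z *\<^sub>C \<Phi> x - T \<Phi> x) \<le> N \<Xi>" using norm_le_N[OF \<Xi>, of x] by (simp add: \<Xi>_def)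
    also have "\<dots> \<le> t * (C3 * (s + B))"
      using N\<Xi> mult_left_mono[OF N_le less_imp_le[OF t(1)]] by linarith
    also have "\<dots> \<le> t * (C3 * (s + holder_const * s))"
      using BK1 t(1) C3 by (intro mult_left_mono add_left_mono) simp_all
    also have "\<dots> = t * C3 * (1 + holder_const) * s" by (simp add: algebra_simps)
    also have "\<dots> \<le> \<tau> * r * s" using t(3) s0 by (intro mult_right_mono)
    also have "\<dots> \<le> \<tau> * s * r * h x"
      using mult_left_mono[OF h1(1)[OF x], of "\<tau> * s * r"] \<tau> r s0 by (simp add: mult_ac)
    finally show "norm (z *\<^sub>C \<Phi> x - T \<Phi> x) \<le> \<tau> * s * r * h x" .
  qed
qed

end

section \<open>Spectral radius and extremal profiles\<close>

context weighted_sft begin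

text \<open>The Green functions satisfy \<open>(growth - \<L>) green\<^sub>r = r - (r - growth) green\<^sub>r\<close>. A bounded inverse of \<open>growth - \<L>\<close>
  would therefore bound \<open>green\<^sub>r\<close> uniformly for \<open>r\<close> near the growth rate, where it is unbounded.\<close>

lemma growth_le_transfer_radius: "growth \<le> transfer_radius \<alpha> X F"
proof -
  interpret tw: twisted_transfer X m F \<alpha> c "UNIV :: complex set" "\<lambda>_ v. v"
    by unfold_locales (simp_all add: scaleC_add_right)
  have T_eq: "tw.T = transfer_op X F"
    by (rule ext)+ (simp add: tw.T_def transfer_op_def pre_def scaleR_conv_of_real)
  define \<Phi> where "\<Phi> r x = (if x \<in> X then complex_of_real (green r x) else 0)" for r x
  have \<Phi>_mem: "\<Phi> r \<in> tw.H" if r: "growth < r" for r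
  proof -
    note adm = green_finite_above_growth[OF r]
    have reg: "regular (green r)" using superharmonic_green[OF adm] by (simp add: superharmonic_def)
    obtain B where B: "\<And>x. x \<in> X \<Longrightarrow> green r x \<le> B" using green_bounded[OF adm] by blast
    have g1: "1 \<le> green r x" if "x \<in> X" for x by (rule green_ge_1[OF adm that])
    obtain x1 where x1: "x1 \<in> X" using nonempty by blast
    have B0: "0 \<le> B" using g1[OF x1] B[OF x1] by linarith
    have A: "norm (\<Phi> r x) \<le> B" if "x \<in> X" for x using B[OF that] g1[OF that] that by (simp add: \<Phi>_def)
    have V: "norm (\<Phi> r x - \<Phi> r y) \<le> (\<kappa> * exp \<kappa> * B) * hdist x y" if xy: "x \<in> X" "y \<in> X" "agree m x y" for x y
    proof -
      have "norm (\<Phi> r x - \<Phi> r y) = \<bar>green r x - green r y\<bar>"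
        using xy by (simp add: \<Phi>_def flip: of_real_diff)
      also have "\<dots> \<le> \<kappa> * exp \<kappa> * hdist x y * green r x" by (rule regular_diff[OF reg xy])
      also have "\<dots> \<le> \<kappa> * exp \<kappa> * hdist x y * B"
        using B[OF xy(1)] \<kappa>_nonneg by (intro mult_left_mono) simp_all
      finally show ?thesis by (simp add: mult_ac)
    qed
    have nn: "0 \<le> \<kappa> * exp \<kappa> * B" using \<kappa>_nonneg B0 by simp
    show ?thesis by (rule tw.locally_holder_mem(1)[OF _ _ A B0 V nn]) (simp_all add: \<Phi>_def)
  qed
  have T\<Phi>: "tw.T (\<Phi> r) x = complex_of_real (r * (green r x - 1))" if r: "growth < r" and x: "x \<in> X" for r x
  proof -
    have "tw.T (\<Phi> r) x = (\<Sum>y\<in>pre x. complex_of_real (F y * green r y))"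
      using x pre_mem by (auto simp: tw.T_def \<Phi>_def scaleR_conv_of_real intro!: sum.cong)
    also have "\<dots> = complex_of_real (L (green r) x)" by (simp add: L_def)
    finally show ?thesis by (simp add: L_green[OF green_finite_above_growth[OF r] x])
  qed
  define one where "one x = (if x \<in> X then 1 else 0 :: complex)" for x
  have one_mem: "one \<in> tw.H"
    by (rule tw.locally_holder_mem(1)[where A = 1 and B = 0]) (simp_all add: one_def)
  have "of_real growth \<in> tw.spec tw.T"
  proof (rule ccontr)
    assume "\<not> ?thesis"
    then obtain R B where R: "tw.bounded_by B R" "tw.inverse_at tw.T (of_real growth) R"
      unfolding tw.spec_def by blast
    define B' where "B' = \<bar>B\<bar> + 1"
    have B': "0 < B'" by (simp add: B'_def)
    define M where "M = 2 * B' * ((growth + 1) * tw.N one)"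
    have bound: "tw.N (\<Phi> r) \<le> M" if r: "growth < r" "r < growth + 1" "r < growth + 1 / (2 * B')" for r
    proof -
      define g where "g x = of_real growth *\<^sub>C \<Phi> r x - tw.T (\<Phi> r) x" for x
      have g: "g \<in> tw.H"
        unfolding g_def[abs_def]
        by (intro tw.diff_mem tw.scale_mem \<Phi>_mem r tw.linear_opD(1)[OF tw.T_linear])
      have g_eq: "g = (\<lambda>x. of_real r *\<^sub>C one x - of_real (r - growth) *\<^sub>C \<Phi> r x)"
      proof
        fix x
        show "g x = of_real r *\<^sub>C one x - of_real (r - growth) *\<^sub>C \<Phi> r x"
        proof (cases "x \<in> X")
          case True
          then show ?thesis
            by (simp add: g_def T\<Phi>[OF r(1) True] one_def \<Phi>_def scaleC_complex_def algebra_simps)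
        next
          case False
          then show ?thesis by (simp add: g_def tw.T_def one_def \<Phi>_def)
        qed
      qed
      have rpos: "0 < r" using growth_pos r(1) by linarith
      have "tw.N (\<Phi> r) = tw.N (R g)"
        using R(2) \<Phi>_mem[OF r(1)] unfolding tw.inverse_at_def g_def[abs_def] by simp
      also have "\<dots> \<le> B * tw.N g" by (rule tw.bounded_byD[OF R(1) g])
      also have "\<dots> \<le> B' * tw.N g" by (intro mult_right_mono tw.N_nonneg g) (simp add: B'_def)
      also have "\<dots> \<le> B' * (r * tw.N one + (r - growth) * tw.N (\<Phi> r))"
      proof (rule mult_left_mono)
        have "tw.N g \<le> tw.N (\<lambda>x. of_real r *\<^sub>C one x) + tw.N (\<lambda>x. of_real (r - growth) *\<^sub>C \<Phi> r x)"
          unfolding g_eq by (intro tw.N_diff_le tw.scale_mem one_mem \<Phi>_mem r)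
        also have "\<dots> = r * tw.N one + (r - growth) * tw.N (\<Phi> r)"
          using tw.N_scale[OF one_mem] tw.N_scale[OF \<Phi>_mem[OF r(1)]] rpos r(1)
          by (simp del: of_real_diff)
        finally show "tw.N g \<le> r * tw.N one + (r - growth) * tw.N (\<Phi> r)" .
      qed (use B' in simp)
      also have "\<dots> = B' * (r * tw.N one) + B' * (r - growth) * tw.N (\<Phi> r)" by (simp add: algebra_simps)
      also have "\<dots> \<le> B' * ((growth + 1) * tw.N one) + 1 / 2 * tw.N (\<Phi> r)"
      proof (intro add_mono mult_left_mono mult_right_mono tw.N_nonneg one_mem \<Phi>_mem r(1))
        show "B' * (r - growth) \<le> 1 / 2" using r(3) B' by (simp add: field_simps)
      qed (use r B' in simp_all)
      finally show ?thesis by (simp add: M_def)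
    qed
    have "\<forall>\<^sub>F r in at_right growth. growth < r \<and> r < growth + 1 \<and> r < growth + 1 / (2 * B')"
      using B' by (intro eventually_conj eventually_at_right_less eventually_at_rightI[of growth "growth + 1"]
          eventually_at_rightI[of growth "growth + 1 / (2 * B')"]) simp_all
    moreover have "\<forall>\<^sub>F r in at_right growth. \<exists>x\<in>X. M < green r x" by (rule green_unbounded_near_growth)
    ultimately have "\<forall>\<^sub>F r in at_right growth. False"
    proof eventually_elim
      case (elim r)
      then obtain x where x: "x \<in> X" "M < green r x" by blast
      have "green r x \<le> norm (\<Phi> r x)" using x by (simp add: \<Phi>_def)
      also have "\<dots> \<le> tw.N (\<Phi> r)" using elim by (intro tw.norm_le_N \<Phi>_mem) simp
      also have "\<dots> \<le> M" using elim by (intro bound) simp_all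
      finally show False using x(2) by simp
    qed
    then show False by (simp add: trivial_limit_at_right_real)
  qed
  then have "cmod (of_real growth) \<le> spectral_radius \<alpha> X UNIV tw.T" by (rule tw.spec_le_spectral_radius)
  then show ?thesis using growth_pos by (simp add: T_eq)
qed

end

locale permutation_rep = group_action G Y act
  for G :: "('g, 'm) monoid_scheme" (structure) and Y :: "'y set" and act
begin

abbreviation \<Lambda> :: "'g \<Rightarrow> 'y ell2 \<Rightarrow> 'y ell2" where "\<Lambda> \<equiv> induced_rep G Y act"

lemma group_G: "group G"
  using group_hom by (simp add: group_hom_def)

lemma \<Lambda>_eq_reindex: "\<Lambda> g = reindex Y (act (inv g))"
  by (rule ext) (simp add: induced_rep_def reindex_def)

lemma act_bij: assumes "g \<in> carrier G" shows "bij_betw (act g) Y Y"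
  using bij_prop0[OF assms] by (simp add: Bij_def)

lemma act_inv:
  assumes "g \<in> carrier G"
  shows "inj_on (act (inv g)) Y" "act (inv g) ` Y = Y"
  using act_bij[of "inv g"] assms group.inv_closed[OF group_G assms] by (auto simp: bij_betw_def)

lemma \<Lambda>_linear:
  assumes "g \<in> carrier G"
  shows "\<Lambda> g (u + v) = \<Lambda> g u + \<Lambda> g v" "\<Lambda> g (u - v) = \<Lambda> g u - \<Lambda> g v"
    "\<Lambda> g (b *\<^sub>C v) = b *\<^sub>C \<Lambda> g v" "\<Lambda> g (r *\<^sub>R v) = r *\<^sub>R \<Lambda> g v"
    "\<Lambda> g 0 = 0" "modulus (\<Lambda> g v) = \<Lambda> g (modulus v)" "\<Lambda> g v \<in> ell2_on Y"
  unfolding \<Lambda>_eq_reindex by (fact reindex_linear[OF act_inv(1)[OF assms]])+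

lemma \<Lambda>_sum: "g \<in> carrier G \<Longrightarrow> \<Lambda> g (\<Sum>i\<in>I. v i) = (\<Sum>i\<in>I. \<Lambda> g (v i))"
  unfolding \<Lambda>_eq_reindex by (rule reindex_sum[OF act_inv(1)])

lemma norm_\<Lambda>_le: "g \<in> carrier G \<Longrightarrow> norm (\<Lambda> g v) \<le> norm v"
  unfolding \<Lambda>_eq_reindex by (rule norm_reindex_le[OF act_inv(1)])

lemma norm_\<Lambda>: "g \<in> carrier G \<Longrightarrow> v \<in> ell2_on Y \<Longrightarrow> norm (\<Lambda> g v) = norm v"
  unfolding \<Lambda>_eq_reindex by (rule norm_reindex[OF act_inv(1)]) (simp_all add: act_inv(2))

lemma \<Lambda>_mult:
  assumes "g \<in> carrier G" "h \<in> carrier G"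
  shows "\<Lambda> g (\<Lambda> h v) = \<Lambda> (g \<otimes> h) v"
proof -
  interpret group G by (rule group_G)
  have "\<Lambda> g (\<Lambda> h v) = reindex Y (\<lambda>y. act (inv h) (act (inv g) y)) v"
    unfolding \<Lambda>_eq_reindex by (rule reindex_reindex) (use act_inv assms in auto)
  also have "\<dots> = reindex Y (act (inv (g \<otimes> h))) v"
    by (rule reindex_cong) (use assms in \<open>simp add: inv_mult_group composition_rule\<close>)
  finally show ?thesis by (simp add: \<Lambda>_eq_reindex)
qed

lemma \<Lambda>_one: assumes "v \<in> ell2_on Y" shows "\<Lambda> \<one> v = v"
proof -
  interpret group G by (rule group_G)
  have "act \<one> y = y" if "y \<in> Y" for y using fun_cong[OF id_eq_one, of y] that by simp
  then have "\<Lambda> \<one> v = reindex Y (\<lambda>y. y) v" unfolding \<Lambda>_eq_reindex by (intro reindex_cong) simp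
  then show ?thesis by (simp add: reindex_id assms)
qed

lemma \<Lambda>_inv_cancel:
  assumes "g \<in> carrier G" "v \<in> ell2_on Y"
  shows "\<Lambda> g (\<Lambda> (inv g) v) = v" "\<Lambda> (inv g) (\<Lambda> g v) = v"
proof -
  interpret group G by (rule group_G)
  show "\<Lambda> g (\<Lambda> (inv g) v) = v" "\<Lambda> (inv g) (\<Lambda> g v) = v"
    using assms by (simp_all add: \<Lambda>_mult \<Lambda>_one)
qed

lemma norm_\<Lambda>_diff:
  assumes "g \<in> carrier G" "u \<in> ell2_on Y" "v \<in> ell2_on Y"
  shows "norm (\<Lambda> g u - \<Lambda> g v) = norm (u - v)"
  using norm_\<Lambda>[OF assms(1) ell2_on_linear(5)[OF assms(2,3)]] by (simp add: \<Lambda>_linear(2)[OF assms(1)])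

lemma norm_\<Lambda>_inv_diff:
  assumes "g \<in> carrier G" "v \<in> ell2_on Y"
  shows "norm (\<Lambda> (inv g) v - v) = norm (\<Lambda> g v - v)"
proof -
  interpret group G by (rule group_G)
  have "norm (\<Lambda> (inv g) v - v) = norm (\<Lambda> g (\<Lambda> (inv g) v) - \<Lambda> g v)"
    by (rule norm_\<Lambda>_diff[symmetric]) (use assms \<Lambda>_linear(7) in simp_all)
  then show ?thesis by (simp add: \<Lambda>_inv_cancel[OF assms] norm_minus_commute)
qed

end

locale extension = weighted_sft X m F \<alpha> c + group G
  for X :: "(nat \<Rightarrow> 'a::finite) set" and m F \<alpha> c and G :: "('g, 'm) monoid_scheme" (structure) +
  fixes \<theta> :: "(nat \<Rightarrow> 'a) \<Rightarrow> 'g"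
  assumes \<theta>_closed: "x \<in> X \<Longrightarrow> \<theta> x \<in> carrier G"
    and \<theta>_agree: "\<lbrakk>x \<in> X; y \<in> X; agree m x y\<rbrakk> \<Longrightarrow> \<theta> x = \<theta> y"
begin

abbreviation "\<Theta> \<equiv> cocycle G \<theta>"

lemma \<Theta>_closed: "x \<in> X \<Longrightarrow> \<Theta> n x \<in> carrier G"
  by (induction n arbitrary: x) (simp_all add: \<theta>_closed shift_mem)

lemma \<Theta>_add: "x \<in> X \<Longrightarrow> \<Theta> (k + n) x = \<Theta> k x \<otimes> \<Theta> n ((shift ^^ k) x)"
  by (induction k arbitrary: x) (simp_all add: \<theta>_closed \<Theta>_closed shift_mem funpow_shift_mem m_assoc funpow_swap1)

lemma \<Theta>_agree: "\<lbrakk>x \<in> X; y \<in> X; agree (n + m) x y\<rbrakk> \<Longrightarrow> \<Theta> n x = \<Theta> n y"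
proof (induction n arbitrary: x y)
  case (Suc n)
  have "\<theta> x = \<theta> y" using \<theta>_agree Suc.prems agree_mono by (metis le_add2)
  moreover have "\<Theta> n (shift x) = \<Theta> n (shift y)"
    using Suc.prems agree_funpow_shift[of 1 "n + m" x y] by (intro Suc.IH) (simp_all add: shift_mem)
  ultimately show ?case by simp
qed simp

end

locale extension_rep = extension X m F \<alpha> c G \<theta> + permutation_rep G Y act
  for X :: "(nat \<Rightarrow> 'a::finite) set" and m F \<alpha> c and G :: "('g, 'm) monoid_scheme" (structure)
    and \<theta> and Y :: "'y set" and act
begin

sublocale twisted_transfer X m F \<alpha> c "ell2_on Y" "\<lambda>y. \<Lambda> (inv (\<theta> y))"
proof unfold_locales
  show "\<Lambda> (inv (\<theta> y)) = \<Lambda> (inv (\<theta> y'))" if "y \<in> X" "y' \<in> X" "agree m y y'" for y y'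
    using \<theta>_agree[OF that] by simp
  show "v \<in> ell2_on Y" if "\<And>n::nat. p n \<in> ell2_on Y" "p \<longlonglongrightarrow> v" for p v
    by (rule ell2_on_closed[OF that])
qed (simp_all add: ell2_on_linear \<theta>_closed \<Lambda>_linear norm_\<Lambda>_le)

lemma T_eq_twisted_transfer_op: "T = twisted_transfer_op X F G \<theta> Y act"
  by (rule ext)+ (simp add: T_def twisted_transfer_op_def pre_def)

text \<open>The vector \<open>|\<Phi>(x)| / (s h(x))\<close>, of norm at most \<open>1\<close> when \<open>s\<close> bounds \<open>\<parallel>\<Phi>\<parallel> / h\<close>.\<close>

definition profile :: "real \<Rightarrow> ((nat \<Rightarrow> 'a) \<Rightarrow> real) \<Rightarrow> ((nat \<Rightarrow> 'a) \<Rightarrow> 'y ell2) \<Rightarrow> (nat \<Rightarrow> 'a) \<Rightarrow> 'y ell2" where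
  "profile s h \<Phi> x = (1 / (s * h x)) *\<^sub>R modulus (\<Phi> x)"

text \<open>The normalised value \<open>\<Phi>(x) / (s h(x))\<close> agrees, up to the factor \<open>z / r\<close> and an error \<open>t\<close>, with the combination \<open>V\<close> of the vectors
  \<open>v y = \<lambda>(\<theta>(y))\<^sup>-\<^sup>1 \<Phi>(y) / (s h(y))\<close> with weights \<open>q y = F y h y / (r h x)\<close>, whose sum is at most \<open>1\<close>. Its norm is at
  least \<open>1 - 3 t\<close>, so uniform convexity forces \<open>v y\<close> to be close to \<open>V\<close>. The lower bound \<open>p\<close> on the weights enters
  because a vector of small weight is hardly constrained.\<close>

lemma profile_step:
  assumes h: "superharmonic r h" and r: "0 < r" and s: "0 < s"
    and bound: "\<And>x. x \<in> X \<Longrightarrow> norm (\<Phi> x) \<le> s * h x"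
    and x: "x \<in> X" and err: "norm (z *\<^sub>C \<Phi> x - T \<Phi> x) \<le> t * s * r * h x"
    and z: "(1 - t) * r \<le> cmod z" and t: "0 \<le> t" "3 * t \<le> 1"
    and big: "1 - t \<le> norm (profile s h \<Phi> x)"
    and y: "y \<in> pre x" and p: "0 < p" "p \<le> F y * h y / (r * h x)"
  shows "norm (\<Lambda> (inv (\<theta> y)) (profile s h \<Phi> y) - profile s h \<Phi> x) \<le> sqrt (6 * t / p) + 3 * t"
proof -
  define q where "q y = F y * h y / (r * h x)" for y
  define v where "v y = (1 / (s * h y)) *\<^sub>R \<Lambda> (inv (\<theta> y)) (\<Phi> y)" for y
  define V where "V = (\<Sum>y\<in>pre x. q y *\<^sub>R v y)"
  define W where "W = (1 / (s * h x)) *\<^sub>R \<Phi> x"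
  define \<zeta> where "\<zeta> = cmod z / r"
  have hpos: "0 < h w" if "w \<in> X" for w by (rule superharmonicD(3)[OF h that])
  have hx: "0 < h x" by (rule hpos[OF x])
  have yX: "y \<in> X" by (rule pre_mem[OF y])
  have normW: "norm W = norm (profile s h \<Phi> x)" by (simp add: W_def profile_def)
  have modW: "modulus W = profile s h \<Phi> x"
    using s hx by (simp add: W_def profile_def modulus_scaleR)
  have W1: "norm W \<le> 1" using bound[OF x] s hx by (simp add: W_def divide_le_eq)
  have \<zeta>: "1 - t \<le> \<zeta>" using z r by (simp add: \<zeta>_def le_divide_eq)
  have V_eq: "V = (1 / (s * r * h x)) *\<^sub>R T \<Phi> x"
    unfolding V_def T_def using x s r hx pre_mem hpos
    by (auto simp: scaleR_sum_right q_def v_def intro!: sum.cong) (metis less_irrefl)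
  have "V - (z / of_real r) *\<^sub>C W = (- 1 / (s * r * h x)) *\<^sub>R (z *\<^sub>C \<Phi> x - T \<Phi> x)"
    using s r hx by (simp add: V_eq W_def scaleC_diff_right scaleC_scaleC algebra_simps flip: scaleC_of_real)
  then have "norm (V - (z / of_real r) *\<^sub>C W) = norm (z *\<^sub>C \<Phi> x - T \<Phi> x) / (s * r * h x)"
    using s r hx by simp
  also have "\<dots> \<le> t" using err s r hx by (simp add: divide_le_eq mult_ac)
  finally have VW: "norm (V - (z / of_real r) *\<^sub>C W) \<le> t" .
  have norm_zW: "norm ((z / of_real r) *\<^sub>C W) = \<zeta> * norm W"
    using r by (simp add: norm_scaleC \<zeta>_def norm_divide)
  have Vge: "\<zeta> * norm W - t \<le> norm V" and Vle: "\<zeta> * norm W \<le> norm V + t"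
    using VW norm_triangle_ineq2[of "(z / of_real r) *\<^sub>C W" V] norm_zW by (auto simp: norm_minus_commute)
  have conv: "q y * (norm (v y - V))\<^sup>2 \<le> 1 - (norm V)\<^sup>2"
    unfolding V_def
  proof (rule uniformly_convex_average[OF finite_pre _ _ _ y])
    show "0 \<le> q w" if "w \<in> pre x" for w
      using F_pre_pos[OF that] hpos[OF pre_mem[OF that]] hx r by (simp add: q_def)
    have "(\<Sum>w\<in>pre x. q w) = L h x / (r * h x)" by (simp add: q_def L_def sum_divide_distrib)
    also have "\<dots> \<le> 1" using superharmonicD(2)[OF h x] r hx by (simp add: divide_le_eq)
    finally show "(\<Sum>w\<in>pre x. q w) \<le> 1" .
    show "norm (v w) \<le> 1" if "w \<in> pre x" for w
      using norm_\<Lambda>_le[of "inv (\<theta> w)" "\<Phi> w"] bound[OF pre_mem[OF that]] \<theta>_closed[OF pre_mem[OF that]]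
        s hpos[OF pre_mem[OF that]] by (simp add: v_def divide_le_eq)
  qed
  have qy: "p \<le> q y" using p(2) by (simp add: q_def)
  have "0 \<le> q y * (norm (v y - V))\<^sup>2" using qy p(1) by simp
  then have "(norm V)\<^sup>2 \<le> 1" using conv by linarith
  then have V1: "norm V \<le> 1" using power2_le_imp_le[of "norm V" 1] by simp
  have "(1 - t) * (1 - t) \<le> \<zeta> * norm W" using \<zeta> big t normW by (intro mult_mono) simp_all
  then have "1 - 3 * t \<le> norm V" using Vge t by (simp add: algebra_simps) (smt (verit) mult_nonneg_nonneg)
  then have "(1 - 3 * t)\<^sup>2 \<le> (norm V)\<^sup>2" using t by (intro power_mono) simp_all
  then have "1 - (norm V)\<^sup>2 \<le> 6 * t" by (simp add: power2_eq_square algebra_simps) (smt (verit) mult_nonneg_nonneg t)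
  moreover have "p * (norm (v y - V))\<^sup>2 \<le> q y * (norm (v y - V))\<^sup>2" using qy by (intro mult_right_mono) simp_all
  ultimately have "p * (norm (v y - V))\<^sup>2 \<le> 6 * t" using conv by linarith
  then have "(norm (v y - V))\<^sup>2 \<le> 6 * t / p" using p(1) by (simp add: le_divide_eq mult.commute)
  then have vV: "norm (v y - V) \<le> sqrt (6 * t / p)" by (rule real_le_rsqrt)
  have mod_v: "modulus (v y) = \<Lambda> (inv (\<theta> y)) (profile s h \<Phi> y)"
    using s hpos[OF yX] \<theta>_closed[OF yX]
    by (simp add: v_def profile_def modulus_scaleR \<Lambda>_linear)
  have mod_zW: "modulus ((z / of_real r) *\<^sub>C W) = \<zeta> *\<^sub>R profile s h \<Phi> x"
    using r by (simp add: modulus_scaleC modW \<zeta>_def norm_divide)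
  have "norm (\<zeta> *\<^sub>R profile s h \<Phi> x - profile s h \<Phi> x) = \<bar>\<zeta> - 1\<bar> * norm W"
    by (metis normW norm_scaleR scaleR_left_diff_distrib scaleR_one)
  also have "\<dots> \<le> 2 * t"
  proof (cases "1 \<le> \<zeta>")
    case True
    then show ?thesis using Vle V1 big normW by (simp add: algebra_simps)
  next
    case False
    then have "\<bar>\<zeta> - 1\<bar> * norm W \<le> t * 1" using \<zeta> W1 by (intro mult_mono) simp_all
    then show ?thesis using t by simp
  qed
  finally have sc: "norm (\<zeta> *\<^sub>R profile s h \<Phi> x - profile s h \<Phi> x) \<le> 2 * t" .
  have "norm (modulus (v y) - profile s h \<Phi> x)
      \<le> norm (modulus (v y) - modulus V) + norm (modulus V - \<zeta> *\<^sub>R profile s h \<Phi> x)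
        + norm (\<zeta> *\<^sub>R profile s h \<Phi> x - profile s h \<Phi> x)"
    by (smt (verit) norm_diff_triangle_ineq norm_triangle_ineq diff_add_cancel add_diff_eq)
  also have "\<dots> \<le> sqrt (6 * t / p) + t + 2 * t"
    using norm_modulus_diff_le[of "v y" V] vV norm_modulus_diff_le[of V "(z / of_real r) *\<^sub>C W"] VW sc
    unfolding mod_zW by linarith
  finally show ?thesis by (simp add: mod_v)
qed

end

section \<open>Vectors almost invariant under loops\<close>

text \<open>\<open>drift p t n\<close> bounds the distance of a profile from norm \<open>1\<close> after \<open>n\<close> steps backwards from a point where this distance is
  at most \<open>t\<close>: each step adds the error of \<open>profile_step\<close>.\<close>

primrec drift :: "real \<Rightarrow> real \<Rightarrow> nat \<Rightarrow> real" where
  "drift p t 0 = t"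
| "drift p t (Suc n) = drift p t n + (sqrt (6 * drift p t n / p) + 3 * drift p t n)"

lemma drift_nonneg: "\<lbrakk>0 < p; 0 \<le> t\<rbrakk> \<Longrightarrow> 0 \<le> drift p t n"
  by (induction n) simp_all

lemma drift_mono: assumes "0 < p" "0 \<le> t" "n \<le> k" shows "drift p t n \<le> drift p t k"
  using assms(3)
proof (induction k rule: dec_induct)
  case (step k)
  have "0 \<le> sqrt (6 * drift p t k / p)" using drift_nonneg[OF assms(1,2), of k] assms(1) by simp
  then show ?case unfolding drift.simps using step.IH drift_nonneg[OF assms(1,2), of k] by linarith
qed simp

lemma drift_tendsto_0: assumes "0 < p" shows "((\<lambda>t. drift p t n) \<longlongrightarrow> 0) (at_right 0)"
proof (induction n)
  case (Suc n)
  have "((\<lambda>t. drift p t n + (sqrt (6 * drift p t n / p) + 3 * drift p t n)) \<longlongrightarrow>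
      0 + (sqrt (6 * 0 / p) + 3 * 0)) (at_right 0)"
    using assms by (intro tendsto_intros Suc) simp_all
  then show ?case by simp
qed (simp add: tendsto_ident_at)

lemma drift_small:
  assumes "0 < p" "0 < e"
  obtains t where "0 < t" "\<And>k. k \<le> n \<Longrightarrow> drift p t k \<le> e"
proof -
  have "\<forall>\<^sub>F t in at_right 0. drift p t n < e"
    using order_tendstoD(2)[OF drift_tendsto_0[OF assms(1)] assms(2)] .
  moreover have "\<forall>\<^sub>F t in at_right (0::real). 0 < t" by (rule eventually_at_right_less)
  ultimately have "\<forall>\<^sub>F t in at_right 0. 0 < t \<and> drift p t n < e" by (rule eventually_conj[rotated])
  then obtain t where t: "0 < t" "drift p t n < e"
    using eventually_happens[of _ "at_right (0::real)"] trivial_limit_at_right_real by blast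
  then have "drift p t k \<le> e" if "k \<le> n" for k
    using drift_mono[OF assms(1) less_imp_le[OF t(1)] that] by linarith
  then show ?thesis using that t(1) by blast
qed

context extension_rep begin

context
  fixes r h \<Phi> s z t p
  assumes h: "superharmonic r h" and r: "0 < r" and s: "0 < s"
    and bound: "\<And>x. x \<in> X \<Longrightarrow> norm (\<Phi> x) \<le> s * h x"
    and err: "\<And>x. x \<in> X \<Longrightarrow> norm (z *\<^sub>C \<Phi> x - T \<Phi> x) \<le> t * s * r * h x"
    and z: "(1 - t) * r \<le> cmod z" and t: "0 < t" and p: "0 < p"
    and weight: "\<And>x y. x \<in> X \<Longrightarrow> y \<in> pre x \<Longrightarrow> p \<le> F y * h y / (r * h x)"
begin

text \<open>One induction carries both conclusions: the step needs the profile at \<open>\<sigma> y\<close> to have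
  almost full norm, and closeness to that profile gives the same for \<open>y\<close>.\<close>

lemma profile_chain:
  assumes x0: "x0 \<in> X" "1 - t \<le> norm (profile s h \<Phi> x0)" and \<Phi>: "\<And>x. x \<in> X \<Longrightarrow> \<Phi> x \<in> ell2_on Y"
    and n: "3 * drift p t n \<le> 1" and y: "y \<in> X" "(shift ^^ n) y = x0"
  shows "norm (\<Lambda> (inv (\<Theta> n y)) (profile s h \<Phi> y) - profile s h \<Phi> x0) \<le> drift p t n - t
    \<and> 1 - drift p t n \<le> norm (profile s h \<Phi> y)"
  using n y
proof (induction n arbitrary: y)
  case 0
  have "profile s h \<Phi> y \<in> ell2_on Y" using \<Phi>[OF 0(2)] by (simp add: profile_def ell2_on_linear)
  then show ?case using 0 x0(2) by (simp add: \<Lambda>_one)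
next
  case (Suc n)
  define d where "d = drift p t n"
  define g where "g = sqrt (6 * d / p) + 3 * d"
  define A where "A = profile s h \<Phi>"
  have td: "t \<le> d" using drift_mono[OF p less_imp_le[OF t], of 0 n] by (simp add: d_def)
  have g0: "0 \<le> g" using td t p by (simp add: g_def)
  have d3: "3 * d \<le> 1" using Suc.prems(1) g0 by (simp add: d_def[symmetric] g_def[symmetric])
  have y': "shift y \<in> X" "(shift ^^ n) (shift y) = x0" "y \<in> pre (shift y)"
    using Suc.prems by (simp_all add: shift_mem funpow_swap1 pre_def)
  have IH: "norm (\<Lambda> (inv (\<Theta> n (shift y))) (A (shift y)) - A x0) \<le> d - t" "1 - d \<le> norm (A (shift y))"
    using Suc.IH[OF _ y'(1,2)] d3 by (simp_all add: d_def A_def)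
  have hy: "0 < h (shift y)" by (rule superharmonicD(3)[OF h y'(1)])
  have step: "norm (\<Lambda> (inv (\<theta> y)) (A y) - A (shift y)) \<le> g"
    unfolding A_def g_def
  proof (rule profile_step[OF h r s bound y'(1)])
    have "t * s * r * h (shift y) \<le> d * s * r * h (shift y)"
      using td s r hy by (intro mult_right_mono) simp_all
    then show "norm (z *\<^sub>C \<Phi> (shift y) - T \<Phi> (shift y)) \<le> d * s * r * h (shift y)"
      using err[OF y'(1)] by linarith
    have "(1 - d) * r \<le> (1 - t) * r" using td r by (intro mult_right_mono) simp_all
    then show "(1 - d) * r \<le> cmod z" using z by linarith
    show "1 - d \<le> norm (profile s h \<Phi> (shift y))" using IH(2) by (simp add: A_def)
    show "p \<le> F y * h y / (r * h (shift y))" by (rule weight[OF y'(1,3)])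
  qed (use td t d3 p y'(3) in simp_all)
  define a where "a = inv (\<Theta> n (shift y))"
  have ac: "a \<in> carrier G" "\<theta> y \<in> carrier G" using \<Theta>_closed[OF y'(1)] \<theta>_closed[OF Suc.prems(2)] by (simp_all add: a_def)
  have "\<Lambda> (inv (\<Theta> (Suc n) y)) (A y) = \<Lambda> a (\<Lambda> (inv (\<theta> y)) (A y))"
    using ac \<Theta>_closed[OF y'(1)] by (simp add: \<Lambda>_mult a_def inv_mult_group)
  then have "\<Lambda> (inv (\<Theta> (Suc n) y)) (A y) - A x0
      = \<Lambda> a (\<Lambda> (inv (\<theta> y)) (A y) - A (shift y)) + (\<Lambda> a (A (shift y)) - A x0)"
    by (simp add: \<Lambda>_linear(2)[OF ac(1)])
  then have "norm (\<Lambda> (inv (\<Theta> (Suc n) y)) (A y) - A x0) \<le>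
      norm (\<Lambda> (inv (\<theta> y)) (A y) - A (shift y)) + norm (\<Lambda> a (A (shift y)) - A x0)"
    using norm_triangle_ineq[of "\<Lambda> a (\<Lambda> (inv (\<theta> y)) (A y) - A (shift y))" "\<Lambda> a (A (shift y)) - A x0"]
      norm_\<Lambda>_le[OF ac(1), of "\<Lambda> (inv (\<theta> y)) (A y) - A (shift y)"] by (simp only:)
  also have "\<dots> \<le> g + (d - t)" using step IH(1) by (simp add: a_def)
  finally have 1: "norm (\<Lambda> (inv (\<Theta> (Suc n) y)) (A y) - A x0) \<le> g + (d - t)" .
  have "norm (A (shift y)) - g \<le> norm (\<Lambda> (inv (\<theta> y)) (A y))"
    using step norm_triangle_ineq3[of "\<Lambda> (inv (\<theta> y)) (A y)" "A (shift y)"] by linarith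
  also have "\<dots> \<le> norm (A y)" using norm_\<Lambda>_le ac(2) by simp
  finally have 2: "1 - (d + g) \<le> norm (A y)" using IH(2) by linarith
  have "drift p t (Suc n) = d + g" by (simp add: d_def g_def)
  then show ?case using 1 2 unfolding A_def by linarith
qed

end

lemma profile_variation:
  assumes h: "superharmonic r h" and s: "0 < s"
    and bound: "\<And>x. x \<in> X \<Longrightarrow> norm (\<Phi> x) \<le> s * h x"
    and xy: "x \<in> X" "y \<in> X" "agree m x y"
    and var: "norm (\<Phi> x - \<Phi> y) \<le> holder_const * s * h x * hdist x y"
  shows "norm (profile s h \<Phi> x - profile s h \<Phi> y) \<le> (holder_const + \<kappa> * exp \<kappa>) * hdist x y"
proof -
  have hx: "0 < h x" and hy: "0 < h y" using superharmonicD(3)[OF h] xy by auto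
  have reg: "regular h" using h by (simp add: superharmonic_def)
  have "profile s h \<Phi> x - profile s h \<Phi> y = (1 / (s * h x)) *\<^sub>R (modulus (\<Phi> x) - modulus (\<Phi> y))
      + (1 / (s * h x) - 1 / (s * h y)) *\<^sub>R modulus (\<Phi> y)"
    by (simp add: profile_def algebra_simps)
  then have "norm (profile s h \<Phi> x - profile s h \<Phi> y) \<le>
      norm ((1 / (s * h x)) *\<^sub>R (modulus (\<Phi> x) - modulus (\<Phi> y)))
      + norm ((1 / (s * h x) - 1 / (s * h y)) *\<^sub>R modulus (\<Phi> y))"
    by (simp only: norm_triangle_ineq)
  also have "norm ((1 / (s * h x)) *\<^sub>R (modulus (\<Phi> x) - modulus (\<Phi> y))) \<le> holder_const * hdist x y"
  proof -
    have "norm (modulus (\<Phi> x) - modulus (\<Phi> y)) \<le> holder_const * s * h x * hdist x y"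
      using norm_modulus_diff_le[of "\<Phi> x" "\<Phi> y"] var by linarith
    then show ?thesis using s hx by (simp add: divide_le_eq mult_ac)
  qed
  also have "norm ((1 / (s * h x) - 1 / (s * h y)) *\<^sub>R modulus (\<Phi> y)) \<le> \<kappa> * exp \<kappa> * hdist x y"
  proof -
    have "1 / (s * h x) - 1 / (s * h y) = (h y - h x) / (s * h x * h y)"
      using s hx hy by (simp add: field_simps)
    then have "norm ((1 / (s * h x) - 1 / (s * h y)) *\<^sub>R modulus (\<Phi> y))
        = \<bar>h x - h y\<bar> / (s * h x * h y) * norm (\<Phi> y)"
      using s hx hy by (simp add: abs_minus_commute)
    also have "\<dots> \<le> \<bar>h x - h y\<bar> / (s * h x * h y) * (s * h y)"
      using bound[OF xy(2)] s hx hy by (intro mult_left_mono) simp_all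
    also have "\<dots> = \<bar>h x - h y\<bar> / h x" using s hx hy by (simp add: field_simps)
    also have "\<dots> \<le> \<kappa> * exp \<kappa> * hdist x y" using regular_diff[OF reg xy] hx by (simp add: divide_le_eq)
    finally show ?thesis .
  qed
  finally show ?thesis by (simp add: algebra_simps)
qed

end

context extension begin

text \<open>Let \<open>x0\<close> be a point where the profile \<open>A\<close> has norm almost \<open>1\<close>, let \<open>y0\<close> begin with \<open>w\<close> and lie over \<open>x0\<close>, and put
  \<open>v = A y0\<close>. A loop \<open>(y, n)\<close> can be prefixed to \<open>y0\<close>; the result \<open>y1\<close> also lies over \<open>x0\<close>, so
  \<open>A y1\<close> transported by \<open>\<theta>\<^sub>n(y)\<close> is close to \<open>A y0\<close>. It remains to compare \<open>A y1\<close> with \<open>A y0\<close>, which agree only in the word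
  \<open>w\<close>. For this both are extended backwards by the same word of length \<open>k\<close>: the profiles at the extensions \<open>q\<close> and \<open>q1\<close>
  are close by Hoelder continuity, and transporting them along the common word leads to \<open>A y0\<close> and \<open>A y1\<close>. The word \<open>w\<close> and
  with it the set of loops is fixed before \<open>\<epsilon>\<close>, while \<open>k\<close> may depend on \<open>\<epsilon>\<close>.\<close>

lemma almost_invariant_vector:
  fixes P :: "((nat \<Rightarrow> 'a) \<times> nat) set"
  assumes w: "w \<in> X" and P: "finite P"
    and loops: "\<And>y n. (y, n) \<in> P \<Longrightarrow> y \<in> X \<and> agree m w y \<and> agree m w ((shift ^^ n) y)"
    and \<epsilon>: "0 < \<epsilon>"
  obtains \<eta> where "0 < \<eta>" "\<eta> \<le> 1"
    "\<And>(Y :: 'y set) act. \<lbrakk>group_action G Y act;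
        (1 - \<eta>) * growth < twisted_transfer_radius \<alpha> X F G \<theta> Y act\<rbrakk>
      \<Longrightarrow> \<exists>v\<in>ell2_on Y. v \<noteq> 0 \<and> modulus v = v \<and>
           (\<forall>(y, n)\<in>P. norm (induced_rep G Y act (\<Theta> n y) v - v) \<le> \<epsilon> * norm v)"
proof -
  define R where "R = 2 * growth"
  have R: "0 < R" using growth_pos by (simp add: R_def)
  obtain D where D: "1 \<le> D"
    and D_ratio: "\<And>r h x y. \<lbrakk>0 < r; r \<le> R; superharmonic r h; x \<in> X; y \<in> X\<rbrakk> \<Longrightarrow> h x \<le> D * h y"
    using superharmonic_bounded_ratio[OF R] by blast
  obtain J where J: "\<And>x y. \<lbrakk>x \<in> X; y \<in> X\<rbrakk> \<Longrightarrow> \<exists>z\<in>X. \<exists>n\<le>J. agree m x z \<and> (shift ^^ n) z = y"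
    using connect_uniform by blast
  define p where "p = exp (- c) / (R * D)"
  have p: "0 < p" using R D by (simp add: p_def)
  \<comment> \<open>Seven errors of size \<open>e\<close> accumulate, and \<open>v\<close> has norm at least \<open>1 / 2\<close>.\<close>
  define e where "e = min (1 / 3) (\<epsilon> / 14)"
  have e: "0 < e" "3 * e \<le> 1" "14 * e \<le> \<epsilon>" using \<epsilon> by (simp_all add: e_def min_def)
  define B where "B = holder_const + \<kappa> * exp \<kappa>"
  have B0: "0 \<le> B" using twist_const_nonneg \<kappa>_nonneg \<alpha>_pos by (simp add: B_def holder_const_def)
  obtain k :: nat where k: "B * exp (- \<alpha> * k) \<le> e"
  proof -
    have "(\<lambda>k::nat. B * exp (- \<alpha>) ^ k) \<longlonglongrightarrow> B * 0"
      using \<alpha>_pos by (intro tendsto_intros LIMSEQ_realpow_zero) simp_all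
    then have "\<forall>\<^sub>F k::nat in sequentially. B * exp (- \<alpha>) ^ k < e" using e(1) order_tendstoD(2) by fastforce
    then obtain k :: nat where "B * exp (- \<alpha>) ^ k < e" using eventually_happens by fastforce
    then show ?thesis using that[of k] by (simp add: exp_of_nat_mult[symmetric] mult.commute less_imp_le)
  qed
  define M where "M = k + (Max (insert 0 (snd ` P)) + J)"
  obtain t where t: "0 < t" and drift_e: "\<And>j. j \<le> M \<Longrightarrow> drift p t j \<le> e"
    using drift_small[OF p e(1)] by blast
  define u where "u = (1 - exp (- \<alpha> / 2)) / 2"
  have u: "0 < u" "2 * u = 1 - exp (- \<alpha> / 2)" using \<alpha>_pos by (simp_all add: u_def)
  define \<eta> where "\<eta> = min (t / 2) (min u 1)"
  have \<eta>: "0 < \<eta>" "\<eta> \<le> 1" "2 * \<eta> \<le> t" "2 * \<eta> \<le> 1 - exp (- \<alpha> / 2)"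
    using t u(1) unfolding u(2)[symmetric] by (auto simp: \<eta>_def min_def)
  show ?thesis
  proof (rule that[OF \<eta>(1,2)])
    fix Y :: "'y set" and act
    assume ga: "group_action G Y act"
      and radius: "(1 - \<eta>) * growth < twisted_transfer_radius \<alpha> X F G \<theta> Y act"
    interpret er: extension_rep X m F \<alpha> c G \<theta> Y act
      by (intro extension_rep.intro permutation_rep.intro extension_axioms ga)
    obtain z where z: "(1 - \<eta>) * growth < cmod z"
      and approx: "\<And>\<tau>. 0 < \<tau> \<Longrightarrow> \<exists>\<Phi>\<in>er.H. er.N (\<lambda>x. z *\<^sub>C \<Phi> x - er.T \<Phi> x) < \<tau> * er.N \<Phi>"
      using er.approximate_eigenvalue_above[of "(1 - \<eta>) * growth"] radius \<eta>(2) growth_pos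
      unfolding er.T_eq_twisted_transfer_op by auto
    \<comment> \<open>Since \<open>(1 - \<eta>) / (1 + \<eta>) \<ge> 1 - 2 \<eta>\<close>, the quotient \<open>|z| / r\<close> is at least \<open>1 - t\<close> and \<open>e\<^sup>-\<^sup>\<alpha>\<^sup>/\<^sup>2\<close>.\<close>
    define r where "r = (1 + \<eta>) * growth"
    have r: "growth < r" "0 < r" "r \<le> R"
      using growth_pos \<eta> by (simp_all add: r_def R_def add_pos_pos)
    note adm = green_finite_above_growth[OF r(1)]
    define h where "h = green r"
    have h: "superharmonic r h" unfolding h_def by (rule superharmonic_green[OF adm])
    obtain hB where hB: "\<And>x. x \<in> X \<Longrightarrow> h x \<le> hB" using green_bounded[OF adm] unfolding h_def by blast
    have "(1 - 2 * \<eta>) * r \<le> (1 - \<eta>) * growth"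
    proof -
      have "(1 - 2 * \<eta>) * (1 + \<eta>) \<le> 1 - \<eta>" using \<eta>(1) by (simp add: algebra_simps)
      then have "(1 - 2 * \<eta>) * (1 + \<eta>) * growth \<le> (1 - \<eta>) * growth"
        using growth_pos by (intro mult_right_mono) simp_all
      then show ?thesis by (simp add: r_def mult.assoc)
    qed
    then have zr: "(1 - 2 * \<eta>) * r \<le> cmod z" using z by linarith
    have zt: "(1 - t) * r \<le> cmod z"
      using mult_right_mono[of "1 - t" "1 - 2 * \<eta>" r] \<eta>(3) r(2) zr by linarith
    have z\<alpha>: "r * exp (- \<alpha> / 2) \<le> cmod z"
    proof -
      have "r * exp (- \<alpha> / 2) \<le> r * (1 - 2 * \<eta>)" using \<eta>(4) r(2) by (intro mult_left_mono) simp_all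
      then show ?thesis using zr by (simp only: mult.commute[of r])
    qed
    obtain \<Phi> s x0 where \<Phi>: "\<Phi> \<in> er.H" and s: "0 < s" and x0: "x0 \<in> X" "(1 - t) * s * h x0 \<le> norm (\<Phi> x0)"
      and bound: "\<And>x. x \<in> X \<Longrightarrow> norm (\<Phi> x) \<le> s * h x"
      and err: "\<And>x. x \<in> X \<Longrightarrow> norm (z *\<^sub>C \<Phi> x - er.T \<Phi> x) \<le> t * s * r * h x"
      and var: "\<And>x y. \<lbrakk>x \<in> X; y \<in> X; agree m x y\<rbrakk> \<Longrightarrow> norm (\<Phi> x - \<Phi> y) \<le> holder_const * s * h x * hdist x y"
      using er.normalised_approximate_eigenvector[OF h r(2) hB z\<alpha> approx t] by blast
    define A where "A = er.profile s h \<Phi>"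
    have hpos: "0 < h x" if "x \<in> X" for x by (rule superharmonicD(3)[OF h that])
    have \<Phi>Y: "\<Phi> x \<in> ell2_on Y" if "x \<in> X" for x using er.holder_mem(1)[OF \<Phi> that] .
    have AY: "A x \<in> ell2_on Y" if "x \<in> X" for x
      using \<Phi>Y[OF that] by (simp add: A_def er.profile_def ell2_on_linear)
    have weight: "p \<le> F y * h y / (r * h x)" if x: "x \<in> X" and y: "y \<in> pre x" for x y
    proof -
      have yX: "y \<in> X" by (rule pre_mem[OF y])
      have "p = exp (- c) * h y / (R * (D * h y))" using hpos[OF yX] by (simp add: p_def)
      also have "\<dots> \<le> F y * h y / (r * h x)"
      proof (rule frac_le)
        show "exp (- c) * h y \<le> F y * h y"
          using F_bounds(1)[OF yX] hpos[OF yX] by (intro mult_right_mono) simp_all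
        show "r * h x \<le> R * (D * h y)"
          using D_ratio[OF r(2,3) h x yX] r R hpos[OF x] by (intro mult_mono) simp_all
      qed (use F_pos[OF yX] hpos[OF yX] hpos[OF x] r(2) in simp_all)
      finally show ?thesis .
    qed
    have Ax0: "1 - t \<le> norm (A x0)"
      using x0(2) s hpos[OF x0(1)] by (simp add: A_def er.profile_def le_divide_eq mult.assoc)
    have chain: "norm (er.\<Lambda> (inv (\<Theta> n y)) (A y) - A x0) \<le> e \<and> 1 - e \<le> norm (A y)"
      if "n \<le> M" "y \<in> X" "(shift ^^ n) y = x0" for n y
      using er.profile_chain[OF h r(2) s bound err zt t p weight x0(1) Ax0[unfolded A_def] \<Phi>Y _ that(2,3)]
        drift_e[OF that(1)] e(2) t unfolding A_def by fastforce
    have close: "norm (A a - A b) \<le> e" if "a \<in> X" "b \<in> X" "agree (k + m) a b" for a b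
    proof -
      have ag: "agree m a b" using agree_mono[OF that(3)] by simp
      have "norm (A a - A b) \<le> B * hdist a b"
        unfolding A_def B_def by (rule er.profile_variation[OF h s bound that(1,2) ag var[OF that(1,2) ag]])
      also have "\<dots> \<le> B * exp (- \<alpha> * k)"
        using hdist_le[OF agree_mono[OF that(3)], of k] B0 by (intro mult_left_mono) simp_all
      finally show ?thesis using k by linarith
    qed
    obtain y0 n0 where y0: "y0 \<in> X" "n0 \<le> J" "agree m w y0" "(shift ^^ n0) y0 = x0" using J[OF w x0(1)] by blast
    obtain q where q: "q \<in> X" "(shift ^^ k) q = y0" using funpow_shift_surj[OF y0(1)] by blast
    have transport: "norm (er.\<Lambda> (inv (\<Theta> j x)) (A x) - A ((shift ^^ j) x)) \<le> 2 * e"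
      if x: "x \<in> X" and n: "(shift ^^ n) ((shift ^^ j) x) = x0" "j + n \<le> M" for x j n
    proof -
      define y where "y = (shift ^^ j) x"
      define g where "g = inv (\<Theta> n y)"
      have yX: "y \<in> X" unfolding y_def by (rule funpow_shift_mem[OF x])
      have gc: "g \<in> carrier G" using \<Theta>_closed[OF yX] by (simp add: g_def)
      have \<Theta>c: "\<Theta> j x \<in> carrier G" "\<Theta> n y \<in> carrier G" using \<Theta>_closed x yX by auto
      have "(shift ^^ (j + n)) x = x0" using n(1) by (simp add: funpow_add add.commute[of j n])
      then have "norm (er.\<Lambda> (inv (\<Theta> (j + n) x)) (A x) - A x0) \<le> e" using chain[OF n(2) x] by blast
      moreover have "er.\<Lambda> (inv (\<Theta> (j + n) x)) (A x) = er.\<Lambda> g (er.\<Lambda> (inv (\<Theta> j x)) (A x))"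
        using \<Theta>_add[OF x, of j n] \<Theta>c by (simp add: er.\<Lambda>_mult g_def inv_mult_group y_def)
      moreover have "norm (er.\<Lambda> g (A y) - A x0) \<le> e"
        using chain[of n y] n yX unfolding g_def y_def by simp
      ultimately have "norm (er.\<Lambda> g (er.\<Lambda> (inv (\<Theta> j x)) (A x)) - er.\<Lambda> g (A y)) \<le> 2 * e"
        using norm_triangle_ineq4[of "er.\<Lambda> g (er.\<Lambda> (inv (\<Theta> j x)) (A x)) - A x0" "er.\<Lambda> g (A y) - A x0"]
        by simp
      moreover have "er.\<Lambda> (inv (\<Theta> j x)) (A x) \<in> ell2_on Y" using er.\<Lambda>_linear(7) \<Theta>c by simp
      ultimately show ?thesis using er.norm_\<Lambda>_diff[OF gc _ AY[OF yX]] unfolding y_def by simp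
    qed
    define v where "v = A y0"
    have vY: "v \<in> ell2_on Y" unfolding v_def by (rule AY[OF y0(1)])
    have norm_v: "1 / 2 \<le> norm v"
      using chain[OF _ y0(1,4)] y0(2) e(2) unfolding v_def M_def by fastforce
    have inv_v: "norm (er.\<Lambda> (\<Theta> n y) v - v) \<le> \<epsilon> * norm v" if yn: "(y, n) \<in> P" for y n
    proof -
      have y: "y \<in> X" "agree m w y" "agree m w ((shift ^^ n) y)" using loops[OF yn] by auto
      have "n \<le> Max (insert 0 (snd ` P))" using P yn by (intro Max_ge) force+
      then have nM: "k + (n + n0) \<le> M" using y0(2) by (simp add: M_def)
      have ag0: "agree m ((shift ^^ n) y) y0" using agree_trans[OF agree_sym[OF y(3)] y0(3)] .
      define y1 where "y1 = graft n y y0"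
      have y1: "y1 \<in> X" "(shift ^^ n) y1 = y0" unfolding y1_def by (simp_all add: graft_mem[OF y(1) y0(1) ag0])
      have ag1: "agree (n + m) y y1" unfolding y1_def by (rule agree_graft_overlap[OF ag0])
      have \<Theta>y1: "\<Theta> n y1 = \<Theta> n y" by (rule \<Theta>_agree[OF y(1) y1(1) ag1, symmetric])
      have "agree m y y1" by (rule agree_mono[OF ag1]) simp
      then have ag01: "agree m y0 y1" using y0(3) y(2) agree_sym agree_trans by blast
      define q1 where "q1 = graft k q y1"
      have q1: "q1 \<in> X" "(shift ^^ k) q1 = y1"
        unfolding q1_def using graft_mem[OF q(1) y1(1)] q(2) ag01 by simp_all
      have ag_q: "agree (k + m) q q1" unfolding q1_def by (rule agree_graft_overlap) (simp add: q(2) ag01)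
      have \<Theta>q1: "\<Theta> k q1 = \<Theta> k q" by (rule \<Theta>_agree[OF q(1) q1(1) ag_q, symmetric])
      define g where "g = inv (\<Theta> k q)"
      have gc: "g \<in> carrier G" and yc: "\<Theta> n y \<in> carrier G" using \<Theta>_closed q(1) y(1) by (simp_all add: g_def)
      have 1: "norm (er.\<Lambda> g (A q) - A y0) \<le> 2 * e"
        using transport[OF q(1), of n0 k] y0(4) nM unfolding q(2) g_def by simp
      have 2: "norm (er.\<Lambda> g (A q1) - A y1) \<le> 2 * e"
        using transport[OF q1(1), of "n + n0" k] y1(2) y0(4) nM
        unfolding q1(2) \<Theta>q1 g_def by (simp add: funpow_add add.commute[of n n0])
      have 3: "norm (er.\<Lambda> (inv (\<Theta> n y)) (A y1) - A y0) \<le> 2 * e"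
        using transport[OF y1(1), of n0 n] y0(4) nM unfolding y1(2) \<Theta>y1 by simp
      have 4: "norm (er.\<Lambda> g (A q) - er.\<Lambda> g (A q1)) \<le> e"
        using close[OF q(1) q1(1) ag_q] er.norm_\<Lambda>_diff[OF gc AY[OF q(1)] AY[OF q1(1)]] by simp
      have "norm (A y0 - A y1) \<le> 5 * e" using 1 2 4 by norm
      then have "norm (er.\<Lambda> (inv (\<Theta> n y)) (A y0) - er.\<Lambda> (inv (\<Theta> n y)) (A y1)) \<le> 5 * e"
        using er.norm_\<Lambda>_diff[of "inv (\<Theta> n y)"] yc AY y0(1) y1(1) by simp
      then have "norm (er.\<Lambda> (inv (\<Theta> n y)) v - v) \<le> 7 * e" using 3 unfolding v_def by norm
      then have "norm (er.\<Lambda> (\<Theta> n y) v - v) \<le> 7 * e" using er.norm_\<Lambda>_inv_diff[OF yc vY] by simp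
      also have "\<dots> \<le> \<epsilon> * (1 / 2)" using e(3) by simp
      also have "\<dots> \<le> \<epsilon> * norm v" using norm_v \<epsilon> by (intro mult_left_mono) simp_all
      finally show ?thesis .
    qed
    show "\<exists>v\<in>ell2_on Y. v \<noteq> 0 \<and> modulus v = v \<and>
           (\<forall>(y, n)\<in>P. norm (induced_rep G Y act (\<Theta> n y) v - v) \<le> \<epsilon> * norm v)"
    proof (intro bexI[OF _ vY] conjI)
      show "v \<noteq> 0" using norm_v by auto
      have "modulus (modulus f) = modulus f" for f :: "'y ell2" by (rule ell2_eqI) (simp add: modulus.rep_eq)
      then show "modulus v = v"
        using s hpos[OF y0(1)] by (simp add: v_def A_def er.profile_def modulus_scaleR)
      show "\<forall>(y, n)\<in>P. norm (induced_rep G Y act (\<Theta> n y) v - v) \<le> \<epsilon> * norm v" using inv_v by auto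
    qed
  qed
qed

end

section \<open>From loops to the whole group\<close>

context group begin

text \<open>The quantification over all \<open>G\<close>-sets expresses that \<open>P\<close> and \<open>n\<close> do not depend on the action.\<close>

definition displacement_bound :: "'y itself \<Rightarrow> 'a set \<Rightarrow> nat \<Rightarrow> 'a \<Rightarrow> bool" where
  "displacement_bound (_ :: 'y itself) P n h \<longleftrightarrow>
     (\<forall>(Y :: 'y set) act v k. group_action G Y act \<longrightarrow> v \<in> ell2_on Y \<longrightarrow>
        (\<forall>g\<in>P. norm (induced_rep G Y act g v - v) \<le> k) \<longrightarrow>
        norm (induced_rep G Y act h v - v) \<le> real n * k)"

lemma displacement_boundD:
  fixes Y :: "'y set"
  assumes "displacement_bound TYPE('y) P n h" "group_action G Y act" "v \<in> ell2_on Y"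
    and "\<And>g. g \<in> P \<Longrightarrow> norm (induced_rep G Y act g v - v) \<le> k"
  shows "norm (induced_rep G Y act h v - v) \<le> real n * k"
  using assms unfolding displacement_bound_def by blast

lemma generated_displacement:
  assumes "A \<subseteq> carrier G" "h \<in> generate G A"
  shows "\<exists>P n. finite P \<and> P \<subseteq> A \<and> displacement_bound TYPE('y) P n h"
  using assms(2)
proof (induction rule: generate.induct)
  case one
  have "norm (induced_rep G Y act \<one> v - v) = 0"
    if "group_action G Y act" "v \<in> ell2_on Y" for Y :: "'y set" and act v
    using permutation_rep.\<Lambda>_one[OF permutation_rep.intro[OF that(1)] that(2)] by simp
  then have "displacement_bound TYPE('y) {} 0 \<one>" by (simp add: displacement_bound_def)
  then show ?case by blast
next
  case (incl h)
  have "displacement_bound TYPE('y) {h} 1 h" by (simp add: displacement_bound_def)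
  then show ?case using incl by blast
next
  case (inv h)
  have "norm (induced_rep G Y act (inv h) v - v) = norm (induced_rep G Y act h v - v)"
    if "group_action G Y act" "v \<in> ell2_on Y" for Y :: "'y set" and act v
    using permutation_rep.norm_\<Lambda>_inv_diff[OF permutation_rep.intro[OF that(1)] _ that(2)] inv assms(1) by blast
  then have "displacement_bound TYPE('y) {h} 1 (inv h)" by (simp add: displacement_bound_def)
  then show ?case using inv by blast
next
  case (eng h1 h2)
  obtain P1 n1 where P1: "finite P1" "P1 \<subseteq> A" "displacement_bound TYPE('y) P1 n1 h1" using eng.IH(1) by blast
  obtain P2 n2 where P2: "finite P2" "P2 \<subseteq> A" "displacement_bound TYPE('y) P2 n2 h2" using eng.IH(2) by blast
  have hc: "h1 \<in> carrier G" "h2 \<in> carrier G" using generate_in_carrier[OF assms(1)] eng.hyps by auto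
  have "displacement_bound TYPE('y) (P1 \<union> P2) (n1 + n2) (h1 \<otimes> h2)"
    unfolding displacement_bound_def
  proof (intro allI impI)
    fix Y :: "'y set" and act v k
    assume ga: "group_action G Y act" and v: "v \<in> ell2_on Y"
      and k: "\<forall>g\<in>P1 \<union> P2. norm (induced_rep G Y act g v - v) \<le> k"
    interpret permutation_rep G Y act using ga by (rule permutation_rep.intro)
    have "\<Lambda> (h1 \<otimes> h2) v - v = \<Lambda> h1 (\<Lambda> h2 v - v) + (\<Lambda> h1 v - v)"
      using hc by (simp add: \<Lambda>_linear(2) \<Lambda>_mult)
    then have "norm (\<Lambda> (h1 \<otimes> h2) v - v) \<le> norm (\<Lambda> h1 (\<Lambda> h2 v - v)) + norm (\<Lambda> h1 v - v)"
      by (simp only: norm_triangle_ineq)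
    also have "\<dots> \<le> norm (\<Lambda> h2 v - v) + norm (\<Lambda> h1 v - v)" using norm_\<Lambda>_le[OF hc(1)] by simp
    also have "\<dots> \<le> real n2 * k + real n1 * k"
      using displacement_boundD[OF P1(3) ga v, of k] displacement_boundD[OF P2(3) ga v, of k] k
      by (intro add_mono) simp_all
    finally show "norm (\<Lambda> (h1 \<otimes> h2) v - v) \<le> real (n1 + n2) * k" by (simp add: algebra_simps)
  qed
  then show ?case using P1(1,2) P2(1,2) by (intro exI[of _ "P1 \<union> P2"] exI[of _ "n1 + n2"]) simp
qed

end

context permutation_rep begin

text \<open>The translates have nonnegative coordinates, so nothing cancels in their sum.\<close>

lemma norm_le_sum_translates:
  assumes R: "finite R" "R \<subseteq> carrier G" "R \<noteq> {}" and v: "v \<in> ell2_on Y" "modulus v = v"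
  shows "norm v \<le> norm (\<Sum>t\<in>R. \<Lambda> t v)"
proof -
  obtain t0 where t0: "t0 \<in> R" using R(3) by blast
  have pos: "Rep_ell2 (\<Lambda> t v) y = of_real (cmod (Rep_ell2 (\<Lambda> t v) y))" if "t \<in> R" for t y
  proof -
    have "modulus (\<Lambda> t v) = \<Lambda> t v" using \<Lambda>_linear(6)[of t v] that R(2) v(2) by auto
    then have "Rep_ell2 (modulus (\<Lambda> t v)) y = Rep_ell2 (\<Lambda> t v) y" by simp
    then show ?thesis by (simp add: modulus.rep_eq)
  qed
  have "norm v = norm (\<Lambda> t0 v)" using norm_\<Lambda>[OF _ v(1)] t0 R(2) by auto
  also have "\<dots> \<le> norm (\<Sum>t\<in>R. \<Lambda> t v)"
  proof (rule ell2_norm_mono)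
    fix y
    have "Rep_ell2 (\<Sum>t\<in>R. \<Lambda> t v) y = of_real (\<Sum>t\<in>R. cmod (Rep_ell2 (\<Lambda> t v) y))"
      unfolding Rep_ell2_sum of_real_sum by (rule sum.cong[OF refl pos])
    then have "cmod (Rep_ell2 (\<Sum>t\<in>R. \<Lambda> t v) y) = (\<Sum>t\<in>R. cmod (Rep_ell2 (\<Lambda> t v) y))"
      by (simp add: sum_nonneg del: of_real_sum)
    then show "cmod (Rep_ell2 (\<Lambda> t0 v) y) \<le> cmod (Rep_ell2 (\<Sum>t\<in>R. \<Lambda> t v) y)"
      using member_le_sum[OF t0, of "\<lambda>t. cmod (Rep_ell2 (\<Lambda> t v) y)"] R(1) by simp
  qed
  finally show ?thesis .
qed

text \<open>Multiplication by \<open>s\<close> permutes the cosets \<open>t H\<close>, so \<open>s t = \<pi> t h\<close> with a permutation \<open>\<pi>\<close> of the transversal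
  and \<open>h \<in> H\<close>; replacing \<open>\<lambda>(h) v\<close> by \<open>v\<close> costs at most \<open>k\<close> for each \<open>t\<close>.\<close>

lemma sum_translates_almost_invariant:
  fixes k :: real
  assumes H: "subgroup H G" and R: "finite R" "R \<subseteq> carrier G"
    "\<And>g. g \<in> carrier G \<Longrightarrow> \<exists>t\<in>R. inv t \<otimes> g \<in> H"
    "\<And>t t'. \<lbrakk>t \<in> R; t' \<in> R; inv t \<otimes> t' \<in> H\<rbrakk> \<Longrightarrow> t = t'"
    and s: "s \<in> carrier G"
    and k: "\<And>t t'. \<lbrakk>t \<in> R; t' \<in> R; inv t' \<otimes> (s \<otimes> t) \<in> H\<rbrakk> \<Longrightarrow> norm (\<Lambda> (inv t' \<otimes> (s \<otimes> t)) v - v) \<le> k"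
  shows "norm (\<Lambda> s (\<Sum>t\<in>R. \<Lambda> t v) - (\<Sum>t\<in>R. \<Lambda> t v)) \<le> card R * k"
proof -
  interpret group G by (rule group_G)
  interpret H: subgroup H G by fact
  have "\<exists>t'\<in>R. inv t' \<otimes> (s \<otimes> t) \<in> H" if "t \<in> R" for t using R(2,3) s that by blast
  then obtain \<pi> where \<pi>: "\<And>t. t \<in> R \<Longrightarrow> \<pi> t \<in> R \<and> inv (\<pi> t) \<otimes> (s \<otimes> t) \<in> H" by metis
  have "inj_on \<pi> R"
  proof (rule inj_onI)
    fix t1 t2 assume t: "t1 \<in> R" "t2 \<in> R" "\<pi> t1 = \<pi> t2"
    define t' where "t' = \<pi> t2"
    have c: "t1 \<in> carrier G" "t2 \<in> carrier G" "t' \<in> carrier G" using t \<pi> R(2) by (auto simp: t'_def)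
    have m: "inv t' \<otimes> (s \<otimes> t1) \<in> H" "inv t' \<otimes> (s \<otimes> t2) \<in> H" using \<pi>[OF t(1)] \<pi>[OF t(2)] t(3) by (simp_all add: t'_def)
    have "inv (inv t' \<otimes> (s \<otimes> t1)) \<otimes> (inv t' \<otimes> (s \<otimes> t2)) = inv t1 \<otimes> t2"
      using c s by (simp add: inv_mult_group m_assoc inv_cancel_left)
    then have "inv t1 \<otimes> t2 \<in> H" using H.m_closed[OF H.m_inv_closed[OF m(1)] m(2)] by simp
    then show "t1 = t2" by (rule R(4)[OF t(1,2)])
  qed
  moreover have "\<pi> ` R \<subseteq> R" using \<pi> by blast
  ultimately have bij: "bij_betw \<pi> R R" using endo_inj_surj[OF R(1)] by (auto simp: bij_betw_def)
  have eq: "\<Lambda> s (\<Lambda> t v) = \<Lambda> (\<pi> t) (\<Lambda> (inv (\<pi> t) \<otimes> (s \<otimes> t)) v)" if t: "t \<in> R" for t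
  proof -
    have c: "t \<in> carrier G" "\<pi> t \<in> carrier G" using t \<pi>[OF t] R(2) by auto
    then show ?thesis using s by (simp add: \<Lambda>_mult inv_cancel_left)
  qed
  have "\<Lambda> s (\<Sum>t\<in>R. \<Lambda> t v) = (\<Sum>t\<in>R. \<Lambda> (\<pi> t) (\<Lambda> (inv (\<pi> t) \<otimes> (s \<otimes> t)) v))"
    unfolding \<Lambda>_sum[OF s] by (rule sum.cong[OF refl eq])
  moreover have "(\<Sum>t\<in>R. \<Lambda> t v) = (\<Sum>t\<in>R. \<Lambda> (\<pi> t) v)"
    by (rule sum.reindex_bij_betw[OF bij, of "\<lambda>t. \<Lambda> t v", symmetric])
  ultimately have "\<Lambda> s (\<Sum>t\<in>R. \<Lambda> t v) - (\<Sum>t\<in>R. \<Lambda> t v)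
      = (\<Sum>t\<in>R. \<Lambda> (\<pi> t) (\<Lambda> (inv (\<pi> t) \<otimes> (s \<otimes> t)) v) - \<Lambda> (\<pi> t) v)"
    by (simp only: sum_subtractf)
  also have "norm \<dots> \<le> (\<Sum>t\<in>R. k)"
  proof (rule sum_norm_le)
    fix t assume t: "t \<in> R"
    have c: "\<pi> t \<in> carrier G" using \<pi>[OF t] R(2) by auto
    have "norm (\<Lambda> (\<pi> t) (\<Lambda> (inv (\<pi> t) \<otimes> (s \<otimes> t)) v) - \<Lambda> (\<pi> t) v)
        \<le> norm (\<Lambda> (inv (\<pi> t) \<otimes> (s \<otimes> t)) v - v)"
      using norm_\<Lambda>_le[OF c] by (simp flip: \<Lambda>_linear(2)[OF c])
    also have "\<dots> \<le> k" using k[OF t] \<pi>[OF t] by blast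
    finally show "norm (\<Lambda> (\<pi> t) (\<Lambda> (inv (\<pi> t) \<otimes> (s \<otimes> t)) v) - \<Lambda> (\<pi> t) v) \<le> k" .
  qed
  finally show ?thesis by simp
qed

end

context extension begin

definition loops :: "(nat \<Rightarrow> 'a) \<Rightarrow> ((nat \<Rightarrow> 'a) \<times> nat) set" where
  "loops w = {(y, n). y \<in> X \<and> agree m w y \<and> agree m w ((shift ^^ n) y)}"

definition holonomy :: "(nat \<Rightarrow> 'a) \<Rightarrow> 'g set" where
  "holonomy w = (\<lambda>(y, n). \<Theta> n y) ` loops w"

lemma holonomy_closed: "holonomy w \<subseteq> carrier G"
  by (auto simp: holonomy_def loops_def \<Theta>_closed)

lemma finite_range_\<Theta>: "finite (\<Theta> n ` X)"
proof -
  define f where "f u = \<Theta> n (SOME x. x \<in> X \<and> map x [0..<n + m] = u)" for u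
  have "\<Theta> n ` X \<subseteq> f ` {u. set u \<subseteq> UNIV \<and> length u = n + m}"
  proof
    fix g assume "g \<in> \<Theta> n ` X"
    then obtain x where x: "x \<in> X" "g = \<Theta> n x" by blast
    define x' where "x' = (SOME x'. x' \<in> X \<and> map x' [0..<n + m] = map x [0..<n + m])"
    have x': "x' \<in> X \<and> map x' [0..<n + m] = map x [0..<n + m]"
      unfolding x'_def by (rule someI[of _ x]) (use x in blast)
    have "agree (n + m) x x'"
      unfolding agree_def
    proof (intro allI impI)
      fix i assume "i < n + m"
      then show "x i = x' i" using arg_cong[OF conjunct2[OF x'], of "\<lambda>u. u ! i"] by simp
    qed
    then have "g = \<Theta> n x'" using \<Theta>_agree[OF x(1) conjunct1[OF x']] x(2) by simp
    then have "g = f (map x [0..<n + m])" unfolding f_def x'_def .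
    then show "g \<in> f ` {u. set u \<subseteq> UNIV \<and> length u = n + m}" by (rule image_eqI) simp
  qed
  moreover have "finite (f ` {u. set u \<subseteq> UNIV \<and> length u = n + m})"
    by (rule finite_imageI[OF finite_lists_length_eq[OF finite]])
  ultimately show ?thesis by (rule finite_subset)
qed

text \<open>An orbit segment of \<open>x\<close> of length \<open>n\<close> is completed to a loop at \<open>w\<close> by connecting segments of length at
  most \<open>J\<close> on both sides. Their contributions to the cocycle range over a finite set and are moved into \<open>U\<close>.\<close>

lemma visibility_cover:
  assumes vis: "visibility X G \<theta>" and w: "w \<in> X"
  obtains U where "finite U" "U \<subseteq> carrier G"
    "\<And>g. g \<in> carrier G \<Longrightarrow> \<exists>u\<in>U. \<exists>h\<in>holonomy w. \<exists>u'\<in>U. g = u \<otimes> h \<otimes> u'"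
proof -
  obtain V where V: "finite V" "V \<subseteq> carrier G"
    and cover: "\<forall>g\<in>carrier G. \<exists>x\<in>X. \<exists>n. \<exists>u1\<in>V. \<exists>u2\<in>V. g = u1 \<otimes> \<Theta> n x \<otimes> u2"
    using vis unfolding visibility_def by (elim exE conjE) (rule that)
  obtain J where J: "\<And>x y. \<lbrakk>x \<in> X; y \<in> X\<rbrakk> \<Longrightarrow> \<exists>z\<in>X. \<exists>n\<le>J. agree m x z \<and> (shift ^^ n) z = y"
    using connect_uniform by blast
  define A where "A = (\<Union>n\<le>J. \<Theta> n ` X)"
  have A: "finite A" "A \<subseteq> carrier G" using finite_range_\<Theta> \<Theta>_closed by (auto simp: A_def)
  define U where "U = (\<lambda>(u, a). u \<otimes> inv a) ` (V \<times> A) \<union> (\<lambda>(b, u). inv b \<otimes> u) ` (A \<times> V)"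
  show ?thesis
  proof (rule that)
    show "finite U" using V A by (simp add: U_def)
    show "U \<subseteq> carrier G" using V A by (auto simp: U_def)
    fix g assume "g \<in> carrier G"
    from bspec[OF cover this]
    obtain x n u1 u2 where x: "x \<in> X" and u: "u1 \<in> V" "u2 \<in> V" and g: "g = u1 \<otimes> \<Theta> n x \<otimes> u2"
      by (elim bexE exE) (rule that)
    obtain z k where z: "z \<in> X" "k \<le> J" "agree m ((shift ^^ n) x) z" "(shift ^^ k) z = w"
      using J[OF funpow_shift_mem[OF x] w] by blast
    define x2 where "x2 = graft n x z"
    have x2: "x2 \<in> X" "(shift ^^ n) x2 = z" unfolding x2_def using graft_mem[OF x z(1,3)] by simp_all
    have \<Theta>x2: "\<Theta> n x = \<Theta> n x2"
      unfolding x2_def by (rule \<Theta>_agree[OF x graft_mem[OF x z(1,3)] agree_graft_overlap[OF z(3)]])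
    obtain y l where y: "y \<in> X" "l \<le> J" "agree m w y" "(shift ^^ l) y = x2" using J[OF w x2(1)] by blast
    define a b where "a = \<Theta> l y" and "b = \<Theta> k z"
    have ab: "a \<in> A" "b \<in> A" using y(1,2) z(1,2) by (auto simp: A_def a_def b_def)
    have c: "a \<in> carrier G" "b \<in> carrier G" "\<Theta> n x2 \<in> carrier G" "u1 \<in> carrier G" "u2 \<in> carrier G"
      using ab A u V \<Theta>_closed[OF x2(1)] by auto
    have "\<Theta> (l + (n + k)) y = a \<otimes> (\<Theta> n x2 \<otimes> b)"
      using \<Theta>_add[OF y(1), of l "n + k"] \<Theta>_add[OF x2(1), of n k] y(4) x2(2) by (simp add: a_def b_def)
    moreover have "(shift ^^ (l + (n + k))) y = w"
    proof -
      have "(shift ^^ (l + (n + k))) y = (shift ^^ k) ((shift ^^ n) ((shift ^^ l) y))"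
        unfolding add.commute[of l] add.commute[of n] funpow_add by simp
      then show ?thesis by (simp add: y(4) x2(2) z(4))
    qed
    ultimately have mem: "a \<otimes> (\<Theta> n x2 \<otimes> b) \<in> holonomy w"
      unfolding holonomy_def loops_def using y(1,3) by (intro image_eqI[of _ _ "(y, l + (n + k))"]) simp_all
    have "g = (u1 \<otimes> inv a) \<otimes> (a \<otimes> (\<Theta> n x2 \<otimes> b)) \<otimes> (inv b \<otimes> u2)"
      using c by (simp add: g \<Theta>x2 m_assoc inv_cancel_left)
    moreover have "u1 \<otimes> inv a \<in> U" "inv b \<otimes> u2 \<in> U" using ab u by (auto simp: U_def)
    ultimately show "\<exists>u\<in>U. \<exists>h\<in>holonomy w. \<exists>u'\<in>U. g = u \<otimes> h \<otimes> u'" using mem by blast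
  qed
qed

lemma invariance_gap_exists:
  assumes vis: "visibility X G \<theta>" and S: "finite S" "S \<subseteq> carrier G" and \<epsilon>: "0 < \<epsilon>"
  shows "\<exists>\<eta>>0. invariance_gap TYPE('y) \<alpha> X F G \<theta> S \<epsilon> \<eta>"
proof -
  obtain w where w: "w \<in> X" using nonempty by blast
  define H where "H = generate G (holonomy w)"
  have H: "subgroup H G" unfolding H_def by (rule generate_is_subgroup[OF holonomy_closed])
  obtain U where U: "finite U" "U \<subseteq> carrier G"
    and cover: "\<And>g. g \<in> carrier G \<Longrightarrow> \<exists>u\<in>U. \<exists>h\<in>holonomy w. \<exists>u'\<in>U. g = u \<otimes> h \<otimes> u'"
    using visibility_cover[OF vis w] by blast
  have cover_H: "\<exists>u\<in>U. \<exists>h\<in>H. \<exists>u'\<in>U. g = u \<otimes> h \<otimes> u'" if "g \<in> carrier G" for g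
    using cover[OF that] generate.incl[of _ "holonomy w" G] unfolding H_def by blast
  obtain R where R: "finite R" "R \<subseteq> carrier G"
    "\<And>g. g \<in> carrier G \<Longrightarrow> \<exists>t\<in>R. inv t \<otimes> g \<in> H"
    "\<And>t t'. \<lbrakk>t \<in> R; t' \<in> R; inv t \<otimes> t' \<in> H\<rbrakk> \<Longrightarrow> t = t'"
    using finite_left_transversal[OF H U cover_H] by blast
  have R_ne: "R \<noteq> {}" using R(3)[OF one_closed] by blast
  define Q where "Q = (\<lambda>(s, t, t'). inv t' \<otimes> (s \<otimes> t)) ` (S \<times> R \<times> R) \<inter> H"
  have Q: "finite Q" using S R(1) by (simp add: Q_def)
  have "\<exists>P n. finite P \<and> P \<subseteq> holonomy w \<and> displacement_bound TYPE('y) P n h" if "h \<in> Q" for h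
    using generated_displacement[OF holonomy_closed] that unfolding Q_def H_def by blast
  then obtain P n where Pn: "\<And>h. h \<in> Q \<Longrightarrow> finite (P h) \<and> P h \<subseteq> holonomy w \<and> displacement_bound TYPE('y) (P h) (n h) h"
    by metis
  define PP where "PP = (\<Union>h\<in>Q. P h)"
  have PP: "finite PP" "PP \<subseteq> (\<lambda>(y, n). \<Theta> n y) ` loops w"
    using Q Pn unfolding PP_def holonomy_def by auto
  obtain Ls where Ls: "Ls \<subseteq> loops w" "finite Ls" "PP = (\<lambda>(y, n). \<Theta> n y) ` Ls"
    using finite_subset_image[OF PP] by blast
  define n0 where "n0 = (\<Sum>h\<in>Q. n h)"
  \<comment> \<open>A displacement of \<open>\<delta>\<close> under the loops in \<open>Ls\<close> becomes at most \<open>n0 \<delta>\<close> under \<open>Q\<close>, and \<open>card R n0 \<delta>\<close> for the sum over the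
  transversal; the summand \<open>1\<close> keeps the last number strictly below \<open>\<epsilon>\<close>.\<close>
  define \<delta> where "\<delta> = \<epsilon> / (card R * n0 + 1)"
  have den: "0 < real (card R * n0) + 1" using of_nat_0_le_iff[where 'a = real, of "card R * n0"] by linarith
  have \<delta>: "0 < \<delta>" using \<epsilon> den by (simp add: \<delta>_def)
  have \<delta>_less: "card R * (n0 * \<delta>) < \<epsilon>"
  proof -
    have "real (card R * n0) * \<epsilon> < (real (card R * n0) + 1) * \<epsilon>" using \<epsilon> by (intro mult_strict_right_mono) simp_all
    then have "real (card R * n0) * \<epsilon> / (real (card R * n0) + 1) < \<epsilon>" using den by (simp add: divide_less_eq mult.commute)
    then show ?thesis by (simp add: \<delta>_def mult.assoc add.commute)
  qed
  have L_loops: "y \<in> X \<and> agree m w y \<and> agree m w ((shift ^^ n) y)" if "(y, n) \<in> Ls" for y n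
    using that Ls(1) by (auto simp: loops_def)
  show ?thesis
  proof (rule almost_invariant_vector[OF w Ls(2) L_loops \<delta>, where 'y = 'y])
    fix \<eta> :: real
    assume \<eta>: "0 < \<eta>" "\<eta> \<le> 1" and gap:
      "\<And>(Y :: 'y set) act. \<lbrakk>group_action G Y act;
          (1 - \<eta>) * growth < twisted_transfer_radius \<alpha> X F G \<theta> Y act\<rbrakk>
        \<Longrightarrow> \<exists>v\<in>ell2_on Y. v \<noteq> 0 \<and> modulus v = v \<and>
             (\<forall>(y, n)\<in>Ls. norm (induced_rep G Y act (\<Theta> n y) v - v) \<le> \<delta> * norm v)"
    have "invariance_gap TYPE('y) \<alpha> X F G \<theta> S \<epsilon> \<eta>"
      unfolding invariance_gap_def
    proof (intro allI impI)
      fix Y :: "'y set" and act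
      assume ga: "group_action G Y act"
        and radius: "(1 - \<eta>) * transfer_radius \<alpha> X F < twisted_transfer_radius \<alpha> X F G \<theta> Y act"
      interpret permutation_rep G Y act using ga by (rule permutation_rep.intro)
      have "(1 - \<eta>) * growth \<le> (1 - \<eta>) * transfer_radius \<alpha> X F"
        using growth_le_transfer_radius \<eta>(2) by (intro mult_left_mono) simp_all
      then obtain v where v: "v \<in> ell2_on Y" "v \<noteq> 0" "modulus v = v"
        and inv_v: "\<And>y n. (y, n) \<in> Ls \<Longrightarrow> norm (\<Lambda> (\<Theta> n y) v - v) \<le> \<delta> * norm v"
      proof -
        have "(1 - \<eta>) * growth < twisted_transfer_radius \<alpha> X F G \<theta> Y act"
          using \<open>(1 - \<eta>) * growth \<le> _\<close> radius by linarith
        from gap[OF ga this] show ?thesis by (auto intro: that)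
      qed
      have disp: "norm (\<Lambda> h v - v) \<le> n0 * (\<delta> * norm v)" if h: "h \<in> Q" for h
      proof -
        have "norm (\<Lambda> g v - v) \<le> \<delta> * norm v" if "g \<in> P h" for g
        proof -
          have "g \<in> (\<lambda>(y, n). \<Theta> n y) ` Ls" using that h Ls(3) by (auto simp: PP_def)
          then show ?thesis using inv_v by auto
        qed
        then have "norm (\<Lambda> h v - v) \<le> real (n h) * (\<delta> * norm v)"
          using Pn[OF h] by (intro displacement_boundD[OF _ ga v(1)]) auto
        also have "\<dots> \<le> n0 * (\<delta> * norm v)"
        proof (rule mult_right_mono)
          have "n h \<le> n0" unfolding n0_def by (rule member_le_sum[OF h _ Q]) simp
          then show "real (n h) \<le> real n0" by simp
        qed (use \<delta> in simp)
        finally show ?thesis .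
      qed
      define \<psi> where "\<psi> = (\<Sum>t\<in>R. \<Lambda> t v)"
      have norm_\<psi>: "norm v \<le> norm \<psi>" unfolding \<psi>_def by (rule norm_le_sum_translates[OF R(1,2) R_ne v(1,3)])
      have \<psi>Y: "\<psi> \<in> ell2_on Y"
        unfolding \<psi>_def using R(2) \<Lambda>_linear(7)
        by (auto intro!: sum_in_ell2_on)
      have inv_\<psi>: "norm (\<Lambda> s \<psi> - \<psi>) \<le> card R * (n0 * (\<delta> * norm v))" if s: "s \<in> S" for s
        unfolding \<psi>_def
      proof (rule sum_translates_almost_invariant[OF H R])
        show "s \<in> carrier G" using s S(2) by blast
        fix t t' assume "t \<in> R" "t' \<in> R" "inv t' \<otimes> (s \<otimes> t) \<in> H"
        then have "inv t' \<otimes> (s \<otimes> t) \<in> Q" using s unfolding Q_def by force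
        then show "norm (\<Lambda> (inv t' \<otimes> (s \<otimes> t)) v - v) \<le> n0 * (\<delta> * norm v)" by (rule disp)
      qed
      have "card R * (n0 * (\<delta> * norm v)) < \<epsilon> * norm v"
        using mult_strict_right_mono[OF \<delta>_less, of "norm v"] v(2) by (simp add: mult.assoc)
      also have "\<dots> \<le> \<epsilon> * norm \<psi>" using norm_\<psi> \<epsilon> by (intro mult_left_mono) simp_all
      finally have less: "card R * (n0 * (\<delta> * norm v)) < \<epsilon> * norm \<psi>" .
      have "(SUP s\<in>S. ennreal (norm (\<Lambda> s \<psi> - \<psi>))) \<le> ennreal (card R * (n0 * (\<delta> * norm v)))"
        by (intro SUP_least ennreal_leI inv_\<psi>)
      also have "\<dots> < ennreal (\<epsilon> * norm \<psi>)"
        using less \<delta> by (intro ennreal_lessI) (simp_all add: mult_pos_pos le_less_trans[OF _ less])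
      finally show "\<exists>\<phi>. invariant_vector G Y act S \<epsilon> \<phi>"
        unfolding invariant_vector_def using \<psi>Y by blast
    qed
    then show ?thesis using \<eta>(1) by blast
  qed
qed

end

section \<open>Reduction to countable sets\<close>

lemma transported_group_action:
  fixes G :: "('g, 'm) monoid_scheme" (structure)
  assumes ga: "group_action G Y act" and j: "bij_betw j Z Y'" and Y': "Y' \<subseteq> Y"
    and invariant: "\<And>g y. g \<in> carrier G \<Longrightarrow> y \<in> Y' \<Longrightarrow> act g y \<in> Y'"
  shows "group_action G Z (\<lambda>g. restrict (\<lambda>k. inv_into Z j (act g (j k))) Z)"
    (is "group_action G Z ?act")
proof -
  interpret permutation_rep G Y act using ga by (rule permutation_rep.intro)
  interpret group G by (rule group_G)
  have jZ: "j k \<in> Y'" if "k \<in> Z" for k using j that by (auto simp: bij_betw_def)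
  have bij_Y': "bij_betw (act g) Y' Y'" if g: "g \<in> carrier G" for g
  proof (rule bij_betw_imageI)
    show "inj_on (act g) Y'" using act_bij[OF g] Y' by (auto simp: bij_betw_def intro: inj_on_subset)
    show "act g ` Y' = Y'"
    proof
      show "act g ` Y' \<subseteq> Y'" using invariant[OF g] by blast
      show "Y' \<subseteq> act g ` Y'"
      proof
        fix y assume y: "y \<in> Y'"
        then have yY: "y \<in> Y" using Y' by blast
        have "act g (act (inv g) y) = act (g \<otimes> inv g) y"
          using composition_rule[OF yY g inv_closed[OF g]] by simp
        also have "\<dots> = y" using g fun_cong[OF id_eq_one, of y] yY by simp
        finally show "y \<in> act g ` Y'" using invariant[OF inv_closed[OF g] y] by (intro image_eqI) simp_all
      qed
    qed
  qed
  have Bij: "?act g \<in> Bij Z" if g: "g \<in> carrier G" for g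
  proof -
    have "bij_betw (inv_into Z j \<circ> (act g \<circ> j)) Z Z"
      by (rule bij_betw_trans[OF bij_betw_trans[OF j bij_Y'[OF g]] bij_betw_inv_into[OF j]])
    then have "bij_betw (?act g) Z Z" by (rule bij_betw_cong[THEN iffD1, rotated]) simp
    then show ?thesis by (simp add: Bij_def)
  qed
  have mult: "?act (g \<otimes> h) = compose Z (?act g) (?act h)" if g: "g \<in> carrier G" and h: "h \<in> carrier G" for g h
  proof
    fix k
    show "?act (g \<otimes> h) k = compose Z (?act g) (?act h) k"
    proof (cases "k \<in> Z")
      case True
      have hk: "act h (j k) \<in> Y'" by (rule invariant[OF h jZ[OF True]])
      have "inv_into Z j (act h (j k)) \<in> Z" using bij_betw_inv_into[OF j] hk by (auto simp: bij_betw_def)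
      moreover have "j (inv_into Z j (act h (j k))) = act h (j k)" by (rule bij_betw_inv_into_right[OF j hk])
      moreover have "act (g \<otimes> h) (j k) = act g (act h (j k))"
        by (rule composition_rule[OF _ g h]) (use jZ[OF True] Y' in blast)
      ultimately show ?thesis using True by (simp add: compose_def)
    qed (simp add: compose_def)
  qed
  show ?thesis
    unfolding group_action_def group_hom_def group_hom_axioms_def
  proof (intro conjI)
    show "group G" by (rule group_G)
    show "group (BijGroup Z)" by (rule group_BijGroup)
    show "?act \<in> hom G (BijGroup Z)"
    proof (rule homI)
      show "?act g \<in> carrier (BijGroup Z)" if "g \<in> carrier G" for g using Bij[OF that] by (simp add: BijGroup_def)
      show "?act (g \<otimes> h) = ?act g \<otimes>\<^bsub>BijGroup Z\<^esub> ?act h" if "g \<in> carrier G" "h \<in> carrier G" for g h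
        using mult[OF that] Bij[OF that(1)] Bij[OF that(2)] by (simp add: BijGroup_def)
    qed
  qed
qed

lemma (in permutation_rep) reindex_intertwines:
  assumes rep': "permutation_rep G Z act'" and j: "inj_on j Z" "j ` Z \<subseteq> Y"
    and equi: "\<And>g k. g \<in> carrier G \<Longrightarrow> k \<in> Z \<Longrightarrow> j (act' g k) = act g (j k)"
    and g: "g \<in> carrier G"
  shows "reindex Z j (\<Lambda> g v) = induced_rep G Z act' g (reindex Z j v)"
proof -
  interpret rep': permutation_rep G Z act' by fact
  interpret group G by (rule group_G)
  have "reindex Z j (\<Lambda> g v) = reindex Z (\<lambda>k. act (inv g) (j k)) v"
    unfolding \<Lambda>_eq_reindex by (rule reindex_reindex[OF act_inv(1)[OF g] j])
  also have "\<dots> = reindex Z (\<lambda>k. j (act' (inv g) k)) v"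
    by (rule reindex_cong) (simp add: equi g)
  also have "\<dots> = reindex Z (act' (inv g)) (reindex Z j v)"
    by (rule reindex_reindex[symmetric]) (use j(1) rep'.act_inv[OF g] in simp_all)
  finally show ?thesis by (simp add: rep'.\<Lambda>_eq_reindex)
qed

context extension_rep begin

text \<open>The values of \<open>\<Phi>\<close> at one point of each cylinder determine all its values by continuity, there are countably
  many cylinders, and a square summable function has countable support.\<close>

lemma countable_support_holder:
  assumes \<Phi>: "\<Phi> \<in> H"
  shows "countable (\<Union>x\<in>X. {y. Rep_ell2 (\<Phi> x) y \<noteq> 0})"
proof -
  define d where "d u = (SOME x. x \<in> X \<and> map x [0..<length u] = u)" for u :: "'a list"
  have d: "d (map x [0..<n]) \<in> X \<and> agree n x (d (map x [0..<n]))" if x: "x \<in> X" for x n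
  proof -
    have *: "d (map x [0..<n]) \<in> X \<and> map (d (map x [0..<n])) [0..<length (map x [0..<n])] = map x [0..<n]"
      unfolding d_def by (rule someI[of _ x]) (use x in simp)
    have "agree n x (d (map x [0..<n]))"
      unfolding agree_def
    proof (intro allI impI)
      fix i assume "i < n"
      then show "x i = d (map x [0..<n]) i" using arg_cong[OF conjunct2[OF *], of "\<lambda>u. u ! i"] by simp
    qed
    then show ?thesis using * by blast
  qed
  have "(\<Union>x\<in>X. {y. Rep_ell2 (\<Phi> x) y \<noteq> 0}) \<subseteq> (\<Union>u. {y. Rep_ell2 (\<Phi> (d u)) y \<noteq> 0})"
  proof
    fix y assume "y \<in> (\<Union>x\<in>X. {y. Rep_ell2 (\<Phi> x) y \<noteq> 0})"
    then obtain x where x: "x \<in> X" "Rep_ell2 (\<Phi> x) y \<noteq> 0" by blast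
    show "y \<in> (\<Union>u. {y. Rep_ell2 (\<Phi> (d u)) y \<noteq> 0})"
    proof (rule ccontr)
      assume "\<not> ?thesis"
      then have zero: "Rep_ell2 (\<Phi> (d u)) y = 0" for u by blast
      have "cmod (Rep_ell2 (\<Phi> x) y) \<le> N \<Phi> * exp (- \<alpha>) ^ n" for n
      proof -
        let ?x' = "d (map x [0..<n])"
        have "cmod (Rep_ell2 (\<Phi> x) y) = cmod (Rep_ell2 (\<Phi> x - \<Phi> ?x') y)" by (simp add: minus_ell2.rep_eq zero)
        also have "\<dots> \<le> norm (\<Phi> x - \<Phi> ?x')" by (rule cmod_Rep_le_norm)
        also have "\<dots> \<le> N \<Phi> * hdist x ?x'" using d[OF x(1)] by (intro holder_variation \<Phi> x(1)) blast
        also have "\<dots> \<le> N \<Phi> * exp (- \<alpha> * n)" using d[OF x(1)] by (intro mult_left_mono hdist_le N_nonneg \<Phi>) blast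
        also have "exp (- \<alpha> * n) = exp (- \<alpha>) ^ n" by (simp add: exp_of_nat_mult[symmetric] mult.commute)
        finally show ?thesis .
      qed
      moreover have "(\<lambda>n. N \<Phi> * exp (- \<alpha>) ^ n) \<longlonglongrightarrow> 0"
        using \<alpha>_pos by (intro tendsto_mult_right_zero LIMSEQ_realpow_zero) simp_all
      ultimately have "cmod (Rep_ell2 (\<Phi> x) y) \<le> 0" by (intro LIMSEQ_le_const) auto
      then show False using x(2) by simp
    qed
  qed
  then show ?thesis by (rule countable_subset) (intro countable_UN countable_support_ell2 countableI_type)
qed

text \<open>The set \<open>Y'\<close> consists of the orbits that meet the supports of the values of countably many approximate eigenvectors.\<close>

lemma approximate_eigenvectors_countable_support:
  assumes cG: "countable (carrier G)"
    and approx: "\<And>\<tau>. 0 < \<tau> \<Longrightarrow> \<exists>\<Phi>\<in>H. N (\<lambda>x. z *\<^sub>C \<Phi> x - T \<Phi> x) < \<tau> * N \<Phi>"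
  obtains Y' where "countable Y'" "Y' \<subseteq> Y" "\<And>g y. g \<in> carrier G \<Longrightarrow> y \<in> Y' \<Longrightarrow> act g y \<in> Y'"
    "\<And>\<tau>. 0 < \<tau> \<Longrightarrow> \<exists>\<Phi>\<in>H. (\<forall>x. \<Phi> x \<in> ell2_on Y') \<and> N (\<lambda>x. z *\<^sub>C \<Phi> x - T \<Phi> x) < \<tau> * N \<Phi>"
proof -
  have "\<forall>n::nat. \<exists>\<Phi>. \<Phi> \<in> H \<and> N (\<lambda>x. z *\<^sub>C \<Phi> x - T \<Phi> x) < 1 / real (Suc n) * N \<Phi>"
  proof
    fix n
    have "\<exists>\<Phi>\<in>H. N (\<lambda>x. z *\<^sub>C \<Phi> x - T \<Phi> x) < 1 / real (Suc n) * N \<Phi>" by (rule approx) simp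
    then show "\<exists>\<Phi>. \<Phi> \<in> H \<and> N (\<lambda>x. z *\<^sub>C \<Phi> x - T \<Phi> x) < 1 / real (Suc n) * N \<Phi>" unfolding Bex_def .
  qed
  then obtain \<Phi> where \<Phi>: "\<And>n::nat. \<Phi> n \<in> H"
    and small: "\<And>n. N (\<lambda>x. z *\<^sub>C \<Phi> n x - T (\<Phi> n) x) < 1 / real (Suc n) * N (\<Phi> n)"
    unfolding choice_iff by blast
  define S where "S = (\<Union>n. \<Union>x\<in>X. {y. Rep_ell2 (\<Phi> n x) y \<noteq> 0})"
  define Y' where "Y' = (\<lambda>(g, y). act g y) ` (carrier G \<times> S)"
  have SY: "S \<subseteq> Y" using holder_mem(1)[OF \<Phi>] by (auto simp: S_def ell2_on_def)
  have cS: "countable S" unfolding S_def by (intro countable_UN countable_support_holder \<Phi>) simp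
  show ?thesis
  proof (rule that)
    show "countable Y'" unfolding Y'_def using cG cS by (intro countable_image countable_SIGMA)
    show "Y' \<subseteq> Y" using SY element_image by (fastforce simp: Y'_def)
    show "act g y \<in> Y'" if g: "g \<in> carrier G" and y: "y \<in> Y'" for g y
    proof -
      obtain h s where h: "h \<in> carrier G" "s \<in> S" "y = act h s" using y by (auto simp: Y'_def)
      have "act g y = act (g \<otimes> h) s" using composition_rule[of s g h] h g SY by auto
      then show ?thesis using h g unfolding Y'_def by (intro image_eqI[of _ _ "(g \<otimes> h, s)"]) simp_all
    qed
    fix \<tau> :: real assume \<tau>: "0 < \<tau>"
    obtain n where n: "1 / real (Suc n) < \<tau>" using \<tau> nat_approx_posE by blast
    have "1 / real (Suc n) * N (\<Phi> n) \<le> \<tau> * N (\<Phi> n)" using n by (intro mult_right_mono N_nonneg \<Phi>) simp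
    then have "N (\<lambda>x. z *\<^sub>C \<Phi> n x - T (\<Phi> n) x) < \<tau> * N (\<Phi> n)" using small[of n] by linarith
    moreover have "\<Phi> n x \<in> ell2_on Y'" for x
    proof (cases "x \<in> X")
      case True
      have "y \<in> Y'" if "y \<in> S" for y
        using that SY fun_cong[OF id_eq_one, of y] unfolding Y'_def by (intro image_eqI[of _ _ "(\<one>, y)"]) auto
      then show ?thesis using True by (auto simp: ell2_on_def S_def)
    next
      case False
      then show ?thesis using holder_mem(2)[OF \<Phi>] by (simp add: ell2_on_linear)
    qed
    ultimately show "\<exists>\<Phi>\<in>H. (\<forall>x. \<Phi> x \<in> ell2_on Y') \<and> N (\<lambda>x. z *\<^sub>C \<Phi> x - T \<Phi> x) < \<tau> * N \<Phi>"
      using \<Phi>[of n] by blast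
  qed
qed

end

context extension begin

text \<open>Approximate eigenvectors for \<open>Y\<close> live on a countable invariant subset \<open>Y'\<close>, which a bijection \<open>j\<close> identifies with a
  set \<open>Z\<close> of natural numbers. Pulling them back along \<open>j\<close> keeps the approximate eigenvalue in the spectrum for \<open>Z\<close>, and
  the invariant vector obtained for \<open>Z\<close> is pushed forward to \<open>Y\<close>.\<close>

lemma invariance_gap_transfer:
  assumes cG: "countable (carrier G)" and S: "S \<subseteq> carrier G"
    and gap: "invariance_gap TYPE(nat) \<alpha> X F G \<theta> S \<epsilon> \<eta>"
  shows "invariance_gap TYPE('y) \<alpha> X F G \<theta> S \<epsilon> \<eta>"
  unfolding invariance_gap_def
proof (intro allI impI)
  fix Y :: "'y set" and act
  assume ga: "group_action G Y act"
    and radius: "(1 - \<eta>) * transfer_radius \<alpha> X F < twisted_transfer_radius \<alpha> X F G \<theta> Y act"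
  define b where "b = (1 - \<eta>) * transfer_radius \<alpha> X F"
  interpret er: extension_rep X m F \<alpha> c G \<theta> Y act
    by (intro extension_rep.intro permutation_rep.intro extension_axioms ga)
  have "\<exists>Y' z. countable Y' \<and> Y' \<subseteq> Y \<and> (\<forall>g\<in>carrier G. \<forall>y\<in>Y'. act g y \<in> Y') \<and>
      (b < 0 \<or> b < cmod z \<and>
        (\<forall>\<tau>>0. \<exists>\<Phi>\<in>er.H. (\<forall>x. \<Phi> x \<in> ell2_on Y') \<and> er.N (\<lambda>x. z *\<^sub>C \<Phi> x - er.T \<Phi> x) < \<tau> * er.N \<Phi>))"
  proof (cases "b < 0")
    case True
    \<comment> \<open>This case occurs for \<open>\<eta> > 1\<close>, where the hypothesis on the radius holds for the empty set too.\<close>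
    then show ?thesis by (intro exI[of _ "{}"]) simp
  next
    case False
    show ?thesis
    proof (rule er.approximate_eigenvalue_above[of b])
      show "b < spectral_radius \<alpha> X (ell2_on Y) er.T"
        using radius by (simp add: b_def er.T_eq_twisted_transfer_op)
      show "0 \<le> b" using False by simp
      fix z assume z: "b < cmod z"
        and approx: "\<And>\<tau>. 0 < \<tau> \<Longrightarrow> \<exists>\<Phi>\<in>er.H. er.N (\<lambda>x. z *\<^sub>C \<Phi> x - er.T \<Phi> x) < \<tau> * er.N \<Phi>"
      show ?thesis
      proof (rule er.approximate_eigenvectors_countable_support[OF cG approx])
        fix Y' assume "countable Y'" "Y' \<subseteq> Y" "\<And>g y. g \<in> carrier G \<Longrightarrow> y \<in> Y' \<Longrightarrow> act g y \<in> Y'"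
          "\<And>\<tau>. 0 < \<tau> \<Longrightarrow> \<exists>\<Phi>\<in>er.H. (\<forall>x. \<Phi> x \<in> ell2_on Y') \<and> er.N (\<lambda>x. z *\<^sub>C \<Phi> x - er.T \<Phi> x) < \<tau> * er.N \<Phi>"
        then show ?thesis using z by (intro exI[of _ Y'] exI[of _ z]) simp
      qed simp_all
    qed
  qed
  then obtain Y' z where Y': "countable Y'" "Y' \<subseteq> Y" and inv_Y': "\<And>g y. g \<in> carrier G \<Longrightarrow> y \<in> Y' \<Longrightarrow> act g y \<in> Y'"
    and z: "b < 0 \<or> b < cmod z \<and>
        (\<forall>\<tau>>0. \<exists>\<Phi>\<in>er.H. (\<forall>x. \<Phi> x \<in> ell2_on Y') \<and> er.N (\<lambda>x. z *\<^sub>C \<Phi> x - er.T \<Phi> x) < \<tau> * er.N \<Phi>)"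
    by (elim exE conjE) (rule that, auto)
  define f where "f = to_nat_on Y'"
  define Z where "Z = f ` Y'"
  define j where "j = inv_into Y' f"
  have f_bij: "bij_betw f Y' Z" using inj_on_to_nat_on[OF Y'(1)] by (simp add: f_def Z_def bij_betw_def)
  have j: "bij_betw j Z Y'" unfolding j_def by (rule bij_betw_inv_into[OF f_bij])
  have jZ: "inj_on j Z" "j ` Z = Y'" using j by (simp_all add: bij_betw_def)
  define act' where "act' = (\<lambda>g. restrict (\<lambda>k. inv_into Z j (act g (j k))) Z)"
  have ga': "group_action G Z act'"
    unfolding act'_def by (rule transported_group_action[OF ga j Y'(2) inv_Y'])
  interpret er': extension_rep X m F \<alpha> c G \<theta> Z act'
    by (intro extension_rep.intro permutation_rep.intro extension_axioms ga')
  have equi: "j (act' g k) = act g (j k)" if g: "g \<in> carrier G" and k: "k \<in> Z" for g k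
    using bij_betw_inv_into_right[OF j inv_Y'[OF g]] jZ(2) k by (auto simp: act'_def)
  define push where "push = (reindex Y' (inv_into Z j) :: nat ell2 \<Rightarrow> 'y ell2)"
  define pull where "pull = (reindex Z j :: 'y ell2 \<Rightarrow> nat ell2)"
  have k: "bij_betw (inv_into Z j) Y' Z" by (rule bij_betw_inv_into[OF j])
  have kY: "inj_on (inv_into Z j) Y'" "inv_into Z j ` Y' = Z" using k by (simp_all add: bij_betw_def)
  have intertwine: "pull (er.\<Lambda> g v) = er'.\<Lambda> g (pull v)" if "g \<in> carrier G" for g v
    unfolding pull_def
    by (rule er.reindex_intertwines[OF er'.permutation_rep_axioms jZ(1) _ equi that]) (use jZ(2) Y'(2) in simp)
  have push_pull: "push (pull v) = v" if "v \<in> ell2_on Y'" for v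
    unfolding push_def pull_def by (rule reindex_inv_into[OF j that])
  have radius': "b < twisted_transfer_radius \<alpha> X F G \<theta> Z act'"
  proof (cases "b < 0")
    case True
    then show ?thesis using er'.spectral_radius_nonneg unfolding er'.T_eq_twisted_transfer_op by linarith
  next
    case False
    with z have bz: "b < cmod z" and approx: "\<And>\<tau>. 0 < \<tau> \<Longrightarrow>
      \<exists>\<Phi>\<in>er.H. (\<forall>x. \<Phi> x \<in> ell2_on Y') \<and> er.N (\<lambda>x. z *\<^sub>C \<Phi> x - er.T \<Phi> x) < \<tau> * er.N \<Phi>" by auto
    have "z \<in> er'.spec er'.T"
    proof (rule er'.approximate_eigenvectors_imp_spec[OF er'.T_linear])
      fix \<tau> :: real assume \<tau>: "0 < \<tau>"
      obtain \<Phi> where \<Phi>: "\<Phi> \<in> er.H" and supp: "\<And>x. \<Phi> x \<in> ell2_on Y'"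
        and small: "er.N (\<lambda>x. z *\<^sub>C \<Phi> x - er.T \<Phi> x) < \<tau> * er.N \<Phi>" using approx[OF \<tau>] by blast
      have pull_lin: "pull (u - v) = pull u - pull v" "pull (a *\<^sub>C v) = a *\<^sub>C pull v" "pull (r *\<^sub>R v) = r *\<^sub>R pull v"
        "pull v \<in> ell2_on Z" "norm (pull v) \<le> norm v" "pull 0 = 0" for u v a r
        unfolding pull_def by (simp_all add: reindex_linear[OF jZ(1)] norm_reindex_le[OF jZ(1)])
      define \<Psi> where "\<Psi> = (\<lambda>x. pull (\<Phi> x))"
      have \<Psi>: "\<Psi> \<in> er'.H" unfolding \<Psi>_def by (rule holder_contraction(1)[OF \<Phi>]) (simp_all add: pull_lin)
      have "er'.T \<Psi> x = pull (er.T \<Phi> x)" for x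
        using \<theta>_closed pre_mem
        by (auto simp: er'.T_def er.T_def \<Psi>_def pull_lin pull_def reindex_sum[OF jZ(1)] reindex_linear[OF jZ(1)]
            intertwine[unfolded pull_def] intro!: sum.cong)
      then have "(\<lambda>x. z *\<^sub>C \<Psi> x - er'.T \<Psi> x) = (\<lambda>x. pull (z *\<^sub>C \<Phi> x - er.T \<Phi> x))"
        by (simp add: \<Psi>_def pull_lin)
      moreover have "(\<lambda>x. z *\<^sub>C \<Phi> x - er.T \<Phi> x) \<in> er.H"
        by (intro er.diff_mem er.scale_mem \<Phi> er.linear_opD(1)[OF er.T_linear])
      then have "er'.N (\<lambda>x. pull (z *\<^sub>C \<Phi> x - er.T \<Phi> x)) \<le> er.N (\<lambda>x. z *\<^sub>C \<Phi> x - er.T \<Phi> x)"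
        by (rule holder_contraction(2)[where E' = "ell2_on Z"]) (simp_all add: pull_lin)
      ultimately have "er'.N (\<lambda>x. z *\<^sub>C \<Psi> x - er'.T \<Psi> x) \<le> er.N (\<lambda>x. z *\<^sub>C \<Phi> x - er.T \<Phi> x)"
        by (simp only:)
      also have "\<dots> < \<tau> * er.N \<Phi>" by (rule small)
      also have "\<dots> \<le> \<tau> * er'.N \<Psi>"
      proof (rule mult_left_mono)
        have "\<Phi> = (\<lambda>x. push (\<Psi> x))" by (simp add: \<Psi>_def push_pull supp)
        moreover have "holder_real_norm \<alpha> X (\<lambda>x. push (\<Psi> x)) \<le> holder_real_norm \<alpha> X \<Psi>"
          by (rule holder_contraction(2)[OF \<Psi>, where E' = UNIV])
            (simp_all add: push_def reindex_linear[OF kY(1)] norm_reindex_le[OF kY(1)])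
        ultimately show "er.N \<Phi> \<le> er'.N \<Psi>" by simp
      qed (use \<tau> in simp)
      finally show "\<exists>f\<in>er'.H. er'.N (\<lambda>x. z *\<^sub>C f x - er'.T f x) < \<tau> * er'.N f" using \<Psi> by blast
    qed
    then show ?thesis
      using er'.spec_le_spectral_radius bz unfolding er'.T_eq_twisted_transfer_op by fastforce
  qed
  then obtain \<psi> where \<psi>: "invariant_vector G Z act' S \<epsilon> \<psi>"
    using gap ga' unfolding invariance_gap_def b_def by blast
  have \<psi>Z: "\<psi> \<in> ell2_on Z" using \<psi> by (simp add: invariant_vector_def)
  define \<phi> where "\<phi> = push \<psi>"
  have \<phi>Y': "\<phi> \<in> ell2_on Y'" unfolding \<phi>_def push_def by (rule reindex_linear(7)[OF kY(1)])
  have pull_\<phi>: "pull \<phi> = \<psi>"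
  proof -
    have "pull \<phi> = reindex Z (\<lambda>n. inv_into Z j (j n)) \<psi>"
      unfolding \<phi>_def push_def pull_def by (rule reindex_reindex) (use kY jZ in simp_all)
    also have "\<dots> = reindex Z (\<lambda>n. n) \<psi>" by (rule reindex_cong) (use jZ(1) in simp)
    finally show ?thesis by (simp add: reindex_id \<psi>Z)
  qed
  have norm_pull: "norm (pull v) = norm v" if "v \<in> ell2_on Y'" for v
    unfolding pull_def by (rule norm_reindex[OF jZ(1)]) (use that jZ(2) in simp)
  have displacement: "norm (er.\<Lambda> s \<phi> - \<phi>) = norm (er'.\<Lambda> s \<psi> - \<psi>)" if s: "s \<in> S" for s
  proof -
    have sc: "s \<in> carrier G" using s S by blast
    have "er.\<Lambda> s \<phi> \<in> ell2_on Y'"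
      unfolding ell2_on_def
    proof (intro CollectI allI impI)
      fix y assume y: "y \<notin> Y'"
      have "act (inv s) y \<notin> Y'" if yY: "y \<in> Y"
      proof
        assume "act (inv s) y \<in> Y'"
        then have "act s (act (inv s) y) \<in> Y'" by (rule inv_Y'[OF sc])
        moreover have "act s (act (inv s) y) = act (s \<otimes> inv s) y"
          using er.composition_rule[OF yY sc inv_closed[OF sc]] by simp
        ultimately show False using y sc fun_cong[OF er.id_eq_one, of y] yY by simp
      qed
      then show "Rep_ell2 (er.\<Lambda> s \<phi>) y = 0"
        using \<phi>Y' by (simp add: Rep_induced_rep[OF ga sc] ell2_on_def)
    qed
    then have "norm (er.\<Lambda> s \<phi> - \<phi>) = norm (pull (er.\<Lambda> s \<phi> - \<phi>))"
      using \<phi>Y' by (simp add: norm_pull ell2_on_linear)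
    also have "pull (er.\<Lambda> s \<phi> - \<phi>) = er'.\<Lambda> s \<psi> - \<psi>"
      using intertwine[OF sc, of \<phi>] pull_\<phi> by (simp add: pull_def reindex_linear[OF jZ(1)])
    finally show ?thesis .
  qed
  have "(SUP s\<in>S. ennreal (norm (er.\<Lambda> s \<phi> - \<phi>))) = (SUP s\<in>S. ennreal (norm (er'.\<Lambda> s \<psi> - \<psi>)))"
    by (rule SUP_cong[OF refl]) (simp only: displacement)
  moreover have "norm \<phi> = norm \<psi>" using norm_pull[OF \<phi>Y'] pull_\<phi> by simp
  moreover have "\<phi> \<in> ell2_on Y" using \<phi>Y' Y'(2) by (auto simp: ell2_on_def)
  ultimately have "invariant_vector G Y act S \<epsilon> \<phi>"
    using \<psi> unfolding invariant_vector_def by (simp only:)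
  then show "\<exists>\<phi>. invariant_vector G Y act S \<epsilon> \<phi>" by blast
qed

end

theorem theorem1p2:
  fixes X :: "(nat \<Rightarrow> 'a::finite) set"
    and F :: "(nat \<Rightarrow> 'a) \<Rightarrow> real"
    and \<alpha> :: real
    and G :: "('g, 'm) monoid_scheme"
    and \<theta> :: "(nat \<Rightarrow> 'a) \<Rightarrow> 'g"
  assumes "subshift X" and "finite_type X" and "topologically_transitive X"
    and "0 < \<alpha>" and "\<forall>x\<in>X. 0 < F x" and "bounded_holder_variations \<alpha> X F"
    and "group G" and "finitely_generated G"
    and "\<theta> \<in> X \<rightarrow> carrier G" and "locally_constant_on X \<theta>"
    and "visibility X G \<theta>"
  shows "(\<forall>S \<epsilon>. finite S \<and> S \<subseteq> carrier G \<and> 0 < \<epsilon> \<longrightarrow>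
           (\<exists>\<eta>>0. invariance_gap TYPE(nat) \<alpha> X F G \<theta> S \<epsilon> \<eta>) \<and>
           (\<forall>\<eta>>0. invariance_gap TYPE(nat) \<alpha> X F G \<theta> S \<epsilon> \<eta> \<longrightarrow>
                  invariance_gap TYPE('y) \<alpha> X F G \<theta> S \<epsilon> \<eta>)) \<and>
         (\<forall>(Y :: 'y set) act. group_action G Y act \<longrightarrow>
           twisted_transfer_radius \<alpha> X F G \<theta> Y act = transfer_radius \<alpha> X F \<longrightarrow>
           amenable_action G Y act)"
proof -
  interpret group G by fact
  obtain N where N: "\<And>x. x \<in> X \<longleftrightarrow> (\<forall>i. admissible X (subword x i N))"
    using \<open>finite_type X\<close> unfolding finite_type_def by blast
  obtain k where k: "\<And>x y. \<lbrakk>x \<in> X; y \<in> X; agree k x y\<rbrakk> \<Longrightarrow> \<theta> x = \<theta> y"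
    using locally_constant_imp_uniform[OF \<open>finite_type X\<close> \<open>locally_constant_on X \<theta>\<close>] by blast
  define m where "m = max 1 (max N k)"
  have m: "N \<le> m" "0 < m" "k \<le> m" by (simp_all add: m_def)
  have ne: "X \<noteq> {}" using \<open>visibility X G \<theta>\<close> one_closed unfolding visibility_def by blast
  define c where "c = holder_real_norm \<alpha> X (\<lambda>x. ln (F x))"
  have fin: "holder_norm \<alpha> X (\<lambda>x. ln (F x)) < \<infinity>"
    using \<open>bounded_holder_variations \<alpha> X F\<close> by (simp add: bounded_holder_variations_def)
  interpret extension X m F \<alpha> c G \<theta>
  proof (intro extension.intro weighted_sft.intro)
    show "irreducible_sft X m"
      by (rule irreducible_sftI[OF \<open>subshift X\<close> \<open>topologically_transitive X\<close> ne N m(1,2)])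
    show "weighted_sft_axioms X F \<alpha> c"
    proof
      show "0 < \<alpha>" by fact
      show "0 < F x" if "x \<in> X" for x using \<open>\<forall>x\<in>X. 0 < F x\<close> that by blast
      show "\<bar>ln (F x)\<bar> \<le> c" if "x \<in> X" for x
        using holder_real_norm_bound[OF fin that that that] by (simp add: c_def)
      show "\<bar>ln (F x) - ln (F y)\<bar> \<le> c * shift_dist x y powr \<alpha>" if "x \<in> X" "y \<in> X" for x y
        using holder_variation_bound[OF fin that] by (simp add: c_def)
    qed
    show "group G" by fact
    show "extension_axioms X m G \<theta>"
    proof
      show "\<theta> x \<in> carrier G" if "x \<in> X" for x using \<open>\<theta> \<in> X \<rightarrow> carrier G\<close> that by blast
      show "\<theta> x = \<theta> y" if "x \<in> X" "y \<in> X" "agree m x y" for x y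
        using k[OF that(1,2) agree_mono[OF that(3) m(3)]] .
    qed
  qed
  obtain A where A: "finite A" "A \<subseteq> carrier G" "generate G A = carrier G"
    using \<open>finitely_generated G\<close> unfolding finitely_generated_def by blast
  have cG: "countable (carrier G)"
    using countable_generate[OF countable_finite[OF A(1)] A(2)] unfolding A(3) .
  show ?thesis
  proof (intro conjI allI impI)
    fix S :: "'g set" and \<epsilon> :: real
    assume S: "finite S \<and> S \<subseteq> carrier G \<and> 0 < \<epsilon>"
    show "\<exists>\<eta>>0. invariance_gap TYPE(nat) \<alpha> X F G \<theta> S \<epsilon> \<eta>"
      using S by (intro invariance_gap_exists \<open>visibility X G \<theta>\<close>) simp_all
    show "invariance_gap TYPE('y) \<alpha> X F G \<theta> S \<epsilon> \<eta>" if "invariance_gap TYPE(nat) \<alpha> X F G \<theta> S \<epsilon> \<eta>" for \<eta>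
      using invariance_gap_transfer[OF cG _ that] S by blast
  next
    fix Y :: "'y set" and act
    assume ga: "group_action G Y act"
      and eq: "twisted_transfer_radius \<alpha> X F G \<theta> Y act = transfer_radius \<alpha> X F"
    show "amenable_action G Y act"
      unfolding amenable_action_def
    proof (intro allI impI)
      fix S :: "'g set" and \<epsilon> :: real
      assume S: "finite S" "S \<subseteq> carrier G" "0 < \<epsilon>"
      obtain \<eta> where \<eta>: "0 < \<eta>" "invariance_gap TYPE('y) \<alpha> X F G \<theta> S \<epsilon> \<eta>"
        using invariance_gap_exists[OF \<open>visibility X G \<theta>\<close> S] by blast
      have "0 < transfer_radius \<alpha> X F" using growth_le_transfer_radius growth_pos by linarith
      then have "(1 - \<eta>) * transfer_radius \<alpha> X F < twisted_transfer_radius \<alpha> X F G \<theta> Y act"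
        using \<eta>(1) by (simp add: eq algebra_simps)
      then show "\<exists>\<phi>. invariant_vector G Y act S \<epsilon> \<phi>"
        using \<eta>(2) ga unfolding invariance_gap_def by blast
    qed
  qed
qed

end
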